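(* Let $I\subset\mathbb R$ be a compact interval, $\mu\ge 0$, and let $H(t)$, $t\in I$, be a family of symmetric operators on $\mathcal H$ such that the equation $\mathrm i\partial_t u(t)=H(t)u(t)$ generates a unitary propagator $U(t,s):\mathcal H\to\mathcal H$, $s,t\in I$ (unitary, strongly continuous in $(t,s)$, $U(t,r)U(r,s)=U(t,s)$, $U(s,s)=\mathbf 1$). Assume: (i) each $H(t)$ extends to a bounded operator $\mathcal H^\mu\to\mathcal H$; (ii) $t\mapsto H(t)$ is continuous from $I$ to $\mathcal L(\mathcal H^\mu,\mathcal H)$; (iii) $U(t,s)$ preserves $\mathcal H^\mu$, and for every $u\in\mathcal H^\mu$, $(t,s)\mapsto U(t,s)u$ is continuous from $I\times I$ to $\mathcal H^\mu$; (iv) for every $u\in\mathcal H^\mu$, $t\mapsto U(t,s)u$ is a strong solution of $\mathrm i\partial_tu(t)=H(t)u(t)$ with values in $\mathcal H$. Let $u\in\mathcal H^\mu$. Then $$U(t,s)u=\lim_{N\to\infty}\lim_{M\to\infty}U_{N,M}(t,s)P_Nu$$ strongly in $\mathcal H$, uniformly for $(t,s)\in I\times I$, where the inner limit is along partitions with $M$ steps whose mesh tends to $0$. Equivalently, the finite-dimensional state-sum representation $$\sum_{a_M=1}^{d_N}\sum_{a_0=1}^{d_N}\mathcal A_{N,M}(a_M,a_0;t,s)\,\langle e_{N,a_0},u\rangle\, e_{N,a_M}$$ of $U_{N,M}(t,s)P_Nu$ converges to $U(t,s)u$ in this iterated sense.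
   Context: $\mathcal H$ is a complex separable Hilbert space and $H_0$ a positive self-adjoint operator on $\mathcal H$ with compact resolvent (spectrum contained in $[0,\infty)$). For $N>0$, $P_N=\mathbf 1_{[0,N]}(H_0)$, $\mathcal H_N=P_N\mathcal H$, $d_N=\dim\mathcal H_N<\infty$, and $(e_{N,1},\dots,e_{N,d_N})$ is an orthonormal basis of $\mathcal H_N$. For $r\ge0$, $\mathcal H^r=D((1+H_0)^r)$ with norm $\|(1+H_0)^ru\|$. $H_N(t)=P_NH(t)P_N$ on $\mathcal H_N$. For a partition $s=t_0<t_1<\dots<t_M=t$ with $\Delta t_j=t_{j+1}-t_j$ and mesh $\max_j\Delta t_j$, set $E_{N,j}=\exp(-\mathrm i\Delta t_jH_N(t_j))$ and $U_{N,M}(t,s)=E_{N,M-1}\cdots E_{N,0}$ (for $t<s$, $U_{N,M}(t,s)$ is the inverse of $U_{N,M}(s,t)$ for a partition of $[t,s]$, with $\mathcal A_{N,M}$ its matrix entries). With $E_{N,j}(a,b)=\langle e_{N,a},E_{N,j}e_{N,b}\rangle$ (scalar product linear in the second variable here), the state-sum amplitude is $$\mathcal A_{N,M}(a_M,a_0;t,s)=\sum_{a_1,\dots,a_{M-1}=1}^{d_N}\prod_{j=0}^{M-1}E_{N,j}(a_{j+1},a_j)=\langle e_{N,a_M},U_{N,M}(t,s)e_{N,a_0}\rangle .$$ *)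

theory Defs
  imports "HOL-Analysis.Analysis"
begin

section \<open>Complex Hilbert spaces\<close>

text \<open>
  The library only has real inner product spaces. A complex Hilbert space is a complete one
  together with a compatible complex structure; the underlying real inner product is the real
  part of the complex one, so the library norm is the Hilbert space norm. The complex inner
  product is linear in the second variable.
\<close>

class complex_hilbert = real_inner + complete_space +
  fixes scaleC :: "complex \<Rightarrow> 'a \<Rightarrow> 'a"  (infixr \<open>*\<^sub>C\<close> 75)
    and cinner :: "'a \<Rightarrow> 'a \<Rightarrow> complex"
  assumes scaleC_add_right: "c *\<^sub>C (x + y) = c *\<^sub>C x + c *\<^sub>C y"
    and scaleC_add_left: "(c + d) *\<^sub>C x = c *\<^sub>C x + d *\<^sub>C x"
    and scaleC_scaleC: "c *\<^sub>C (d *\<^sub>C x) = (c * d) *\<^sub>C x"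
    and scaleC_of_real: "complex_of_real r *\<^sub>C x = r *\<^sub>R x"
    and cinner_commute: "cinner x y = cnj (cinner y x)"
    and cinner_add_right: "cinner x (y + z) = cinner x y + cinner x z"
    and cinner_scaleC_right: "cinner x (c *\<^sub>C y) = c * cinner x y"
    and Re_cinner: "Re (cinner x y) = inner x y"

global_interpretation complex_vector:
  vector_space "scaleC :: complex \<Rightarrow> 'a \<Rightarrow> 'a::complex_hilbert"
proof
  fix x :: 'a
  show "1 *\<^sub>C x = x"
    using scaleC_of_real[of 1 x] by simp
qed (simp_all add: scaleC_add_right scaleC_add_left scaleC_scaleC)

instantiation complex :: complex_hilbert
begin

definition scaleC_complex :: "complex \<Rightarrow> complex \<Rightarrow> complex"
  where "scaleC_complex c x = c * x"

definition cinner_complex :: "complex \<Rightarrow> complex \<Rightarrow> complex"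
  where "cinner_complex x y = cnj x * y"

instance
  by standard
    (simp_all add: scaleC_complex_def cinner_complex_def algebra_simps scaleR_conv_of_real
      inner_complex_def)

end

definition is_orthonormal_basis :: "nat \<Rightarrow> (nat \<Rightarrow> 'a::complex_hilbert) \<Rightarrow> 'a set \<Rightarrow> bool"
  where "is_orthonormal_basis d e V \<longleftrightarrow>
    (\<forall>a\<in>{1..d}. \<forall>b\<in>{1..d}. cinner (e a) (e b) = (if a = b then 1 else 0)) \<and>
    complex_vector.span (e ` {1..d}) = V"

text \<open>Only used for closed subspaces, where the projection exists and is unique.\<close>

definition orth_proj :: "'a::complex_hilbert set \<Rightarrow> 'a \<Rightarrow> 'a"
  where "orth_proj V u = (THE v. v \<in> V \<and> (\<forall>w\<in>V. cinner w (u - v) = 0))"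


section \<open>Unbounded operators\<close>

text \<open>
  An operator is a pair of a domain and a map; the values of the map outside the domain are
  irrelevant.
\<close>

type_synonym 'a operator = "'a set \<times> ('a \<Rightarrow> 'a)"

abbreviation opdom :: "'a operator \<Rightarrow> 'a set"
  where "opdom T \<equiv> fst T"

abbreviation opapp :: "'a operator \<Rightarrow> 'a \<Rightarrow> 'a"
  where "opapp T \<equiv> snd T"

definition complex_linear_on :: "'a::complex_hilbert set \<Rightarrow> ('a \<Rightarrow> 'a) \<Rightarrow> bool"
  where "complex_linear_on V A \<longleftrightarrow> complex_vector.subspace V \<and>
    (\<forall>x\<in>V. \<forall>y\<in>V. A (x + y) = A x + A y) \<and> (\<forall>c. \<forall>x\<in>V. A (c *\<^sub>C x) = c *\<^sub>C A x)"

definition densely_defined :: "'a::complex_hilbert operator \<Rightarrow> bool"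
  where "densely_defined T \<longleftrightarrow> complex_linear_on (opdom T) (opapp T) \<and> closure (opdom T) = UNIV"

definition symmetric_operator :: "'a::complex_hilbert operator \<Rightarrow> bool"
  where "symmetric_operator T \<longleftrightarrow> densely_defined T \<and>
    (\<forall>u\<in>opdom T. \<forall>v\<in>opdom T. cinner (opapp T u) v = cinner u (opapp T v))"

text \<open>The graphs of the operator and of its adjoint coincide.\<close>

definition self_adjoint :: "'a::complex_hilbert operator \<Rightarrow> bool"
  where "self_adjoint T \<longleftrightarrow> densely_defined T \<and>
    (\<forall>v w. (v \<in> opdom T \<and> opapp T v = w) \<longleftrightarrow> (\<forall>u\<in>opdom T. cinner v (opapp T u) = cinner w u))"

definition positive_operator :: "'a::complex_hilbert operator \<Rightarrow> bool"
  where "positive_operator T \<longleftrightarrow> (\<forall>u\<in>opdom T. 0 \<le> Re (cinner u (opapp T u)))"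

definition compact_operator :: "('a::complex_hilbert \<Rightarrow> 'a) \<Rightarrow> bool"
  where "compact_operator A \<longleftrightarrow> complex_linear_on UNIV A \<and>
    (\<forall>B. bounded B \<longrightarrow> compact (closure (A ` B)))"

definition compact_resolvent :: "'a::complex_hilbert operator \<Rightarrow> bool"
  where "compact_resolvent T \<longleftrightarrow>
    (\<exists>z. bij_betw (\<lambda>u. opapp T u - z *\<^sub>C u) (opdom T) UNIV \<and>
         compact_operator (inv_into (opdom T) (\<lambda>u. opapp T u - z *\<^sub>C u)))"


section \<open>Functional calculus of an operator with compact resolvent\<close>

text \<open>
  The spectrum of a self-adjoint operator with compact resolvent consists of eigenvalues, so its
  spectral measure is the sum of the point masses given by the projections onto the eigenspaces
  (these are zero at real numbers that are not eigenvalues).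
\<close>

definition eigenspace :: "'a::complex_hilbert operator \<Rightarrow> real \<Rightarrow> 'a set"
  where "eigenspace T l = {v \<in> opdom T. opapp T v = l *\<^sub>R v}"

definition fun_calc :: "'a::complex_hilbert operator \<Rightarrow> (real \<Rightarrow> real) \<Rightarrow> 'a operator"
  where "fun_calc T f =
    ({u. (\<lambda>l. (f l)\<^sup>2 * (norm (orth_proj (eigenspace T l) u))\<^sup>2) summable_on UNIV},
     \<lambda>u. \<Sum>\<^sub>\<infinity>l. f l *\<^sub>R orth_proj (eigenspace T l) u)"

definition spectral_proj :: "'a::complex_hilbert operator \<Rightarrow> real \<Rightarrow> 'a \<Rightarrow> 'a"
  where "spectral_proj H0 N = opapp (fun_calc H0 (indicator {0..N}))"

definition spectral_space :: "'a::complex_hilbert operator \<Rightarrow> real \<Rightarrow> 'a set"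
  where "spectral_space H0 N = range (spectral_proj H0 N)"

definition sobolev :: "'a::complex_hilbert operator \<Rightarrow> real \<Rightarrow> 'a set"
  where "sobolev H0 r = opdom (fun_calc H0 (\<lambda>l. (1 + l) powr r))"

definition sobolev_norm :: "'a::complex_hilbert operator \<Rightarrow> real \<Rightarrow> 'a \<Rightarrow> real"
  where "sobolev_norm H0 r u = norm (opapp (fun_calc H0 (\<lambda>l. (1 + l) powr r)) u)"

definition sobolev_bounded :: "'a::complex_hilbert operator \<Rightarrow> real \<Rightarrow> ('a \<Rightarrow> 'a) \<Rightarrow> bool"
  where "sobolev_bounded H0 r A \<longleftrightarrow> complex_linear_on (sobolev H0 r) A \<and>
    (\<exists>C. \<forall>u\<in>sobolev H0 r. norm (A u) \<le> C * sobolev_norm H0 r u)"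

text \<open>The norm of bounded operators from \<open>sobolev H0 r\<close> to the Hilbert space.\<close>

definition sobolev_opnorm :: "'a::complex_hilbert operator \<Rightarrow> real \<Rightarrow> ('a \<Rightarrow> 'a) \<Rightarrow> real"
  where "sobolev_opnorm H0 r A =
    (SUP u\<in>{u \<in> sobolev H0 r. sobolev_norm H0 r u \<le> 1}. norm (A u))"


section \<open>Propagators\<close>

definition unitary_operator :: "('a::complex_hilbert \<Rightarrow> 'a) \<Rightarrow> bool"
  where "unitary_operator A \<longleftrightarrow> complex_linear_on UNIV A \<and> surj A \<and>
    (\<forall>x y. cinner (A x) (A y) = cinner x y)"

definition unitary_propagator ::
    "real set \<Rightarrow> (real \<Rightarrow> real \<Rightarrow> 'a::complex_hilbert \<Rightarrow> 'a) \<Rightarrow> bool"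
  where "unitary_propagator I U \<longleftrightarrow>
    (\<forall>t\<in>I. \<forall>s\<in>I. unitary_operator (U t s)) \<and>
    (\<forall>v. continuous_on (I \<times> I) (\<lambda>(t, s). U t s v)) \<and>
    (\<forall>t\<in>I. \<forall>r\<in>I. \<forall>s\<in>I. \<forall>v. U t r (U r s v) = U t s v) \<and>
    (\<forall>s\<in>I. \<forall>v. U s s v = v)"


section \<open>Finite-dimensional time slicing\<close>

text \<open>The trivial partition with \<open>M = 0\<close> steps is the only one of a degenerate interval.\<close>

definition is_partition :: "real \<Rightarrow> real \<Rightarrow> nat \<Rightarrow> (nat \<Rightarrow> real) \<Rightarrow> bool"
  where "is_partition a b M \<tau> \<longleftrightarrow> \<tau> 0 = a \<and> \<tau> M = b \<and> (\<forall>j<M. \<tau> j < \<tau> (Suc j))"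

definition mesh :: "nat \<Rightarrow> (nat \<Rightarrow> real) \<Rightarrow> real"
  where "mesh M \<tau> = Max (insert 0 ((\<lambda>j. \<tau> (Suc j) - \<tau> j) ` {..<M}))"

definition op_exp :: "('a::real_normed_vector \<Rightarrow> 'a) \<Rightarrow> 'a \<Rightarrow> 'a"
  where "op_exp A v = (\<Sum>n. (A ^^ n) v /\<^sub>R fact n)"

definition truncated :: "'a::complex_hilbert operator \<Rightarrow> real \<Rightarrow> ('a \<Rightarrow> 'a) \<Rightarrow> 'a \<Rightarrow> 'a"
  where "truncated H0 N A v = spectral_proj H0 N (A (spectral_proj H0 N v))"

definition short_step ::
    "'a::complex_hilbert operator \<Rightarrow> (real \<Rightarrow> 'a \<Rightarrow> 'a) \<Rightarrow> real \<Rightarrow> (nat \<Rightarrow> real) \<Rightarrow> nat \<Rightarrow> 'a \<Rightarrow> 'a"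
  where "short_step H0 H N \<tau> j =
    op_exp (\<lambda>v. (- \<i> * complex_of_real (\<tau> (Suc j) - \<tau> j)) *\<^sub>C truncated H0 N (H (\<tau> j)) v)"

primrec time_ordered :: "(nat \<Rightarrow> 'a \<Rightarrow> 'a) \<Rightarrow> nat \<Rightarrow> 'a \<Rightarrow> 'a" where
  "time_ordered E 0 = id"
| "time_ordered E (Suc j) = E j \<circ> time_ordered E j"

text \<open>
  For \<open>t < s\<close> the argument \<open>\<tau>\<close> is a partition of \<open>{t..s}\<close>, and the operator is inverted
  on the finite-dimensional space \<open>spectral_space H0 N\<close>.
\<close>

definition approx_propagator ::
    "'a::complex_hilbert operator \<Rightarrow> (real \<Rightarrow> 'a \<Rightarrow> 'a) \<Rightarrow> real \<Rightarrow> real \<Rightarrow> real \<Rightarrow>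
      nat \<Rightarrow> (nat \<Rightarrow> real) \<Rightarrow> 'a \<Rightarrow> 'a"
  where "approx_propagator H0 H N t s M \<tau> =
    (if s \<le> t then time_ordered (short_step H0 H N \<tau>) M
     else inv_into (spectral_space H0 N) (time_ordered (short_step H0 H N \<tau>) M))"

text \<open>
  For \<open>s \<le> t\<close> the sum is over all index paths \<open>(p 0, \<dots>, p M)\<close> with fixed end points
  \<open>p 0 = b\<close> and \<open>p M = a\<close>; for \<open>M = 0\<close> it is the Kronecker delta.
\<close>

definition amplitude ::
    "'a::complex_hilbert operator \<Rightarrow> (real \<Rightarrow> 'a \<Rightarrow> 'a) \<Rightarrow> (nat \<Rightarrow> 'a) \<Rightarrow> real \<Rightarrow> real \<Rightarrow> real \<Rightarrow>
      nat \<Rightarrow> (nat \<Rightarrow> real) \<Rightarrow> nat \<Rightarrow> nat \<Rightarrow> complex"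
  where "amplitude H0 H e N t s M \<tau> a b =
    (if s \<le> t then
       \<Sum>p \<in> {p \<in> {0..M} \<rightarrow>\<^sub>E {1..complex_vector.dim (spectral_space H0 N)}. p 0 = b \<and> p M = a}.
         \<Prod>j<M. cinner (e (p (Suc j))) (short_step H0 H N \<tau> j (e (p j)))
     else cinner (e a) (approx_propagator H0 H N t s M \<tau> (e b)))"

definition state_sum ::
    "'a::complex_hilbert operator \<Rightarrow> (real \<Rightarrow> 'a \<Rightarrow> 'a) \<Rightarrow> (nat \<Rightarrow> 'a) \<Rightarrow> real \<Rightarrow> real \<Rightarrow> real \<Rightarrow>
      nat \<Rightarrow> (nat \<Rightarrow> real) \<Rightarrow> 'a \<Rightarrow> 'a"
  where "state_sum H0 H e N t s M \<tau> u =
    (\<Sum>a = 1..complex_vector.dim (spectral_space H0 N).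
       \<Sum>b = 1..complex_vector.dim (spectral_space H0 N).
         (amplitude H0 H e N t s M \<tau> a b * cinner (e b) u) *\<^sub>C e a)"

text \<open>
  Convergence, uniformly in \<open>(t, s) \<in> I \<times> I\<close>, along partitions of the interval between \<open>s\<close>
  and \<open>t\<close> whose mesh tends to zero. For \<open>s \<noteq> t\<close> the number \<open>M\<close> of steps then tends to
  infinity.
\<close>

definition uniform_mesh_limit ::
    "real set \<Rightarrow> (real \<Rightarrow> real \<Rightarrow> nat \<Rightarrow> (nat \<Rightarrow> real) \<Rightarrow> 'a::metric_space) \<Rightarrow>
      (real \<Rightarrow> real \<Rightarrow> 'a) \<Rightarrow> bool"
  where "uniform_mesh_limit I F L \<longleftrightarrow>
    (\<forall>\<epsilon>>0. \<exists>\<delta>>0. \<forall>t\<in>I. \<forall>s\<in>I. \<forall>M \<tau>.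
       is_partition (min s t) (max s t) M \<tau> \<and> mesh M \<tau> < \<delta> \<longrightarrow> dist (F t s M \<tau>) (L t s) < \<epsilon>)"

end

theory Submission
  imports Defs
begin

text \<open>
  By the spectral theorem for the compact operator \<open>(1 + H0)\<^sup>-\<^sup>1\<close>, the projections \<open>P\<^sub>N\<close> converge
  strongly to the identity and commute with the Sobolev weight \<open>\<Lambda> = (1 + H0)\<^sup>\<mu>\<close>. Unitarity of the
  propagator makes \<open>K t\<close> symmetric on the Sobolev space, so the truncated generators
  \<open>- \<i> P\<^sub>N K t P\<^sub>N\<close> are bounded, skew and norm continuous. For skew generators, a function that
  solves the evolution equation up to an error \<open>\<epsilon>\<close> stays within \<open>\<epsilon> \<bar>t - s\<bar>\<close> of the
  exact solution. Applied to piecewise constant generators this gives convergence of the time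
  slicing to the truncated propagator. Applied to \<open>P\<^sub>N U t s u\<close>, which solves the truncated equation
  up to \<open>P\<^sub>N K t (1 - P\<^sub>N) U t s u\<close>, it gives the limit \<open>N \<rightarrow> \<infinity>\<close>: the error is bounded by
  \<open>\<parallel>(1 - P\<^sub>N) \<Lambda> U t s u\<parallel>\<close>, which tends to zero uniformly because \<open>\<Lambda> U t s u\<close>
  ranges over a compact set. The state sum is the matrix product written out over index paths.
\<close>

section \<open>Hilbert space geometry\<close>

text \<open>The norms of the truncated generators need not stay bounded in \<open>N\<close>, so a
  Gronwall factor would spoil the limit \<open>N \<rightarrow> \<infinity>\<close>. Every estimate
  therefore pairs an error with its derivative: a skew generator drops out of the inner product and
  only the defect of the equation remains. That defect contains the unbounded \<open>K t\<close>,
  which is tamed by factoring it on the Sobolev space as a bounded operator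
  \<open>K_weighted t\<close> applied after the weight; only the tail of the weighted trajectory has
  to be small. Skewness is read off by differentiating the constant squared norm of
  \<open>U r t v\<close> at \<open>r = t\<close>. This needs \<open>t\<close> to be a limit point of
  \<open>I\<close>, so a one-point interval is treated apart. For \<open>t < s\<close> the slices
  are isometries of the spectral space, and the error of the inverse equals the forward error. The
  estimates use the real inner product; the imaginary part is recovered by testing with multiples of
  \<open>\<i>\<close>.\<close>

instance complex_hilbert \<subseteq> banach ..

section \<open>The complex structure expressed through the real inner product\<close>

lemma complex_subspace_imp_subspace:
  fixes V :: "'a::complex_hilbert set"
  assumes "complex_vector.subspace V"
  shows "subspace V"
  unfolding subspace_def
  using complex_vector.subspace_0[OF assms] complex_vector.subspace_add[OF assms]
    complex_vector.subspace_scale[OF assms, of _ "complex_of_real _"]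
  by (simp add: scaleC_of_real)

lemma cinner_scaleC_left: "cinner (c *\<^sub>C x) y = cnj c * cinner x (y::'a::complex_hilbert)"
  by (metis cinner_commute cinner_scaleC_right complex_cnj_mult)

lemma cinner_diff_right: "cinner x (y - z) = cinner x y - cinner x (z::'a::complex_hilbert)"
  by (metis add_diff_cancel_right' cinner_add_right diff_add_cancel)

lemma cinner_zero_right [simp]: "cinner x (0::'a::complex_hilbert) = 0"
  using cinner_diff_right[of x 0 0] by simp

lemma cinner_sum_right: "cinner x (\<Sum>i\<in>A. f i) = (\<Sum>i\<in>A. cinner x (f i :: 'a::complex_hilbert))"
  by (induction A rule: infinite_finite_induct) (auto simp: cinner_add_right)

lemma Im_cinner: "Im (cinner x y) = inner (\<i> *\<^sub>C x) (y::'a::complex_hilbert)"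
  by (simp flip: Re_cinner add: cinner_scaleC_left)

lemma cinner_eq: "cinner x y = Complex (inner x y) (inner (\<i> *\<^sub>C x) (y::'a::complex_hilbert))"
  by (simp add: complex_eq_iff Im_cinner Re_cinner)

lemma cinner_self: "cinner x x = complex_of_real ((norm (x::'a::complex_hilbert))\<^sup>2)"
proof -
  have "Im (cinner x x) = 0"
    using cinner_commute[of x x] by (metis Reals_cnj_iff complex_is_Real_iff)
  then show ?thesis
    by (simp add: complex_eq_iff Re_cinner power2_norm_eq_inner)
qed

lemma norm_scaleC: "norm (c *\<^sub>C x) = cmod c * norm (x::'a::complex_hilbert)"
proof -
  have "complex_of_real ((norm (c *\<^sub>C x))\<^sup>2) = cnj c * c * cinner x x"
    unfolding cinner_self[symmetric] by (simp add: cinner_scaleC_left cinner_scaleC_right)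
  also have "\<dots> = complex_of_real ((cmod c * norm x)\<^sup>2)"
    by (simp add: cinner_self power_mult_distrib mult.commute[of "cnj c"] flip: complex_norm_square)
  finally have "(norm (c *\<^sub>C x))\<^sup>2 = (cmod c * norm x)\<^sup>2"
    using of_real_eq_iff by blast
  then show ?thesis
    by (simp add: power2_eq_iff_nonneg)
qed

lemma bounded_linear_scaleC: "bounded_linear (\<lambda>x::'a::complex_hilbert. c *\<^sub>C x)"
proof (rule bounded_linear_intro[where K = "cmod c"])
  show "c *\<^sub>C (r *\<^sub>R x) = r *\<^sub>R c *\<^sub>C x" for r and x :: 'a
    by (simp flip: scaleC_of_real add: scaleC_scaleC mult.commute)
qed (auto simp: scaleC_add_right norm_scaleC)

lemma scaleC_scaleR: "c *\<^sub>C (r *\<^sub>R x) = r *\<^sub>R (c *\<^sub>C (x::'a::complex_hilbert))"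
  by (simp flip: scaleC_of_real add: scaleC_scaleC mult.commute)

text \<open>A complex subspace contains \<open>\<i> *\<^sub>C w\<close> along with \<open>w\<close>,
  and the imaginary part of \<open>cinner w x\<close> is \<open>inner (\<i> *\<^sub>C w) x\<close>.
  The real inner product thus suffices to test orthogonality.\<close>

lemma cinner_zero_iff_inner_zero:
  fixes V :: "'a::complex_hilbert set"
  assumes "complex_vector.subspace V"
  shows "(\<forall>w\<in>V. cinner w x = 0) \<longleftrightarrow> (\<forall>w\<in>V. inner w x = 0)"
  using complex_vector.subspace_scale[OF assms] by (auto simp: cinner_eq zero_complex.code)

text \<open>A minimizing sequence for the distance is Cauchy by the parallelogram law, and its limit
  is orthogonal by variation. The real setting also covers the range of \<open>A + 1\<close> in
  \<open>A_plus_surj\<close>, which is treated there as a real subspace.\<close>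

lemma projection_exists:
  fixes V :: "'a::{real_inner,complete_space} set"
  assumes V: "subspace V" "closed V"
  obtains v where "v \<in> V" "\<And>w. w \<in> V \<Longrightarrow> inner w (u - v) = 0"
proof -
  define \<delta> where "\<delta> = (INF v\<in>V. (norm (u - v))\<^sup>2)"
  have bdd: "bdd_below ((\<lambda>v. (norm (u - v))\<^sup>2) ` V)"
    by (rule bdd_belowI2[of _ 0]) simp
  have ne: "V \<noteq> {}"
    using subspace_0[OF V(1)] by auto
  have le: "\<delta> \<le> (norm (u - v))\<^sup>2" if "v \<in> V" for v
    unfolding \<delta>_def using bdd that by (rule cINF_lower)
  have "\<exists>v\<in>V. (norm (u - v))\<^sup>2 < \<delta> + 1 / real (Suc n)" for n
    using cINF_less_iff[OF ne bdd, of "\<delta> + 1 / real (Suc n)"] by (auto simp: \<delta>_def)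
  then obtain X where X: "\<And>n. X n \<in> V" "\<And>n. (norm (u - X n))\<^sup>2 < \<delta> + 1 / real (Suc n)"
    by metis
  have dist2: "(norm (X m - X n))\<^sup>2 \<le> 2 / real (Suc m) + 2 / real (Suc n)" for m n
  proof -
    \<comment> \<open>The midpoint lies in \<open>V\<close>, so its distance is at least the
      infimum; the parallelogram identity turns this into a bound on
      \<open>X m - X n\<close>.\<close>
    have "(1/2) *\<^sub>R (X m + X n) \<in> V"
      using X(1) V(1) by (simp add: subspace_add subspace_scale)
    then have "\<delta> \<le> (norm (u - (1/2) *\<^sub>R (X m + X n)))\<^sup>2"
      by (rule le)
    also have "\<dots> = (2 * (norm (u - X m))\<^sup>2 + 2 * (norm (u - X n))\<^sup>2 - (norm (X m - X n))\<^sup>2) / 4"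
      by (simp add: power2_norm_eq_inner algebra_simps inner_commute)
    finally show ?thesis
      using X(2)[of m] X(2)[of n] by simp
  qed
  have "Cauchy X"
  proof (rule metric_CauchyI)
    fix e :: real assume "0 < e"
    then obtain k where k: "4 / e\<^sup>2 < real k"
      using reals_Archimedean2 by blast
    have "dist (X m) (X n) < e" if "k \<le> m" "k \<le> n" for m n
    proof -
      have "4 / e\<^sup>2 < real (Suc j)" if "k \<le> j" for j
        using k that by linarith
      then have "2 / real (Suc j) < e\<^sup>2 / 2" if "k \<le> j" for j
        using that \<open>0 < e\<close> by (simp add: field_simps del: of_nat_Suc)
      from this[OF that(1)] this[OF that(2)] have "(norm (X m - X n))\<^sup>2 < e\<^sup>2"
        using dist2[of m n] by linarith
      then show ?thesis
        using \<open>0 < e\<close> by (simp add: dist_norm power2_less_imp_less)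
    qed
    then show "\<exists>M. \<forall>m\<ge>M. \<forall>n\<ge>M. dist (X m) (X n) < e"
      by blast
  qed
  then obtain v where lim: "X \<longlonglongrightarrow> v"
    using Cauchy_convergent_iff convergent_def by blast
  then have v: "v \<in> V"
    using V(2) X(1) closed_sequentially by blast
  have "(norm (u - v))\<^sup>2 \<le> \<delta>"
  proof (rule LIMSEQ_le)
    show "(\<lambda>n. (norm (u - X n))\<^sup>2) \<longlonglongrightarrow> (norm (u - v))\<^sup>2"
      by (intro tendsto_intros lim)
    show "(\<lambda>n. \<delta> + 1 / real (Suc n)) \<longlonglongrightarrow> \<delta>"
      using tendsto_add[OF tendsto_const LIMSEQ_inverse_real_of_nat, of \<delta>]
      by (simp add: inverse_eq_divide)
    show "\<exists>N. \<forall>n\<ge>N. (norm (u - X n))\<^sup>2 \<le> \<delta> + 1 / real (Suc n)"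
      using X(2) less_imp_le by blast
  qed
  have "inner w (u - v) = 0" if w: "w \<in> V" for w
  proof (cases "w = 0")
    case False
    \<comment> \<open>The minimizer in \<open>t\<close> of the squared distance from
      \<open>u\<close> to \<open>v + t *\<^sub>R w\<close>; a nonzero inner product would let it
      undercut the infimum.\<close>
    define t where "t = inner w (u - v) / (norm w)\<^sup>2"
    have "v + t *\<^sub>R w \<in> V"
      using v w V(1) by (simp add: subspace_add subspace_scale)
    then have "(norm (u - v))\<^sup>2 \<le> (norm (u - (v + t *\<^sub>R w)))\<^sup>2"
      using le[of "v + t *\<^sub>R w"] \<open>(norm (u - v))\<^sup>2 \<le> \<delta>\<close> by linarith
    also have "\<dots> = (norm (u - v))\<^sup>2 - 2 * t * inner w (u - v) + t\<^sup>2 * (norm w)\<^sup>2"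
      unfolding power2_norm_eq_inner by (simp add: algebra_simps inner_commute power2_eq_square)
    also have "\<dots> = (norm (u - v))\<^sup>2 - (inner w (u - v))\<^sup>2 / (norm w)\<^sup>2"
      using False by (simp add: t_def field_simps power2_eq_square)
    finally have "(inner w (u - v))\<^sup>2 / (norm w)\<^sup>2 \<le> 0"
      by simp
    then show ?thesis
      using False by (simp add: divide_le_0_iff)
  qed simp
  with v that show ?thesis
    by blast
qed

text \<open>Justifies the definite description: the difference of two candidates lies in
  \<open>V\<close> and is orthogonal to itself.\<close>

lemma orth_proj_eqI:
  fixes V :: "'a::complex_hilbert set"
  assumes V: "complex_vector.subspace V" and v: "v \<in> V" "\<And>w. w \<in> V \<Longrightarrow> inner w (u - v) = 0"
  shows "orth_proj V u = v"
  unfolding orth_proj_def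
proof (rule the_equality)
  show "v \<in> V \<and> (\<forall>w\<in>V. cinner w (u - v) = 0)"
    using v cinner_zero_iff_inner_zero[OF V] by blast
  fix v' assume "v' \<in> V \<and> (\<forall>w\<in>V. cinner w (u - v') = 0)"
  then have v': "v' \<in> V" "\<And>w. w \<in> V \<Longrightarrow> inner w (u - v') = 0"
    using cinner_zero_iff_inner_zero[OF V] by blast+
  have d: "v' - v \<in> V"
    using complex_vector.subspace_diff[OF V] v v' by blast
  have "inner (v' - v) ((u - v) - (u - v')) = 0"
    unfolding inner_diff_right[of _ "u - v"] using v(2)[OF d] v'(2)[OF d] by simp
  then show "v' = v"
    by simp
qed

locale closed_complex_subspace =
  fixes V :: "'a::complex_hilbert set"
  assumes subspace: "complex_vector.subspace V" and closed: "closed V"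
begin

lemma orth_proj_in: "orth_proj V u \<in> V"
  and orth_proj_orthogonal: "w \<in> V \<Longrightarrow> inner w (u - orth_proj V u) = 0"
proof -
  obtain v where "v \<in> V" "\<And>w. w \<in> V \<Longrightarrow> inner w (u - v) = 0"
    using projection_exists[OF complex_subspace_imp_subspace[OF subspace] closed] by metis
  with orth_proj_eqI[OF subspace this]
  show "orth_proj V u \<in> V" "w \<in> V \<Longrightarrow> inner w (u - orth_proj V u) = 0"
    by auto
qed

lemma orth_proj_inner: "w \<in> V \<Longrightarrow> inner w (orth_proj V u) = inner w u"
  using orth_proj_orthogonal[of w u] by (simp add: inner_diff_right)

lemma orth_proj_id: "v \<in> V \<Longrightarrow> orth_proj V v = v"
  by (rule orth_proj_eqI[OF subspace]) auto

lemma orth_proj_zero: "(\<And>w. w \<in> V \<Longrightarrow> inner w u = 0) \<Longrightarrow> orth_proj V u = 0"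
  by (rule orth_proj_eqI[OF subspace]) (auto simp: complex_vector.subspace_0[OF subspace])

lemma orth_proj_add: "orth_proj V (x + y) = orth_proj V x + orth_proj V y"
proof (rule orth_proj_eqI[OF subspace])
  show "orth_proj V x + orth_proj V y \<in> V"
    using orth_proj_in complex_vector.subspace_add[OF subspace] by blast
qed (simp add: inner_diff_right inner_add_right orth_proj_inner)

lemma orth_proj_scaleC: "orth_proj V (c *\<^sub>C x) = c *\<^sub>C orth_proj V x"
proof (rule orth_proj_eqI[OF subspace])
  show "c *\<^sub>C orth_proj V x \<in> V"
    using orth_proj_in complex_vector.subspace_scale[OF subspace] by blast
  fix w assume w: "w \<in> V"
  have "cinner w (x - orth_proj V x) = 0"
    using w orth_proj_orthogonal cinner_zero_iff_inner_zero[OF subspace] by blast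
  then have "Re (cinner w (c *\<^sub>C (x - orth_proj V x))) = 0"
    by (simp add: cinner_scaleC_right)
  then show "inner w (c *\<^sub>C x - c *\<^sub>C orth_proj V x) = 0"
    by (simp add: Re_cinner complex_vector.scale_right_diff_distrib)
qed

lemma norm_orth_proj_le: "norm (orth_proj V x) \<le> norm x"
proof -
  have "(norm (orth_proj V x))\<^sup>2 \<le> norm (orth_proj V x) * norm x"
    using orth_proj_inner[OF orth_proj_in, of x x] norm_cauchy_schwarz[of "orth_proj V x" x]
    by (simp add: power2_norm_eq_inner)
  then show ?thesis
    by (cases "orth_proj V x = 0") (auto simp: power2_eq_square)
qed

lemma bounded_linear_orth_proj: "bounded_linear (orth_proj V)"
proof (rule bounded_linear_intro[where K = 1])
  show "orth_proj V (r *\<^sub>R x) = r *\<^sub>R orth_proj V x" for r x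
    using orth_proj_scaleC[of "complex_of_real r"] by (simp add: scaleC_of_real)
qed (auto simp: orth_proj_add norm_orth_proj_le)

end

section \<open>Orthogonal families\<close>

lemma norm_sum_orthogonal:
  fixes x :: "'i \<Rightarrow> 'a::real_inner"
  assumes orth: "\<And>i j. i \<noteq> j \<Longrightarrow> inner (x i) (x j) = 0" and "finite F"
  shows "(norm (sum x F))\<^sup>2 = (\<Sum>i\<in>F. (norm (x i))\<^sup>2)"
  using \<open>finite F\<close>
proof (induction F)
  case (insert a F)
  have "inner (x a) (sum x F) = 0"
    using insert.hyps by (auto simp: inner_sum_right intro!: sum.neutral orth)
  with insert show ?case
    by (simp add: power2_norm_eq_inner inner_add_left inner_add_right inner_commute)
qed simp

text \<open>Finite partial sums form a Cauchy net, since by Pythagoras the squared norm of a block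
  is a block of the convergent series of squares. Summation is unordered because the index will be a
  real eigenvalue.\<close>

lemma orthogonal_summable_on:
  fixes x :: "'i \<Rightarrow> 'a::{real_inner,banach}"
  assumes orth: "\<And>i j. i \<noteq> j \<Longrightarrow> inner (x i) (x j) = 0"
    and sq: "(\<lambda>i. (norm (x i))\<^sup>2) summable_on UNIV"
  shows "x summable_on UNIV"
proof -
  have "\<exists>P. eventually P (finite_subsets_at_top UNIV) \<and>
          (\<forall>F F'. P F \<and> P F' \<longrightarrow> dist (sum x F) (sum x F') < e)" if "e > 0" for e
  proof -
    define S where "S = (\<Sum>\<^sub>\<infinity>i. (norm (x i))\<^sup>2)"
    \<comment> \<open>Accuracy \<open>(e/4)\<^sup>2\<close> for the squares becomes
      \<open>e/4\<close> for the vectors, so two partial sums beyond \<open>F0\<close> differ by at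
      most \<open>e/2\<close>.\<close>
    obtain F0 where F0: "finite F0" "dist (\<Sum>i\<in>F0. (norm (x i))\<^sup>2) S \<le> (e/4)\<^sup>2"
      using infsum_finite_approximation[OF sq, of "(e/4)\<^sup>2"] \<open>e > 0\<close> by (auto simp: S_def)
    have near: "dist (sum x F) (sum x F0) \<le> e/4" if F: "finite F" "F0 \<subseteq> F" for F
    proof -
      have "(norm (sum x (F - F0)))\<^sup>2 = (\<Sum>i\<in>F - F0. (norm (x i))\<^sup>2)"
        using F by (intro norm_sum_orthogonal orth) auto
      also have "\<dots> = (\<Sum>i\<in>F. (norm (x i))\<^sup>2) - (\<Sum>i\<in>F0. (norm (x i))\<^sup>2)"
        using F by (intro sum_diff) auto
      also have "\<dots> \<le> S - (\<Sum>i\<in>F0. (norm (x i))\<^sup>2)"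
        unfolding S_def using F by (intro diff_right_mono finite_sum_le_infsum[OF sq]) auto
      also have "\<dots> \<le> (e/4)\<^sup>2"
        using F0(2) by (simp add: dist_real_def)
      finally have "norm (sum x (F - F0)) \<le> e/4"
        by (rule power2_le_imp_le) (use \<open>e > 0\<close> in simp)
      then show ?thesis
        using F by (simp add: dist_norm sum_diff)
    qed
    show ?thesis
    proof (intro exI conjI allI impI)
      show "\<forall>\<^sub>F F in finite_subsets_at_top UNIV. finite F \<and> F0 \<subseteq> F"
        using F0(1) by (auto simp: eventually_finite_subsets_at_top)
      fix F F' assume *: "(finite F \<and> F0 \<subseteq> F) \<and> (finite F' \<and> F0 \<subseteq> F')"
      then have "dist (sum x F) (sum x F0) \<le> e/4" "dist (sum x F') (sum x F0) \<le> e/4"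
        using near by auto
      then show "dist (sum x F) (sum x F') < e"
        using dist_triangle2[of "sum x F" "sum x F'" "sum x F0"] \<open>e > 0\<close> by linarith
    qed
  qed
  then have "cauchy_filter (filtermap (sum x) (finite_subsets_at_top UNIV))"
    by (simp add: cauchy_filter_metric_filtermap)
  moreover have "complete (UNIV::'a set)"
    by (meson Cauchy_convergent UNIV_I complete_def convergent_def)
  ultimately obtain L where "(sum x \<longlongrightarrow> L) (finite_subsets_at_top UNIV)"
    using complete_uniform[where S=UNIV] by (force simp add: filterlim_def)
  then show ?thesis
    using summable_on_def has_sum_def by blast
qed

lemma has_sum_single_UNIV: "(\<And>j. j \<noteq> i \<Longrightarrow> f j = 0) \<Longrightarrow> (f has_sum f i) UNIV"
  by (rule has_sum_finite_neutralI[where B = "{i}"]) auto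

text \<open>Pairing the series with one of its terms leaves the square of that term; pairing it with
  its own sum then gives Parseval.\<close>

lemma orthogonal_has_sum_norm:
  fixes x :: "'i \<Rightarrow> 'a::real_inner"
  assumes orth: "\<And>i j. i \<noteq> j \<Longrightarrow> inner (x i) (x j) = 0" and S: "(x has_sum S) UNIV"
  shows "((\<lambda>i. (norm (x i))\<^sup>2) has_sum (norm S)\<^sup>2) UNIV"
proof -
  have "inner (x i) S = (norm (x i))\<^sup>2" for i
  proof (rule has_sum_unique)
    show "((\<lambda>j. inner (x i) (x j)) has_sum inner (x i) S) UNIV"
      by (rule has_sum_bounded_linear[OF bounded_linear_inner_right S])
    show "((\<lambda>j. inner (x i) (x j)) has_sum (norm (x i))\<^sup>2) UNIV"
      unfolding power2_norm_eq_inner by (rule has_sum_single_UNIV) (use orth in auto)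
  qed
  then show ?thesis
    using has_sum_bounded_linear[OF bounded_linear_inner_left S, of S]
    by (simp add: power2_norm_eq_inner)
qed

text \<open>
  Identities between vectors are proved by comparing their components, which determine
  them by totality.
\<close>

locale orth_resolution =
  fixes E :: "'i \<Rightarrow> 'a::complex_hilbert set"
  assumes closed_subspace: "closed_complex_subspace (E i)"
    and orthogonal: "i \<noteq> j \<Longrightarrow> v \<in> E i \<Longrightarrow> w \<in> E j \<Longrightarrow> inner v w = 0"
    and total: "(\<And>i v. v \<in> E i \<Longrightarrow> inner v x = 0) \<Longrightarrow> x = 0"
begin

section \<open>Components and diagonal operators\<close>

definition component :: "'i \<Rightarrow> 'a \<Rightarrow> 'a"
  where "component i = orth_proj (E i)"

text \<open>For the eigenspaces of an operator this is its functional calculus, with domain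
  \<open>diag_dom f\<close>; off that domain the sum is a default value.\<close>

definition diag :: "('i \<Rightarrow> real) \<Rightarrow> 'a \<Rightarrow> 'a"
  where "diag f x = (\<Sum>\<^sub>\<infinity>i. f i *\<^sub>R component i x)"

definition diag_dom :: "('i \<Rightarrow> real) \<Rightarrow> 'a set"
  where "diag_dom f = {x. (\<lambda>i. (f i)\<^sup>2 * (norm (component i x))\<^sup>2) summable_on UNIV}"

lemma comp_in: "component i x \<in> E i"
  unfolding component_def using closed_complex_subspace.orth_proj_in[OF closed_subspace] .

lemma comp_id: "x \<in> E i \<Longrightarrow> component i x = x"
  unfolding component_def using closed_complex_subspace.orth_proj_id[OF closed_subspace] .

lemma comp_other: "i \<noteq> j \<Longrightarrow> x \<in> E j \<Longrightarrow> component i x = 0"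
  unfolding component_def
  by (rule closed_complex_subspace.orth_proj_zero[OF closed_subspace]) (rule orthogonal)

lemma bounded_linear_comp: "bounded_linear (component i)"
  unfolding component_def by (rule closed_complex_subspace.bounded_linear_orth_proj[OF closed_subspace])

sublocale component: bounded_linear "component i" for i
  by (rule bounded_linear_comp)

lemma comp_scaleC: "component i (c *\<^sub>C x) = c *\<^sub>C component i x"
  unfolding component_def by (rule closed_complex_subspace.orth_proj_scaleC[OF closed_subspace])

lemma comp_inner: "w \<in> E i \<Longrightarrow> inner w (component i x) = inner w x"
  unfolding component_def by (rule closed_complex_subspace.orth_proj_inner[OF closed_subspace])

lemma comp_eqI:
  assumes "\<And>i. component i x = component i y"
  shows "x = y"
proof -
  have "inner v (x - y) = 0" if "v \<in> E i" for v i
    using comp_inner[OF that, of x] comp_inner[OF that, of y] assms by (simp add: inner_diff_right)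
  then show ?thesis
    using total[of "x - y"] by simp
qed

lemma scaleR_comp_in: "r *\<^sub>R component i x \<in> E i"
  using subspace_scale[OF complex_subspace_imp_subspace comp_in]
    closed_complex_subspace.subspace[OF closed_subspace] .

lemma orthogonal_components: "i \<noteq> j \<Longrightarrow> inner (f i *\<^sub>R component i x) (g j *\<^sub>R component j y) = 0"
  by (rule orthogonal[OF _ scaleR_comp_in scaleR_comp_in])

lemma comp_has_sum:
  assumes y: "(y has_sum S) UNIV" and "\<And>i. y i \<in> E i"
  shows "component i S = y i"
proof (rule has_sum_unique)
  show "((\<lambda>j. component i (y j)) has_sum component i S) UNIV"
    by (rule has_sum_bounded_linear[OF bounded_linear_comp y])
  show "((\<lambda>j. component i (y j)) has_sum y i) UNIV"
    using has_sum_single_UNIV[of i "\<lambda>j. component i (y j)"] comp_other[of i _ "y _"] assms(2)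
    by (simp add: comp_id[OF assms(2)]) metis
qed

lemma diag_has_sum: "x \<in> diag_dom f \<Longrightarrow> ((\<lambda>i. f i *\<^sub>R component i x) has_sum diag f x) UNIV"
  unfolding diag_def
  by (rule has_sum_infsum, rule orthogonal_summable_on)
    (auto simp: diag_dom_def orthogonal_components[unfolded inner_scaleR_left inner_scaleR_right] power_mult_distrib)

lemma comp_diag: "x \<in> diag_dom f \<Longrightarrow> component i (diag f x) = f i *\<^sub>R component i x"
  using comp_has_sum[OF diag_has_sum scaleR_comp_in] .

lemma norm_diag_has_sum:
  "x \<in> diag_dom f \<Longrightarrow> ((\<lambda>i. (f i)\<^sup>2 * (norm (component i x))\<^sup>2) has_sum (norm (diag f x))\<^sup>2) UNIV"
  using orthogonal_has_sum_norm[OF _ diag_has_sum[of x f]]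
  by (simp add: orthogonal_components power_mult_distrib del: inner_scaleR_left inner_scaleR_right)

text \<open>The partial sum \<open>s\<close> satisfies \<open>inner s x = (norm s)\<^sup>2\<close>,
  so the square of \<open>norm (x - s)\<close> is exactly the difference of the two sides.\<close>

lemma bessel:
  assumes "finite F"
  shows "(\<Sum>i\<in>F. (norm (component i x))\<^sup>2) \<le> (norm x)\<^sup>2"
proof -
  define s where "s = (\<Sum>i\<in>F. component i x)"
  have s2: "(norm s)\<^sup>2 = (\<Sum>i\<in>F. (norm (component i x))\<^sup>2)"
    unfolding s_def using assms orthogonal_components[of _ _ "\<lambda>_. 1" _ "\<lambda>_. 1"]
    by (intro norm_sum_orthogonal) auto
  have "inner s x = (norm s)\<^sup>2"
    unfolding s2 unfolding s_def inner_sum_left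
    by (rule sum.cong) (simp_all add: power2_norm_eq_inner comp_inner[OF comp_in])
  moreover have "(norm (x - s))\<^sup>2 = (norm x)\<^sup>2 - 2 * inner s x + (norm s)\<^sup>2"
    unfolding power2_norm_eq_inner by (simp add: inner_diff_left inner_diff_right inner_commute)
  ultimately have "(norm s)\<^sup>2 \<le> (norm x)\<^sup>2"
    using zero_le_power2[of "norm (x - s)"] by linarith
  then show ?thesis
    by (simp only: s2)
qed

lemma components_summable: "(\<lambda>i. (norm (component i x))\<^sup>2) summable_on UNIV"
  by (rule nonneg_bdd_above_summable_on) (auto intro!: bdd_aboveI2 bessel)

lemma diag_dom_bounded:
  assumes "\<And>i. \<bar>f i\<bar> \<le> C"
  shows "x \<in> diag_dom f"
proof -
  have "(f i)\<^sup>2 * (norm (component i x))\<^sup>2 \<le> C\<^sup>2 * (norm (component i x))\<^sup>2" for i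
    using power_mono[OF assms[of i], of 2] by (intro mult_right_mono) auto
  moreover have "(\<lambda>i. C\<^sup>2 * (norm (component i x))\<^sup>2) summable_on UNIV"
    by (intro summable_on_cmult_right components_summable)
  ultimately show ?thesis
    unfolding diag_dom_def by (auto intro: summable_on_comparison_test)
qed

lemma diag_one: "diag (\<lambda>_. 1) x = x"
  by (rule comp_eqI) (simp add: comp_diag diag_dom_bounded[where C = 1])

lemma parseval: "((\<lambda>i. (norm (component i x))\<^sup>2) has_sum (norm x)\<^sup>2) UNIV"
  using norm_diag_has_sum[of x "\<lambda>_. 1"] by (simp add: diag_one diag_dom_bounded[where C = 1])

lemma norm_diag_le:
  assumes "\<And>i. \<bar>f i\<bar> \<le> C"
  shows "norm (diag f x) \<le> C * norm x"
proof -
  \<comment> \<open>The index type is inhabited, so the bound at \<open>undefined\<close> forces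
    \<open>C\<close> to be nonnegative.\<close>
  have "0 \<le> C"
    using assms[of undefined] by linarith
  have "(norm (diag f x))\<^sup>2 \<le> C\<^sup>2 * (norm x)\<^sup>2"
  proof (rule has_sum_mono)
    show "((\<lambda>i. (f i)\<^sup>2 * (norm (component i x))\<^sup>2) has_sum (norm (diag f x))\<^sup>2) UNIV"
      by (rule norm_diag_has_sum[OF diag_dom_bounded[OF assms]])
    show "((\<lambda>i. C\<^sup>2 * (norm (component i x))\<^sup>2) has_sum C\<^sup>2 * (norm x)\<^sup>2) UNIV"
      by (intro has_sum_cmult_right parseval)
    show "(f i)\<^sup>2 * (norm (component i x))\<^sup>2 \<le> C\<^sup>2 * (norm (component i x))\<^sup>2" for i
      using power_mono[OF assms[of i], of 2] by (intro mult_right_mono) auto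
  qed
  then show ?thesis
    unfolding power_mult_distrib[symmetric] by (rule power2_le_imp_le) (use \<open>0 \<le> C\<close> in simp)
qed

lemma bounded_linear_diag:
  assumes "\<And>i. \<bar>f i\<bar> \<le> C"
  shows "bounded_linear (diag f)"
proof (rule bounded_linear_intro[where K = C])
  show "diag f (x + y) = diag f x + diag f y" "diag f (r *\<^sub>R x) = r *\<^sub>R diag f x" for x y r
    by (rule comp_eqI; simp add: comp_diag diag_dom_bounded[OF assms] component.add component.scaleR algebra_simps)+
qed (simp add: norm_diag_le[OF assms] mult.commute)

lemma diag_scaleC:
  assumes "\<And>i. \<bar>f i\<bar> \<le> C"
  shows "diag f (c *\<^sub>C x) = c *\<^sub>C diag f x"
  by (rule comp_eqI) (simp add: comp_diag diag_dom_bounded[OF assms] comp_scaleC scaleC_scaleR)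

lemma inner_components: "((\<lambda>i. inner (component i x) (component i y)) has_sum inner x y) UNIV"
proof -
  have "((\<lambda>i. component i x) has_sum x) UNIV"
    using diag_has_sum[of x "\<lambda>_. 1"] by (simp add: diag_one diag_dom_bounded[where C = 1])
  from has_sum_bounded_linear[OF bounded_linear_inner_left this] show ?thesis
    by (simp add: comp_inner[OF comp_in])
qed

lemma diag_symmetric:
  assumes "\<And>i. \<bar>f i\<bar> \<le> C"
  shows "inner (diag f x) y = inner x (diag f y)"
proof -
  have "((\<lambda>i. inner (component i (diag f x)) (component i y)) has_sum inner (diag f x) y) UNIV"
    "((\<lambda>i. inner (component i x) (component i (diag f y))) has_sum inner x (diag f y)) UNIV"
    by (rule inner_components)+
  then show ?thesis
    by (simp add: comp_diag diag_dom_bounded[OF assms] has_sum_unique)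
qed

end

section \<open>Spectral resolution of a positive operator with compact resolvent\<close>

locale positive_compact_resolvent =
  fixes T :: "'a::complex_hilbert operator"
  assumes self_adj: "self_adjoint T" and pos: "positive_operator T" and compact_res: "compact_resolvent T"
begin

abbreviation "D \<equiv> opdom T"
abbreviation "A \<equiv> opapp T"

section \<open>Consequences of self-adjointness and positivity\<close>

lemma dom_subspace: "complex_vector.subspace D"
  and A_add: "x \<in> D \<Longrightarrow> y \<in> D \<Longrightarrow> A (x + y) = A x + A y"
  and A_scaleC: "x \<in> D \<Longrightarrow> A (c *\<^sub>C x) = c *\<^sub>C A x"
  using self_adj by (auto simp: self_adjoint_def densely_defined_def complex_linear_on_def)

lemma dom_real_subspace: "subspace D"
  by (rule complex_subspace_imp_subspace[OF dom_subspace])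

lemma A_scaleR: "x \<in> D \<Longrightarrow> A (r *\<^sub>R x) = r *\<^sub>R A x"
  using A_scaleC[of x "complex_of_real r"] by (simp add: scaleC_of_real)

lemma A_diff: "x \<in> D \<Longrightarrow> y \<in> D \<Longrightarrow> A (x - y) = A x - A y"
  using A_add[of x "(-1) *\<^sub>R y"] A_scaleR[of y "-1"] dom_real_subspace by (simp add: subspace_neg)

text \<open>Testing the real identity on \<open>\<i> *\<^sub>C u\<close> as well yields the
  imaginary part. Self-adjointness is used in this form: testing against \<open>D\<close> proves
  membership in the domain.\<close>

lemma graph_iff: "v \<in> D \<and> A v = w \<longleftrightarrow> (\<forall>u\<in>D. inner v (A u) = inner w u)"
proof
  assume "v \<in> D \<and> A v = w"
  then have "\<forall>u\<in>D. cinner v (A u) = cinner w u"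
    using self_adj unfolding self_adjoint_def by blast
  then show "\<forall>u\<in>D. inner v (A u) = inner w u"
    by (metis Re_cinner)
next
  assume *: "\<forall>u\<in>D. inner v (A u) = inner w u"
  have "cinner v (A u) = cinner w u" if u: "u \<in> D" for u
  proof -
    have "\<i> *\<^sub>C u \<in> D"
      using u complex_vector.subspace_scale[OF dom_subspace] by blast
    with * have "inner v (A (\<i> *\<^sub>C u)) = inner w (\<i> *\<^sub>C u)"
      by blast
    then have "Re (cinner v (\<i> *\<^sub>C A u)) = Re (cinner w (\<i> *\<^sub>C u))"
      using u by (simp add: A_scaleC Re_cinner)
    moreover have "Re (cinner v (A u)) = Re (cinner w u)"
      using * u by (simp add: Re_cinner)
    ultimately show ?thesis
      by (simp add: cinner_scaleC_right complex_eq_iff)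
  qed
  then show "v \<in> D \<and> A v = w"
    using self_adj unfolding self_adjoint_def by blast
qed

lemma A_symmetric: "v \<in> D \<Longrightarrow> u \<in> D \<Longrightarrow> inner (A v) u = inner v (A u)"
  using graph_iff[of v "A v"] by simp

lemma A_pos: "u \<in> D \<Longrightarrow> 0 \<le> inner u (A u)"
  using pos by (simp add: positive_operator_def Re_cinner)

lemma eigenspace_closed_subspace: "closed_complex_subspace (eigenspace T l)"
proof
  have "x + y \<in> eigenspace T l" if "x \<in> eigenspace T l" "y \<in> eigenspace T l" for x y
    using that complex_vector.subspace_add[OF dom_subspace]
    by (auto simp: eigenspace_def A_add scaleR_add_right)
  moreover have "c *\<^sub>C x \<in> eigenspace T l" if "x \<in> eigenspace T l" for x c
    using that complex_vector.subspace_scale[OF dom_subspace]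
    by (auto simp: eigenspace_def A_scaleC scaleC_scaleR)
  moreover have "0 \<in> eigenspace T l"
    using A_scaleR[of 0 0] complex_vector.subspace_0[OF dom_subspace] by (simp add: eigenspace_def)
  ultimately show "complex_vector.subspace (eigenspace T l)"
    by (simp add: complex_vector.subspace_def)
  \<comment> \<open>\<open>A\<close> is not assumed continuous; closedness comes from rewriting the
    eigenvalue equation as conditions continuous in \<open>v\<close>.\<close>
  have "eigenspace T l = (\<Inter>u\<in>D. {v. inner v (A u) = inner (l *\<^sub>R v) u})"
    using graph_iff by (auto simp: eigenspace_def)
  also have "closed \<dots>"
    by (intro closed_INT ballI closed_Collect_eq continuous_intros)
  finally show "closed (eigenspace T l)" .
qed

lemma eigenspace_orthogonal:
  assumes "l \<noteq> k" "v \<in> eigenspace T l" "w \<in> eigenspace T k"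
  shows "inner v w = 0"
  using A_symmetric[of v w] assms by (auto simp: eigenspace_def)

lemma eigenspace_negative:
  assumes "l < 0" "v \<in> eigenspace T l"
  shows "v = 0"
proof -
  have "0 \<le> l * (norm v)\<^sup>2"
    using A_pos[of v] assms(2) by (simp add: eigenspace_def dot_square_norm)
  then show ?thesis
    using assms(1) by (simp add: zero_le_mult_iff)
qed

text \<open>Positivity makes \<open>A + 1\<close> expanding. This yields its injectivity, the
  closedness of its range and the contraction bound for its inverse.\<close>

lemma norm_le_norm_A_plus: "u \<in> D \<Longrightarrow> norm u \<le> norm (A u + u)"
proof -
  assume u: "u \<in> D"
  have "norm u * norm u \<le> inner u (A u + u)"
    using A_pos[OF u] by (simp add: inner_add_right dot_square_norm power2_eq_square)
  also have "\<dots> \<le> norm u * norm (A u + u)"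
    by (rule norm_cauchy_schwarz)
  finally show ?thesis
    by (cases "u = 0") auto
qed

text \<open>The range of \<open>A + 1\<close> is closed. By self-adjointness a nonzero vector
  orthogonal to it would be an eigenvector of \<open>A\<close> for \<open>-1\<close>, which
  positivity excludes.\<close>

lemma A_plus_surj: "\<exists>u\<in>D. A u + u = y"
proof -
  let ?R = "(\<lambda>u. A u + u) ` D"
  have sub: "subspace ?R"
    unfolding subspace_def
  proof (intro conjI ballI allI)
    show "0 \<in> ?R"
      using A_scaleR[of 0 0] subspace_0[OF dom_real_subspace] by (auto intro!: image_eqI[of _ _ 0])
    show "x + y \<in> ?R" if xy: "x \<in> ?R" "y \<in> ?R" for x y
    proof -
      obtain a b where "a \<in> D" "x = A a + a" "b \<in> D" "y = A b + b"
        using xy by auto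
      then show ?thesis
        using subspace_add[OF dom_real_subspace]
        by (intro image_eqI[of _ _ "a + b"]) (simp_all add: A_add)
    qed
    show "c *\<^sub>R x \<in> ?R" if x: "x \<in> ?R" for x c
    proof -
      obtain a where "a \<in> D" "x = A a + a"
        using x by auto
      then show ?thesis
        using subspace_scale[OF dom_real_subspace]
        by (intro image_eqI[of _ _ "c *\<^sub>R a"]) (simp_all add: A_scaleR scaleR_add_right)
    qed
  qed
  have "closed ?R"
    unfolding closed_sequential_limits
  proof (intro allI impI)
    fix X y assume X: "(\<forall>n. X n \<in> ?R) \<and> X \<longlonglongrightarrow> y"
    then have "\<forall>n. \<exists>v. v \<in> D \<and> X n = A v + v"
      by blast
    then obtain V where V: "\<And>n. V n \<in> D" "\<And>n. X n = A (V n) + V n"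
      by metis
    have "Cauchy V"
    proof (rule metric_CauchyI)
      fix e :: real assume "0 < e"
      with X obtain N where "\<forall>m\<ge>N. \<forall>n\<ge>N. dist (X m) (X n) < e"
        using LIMSEQ_imp_Cauchy metric_CauchyD by blast
      moreover have "dist (V m) (V n) \<le> dist (X m) (X n)" for m n
      proof -
        have "V m - V n \<in> D"
          using V(1) dom_real_subspace by (simp add: subspace_diff)
        from norm_le_norm_A_plus[OF this] show ?thesis
          by (simp add: dist_norm V A_diff algebra_simps)
      qed
      ultimately show "\<exists>M. \<forall>m\<ge>M. \<forall>n\<ge>M. dist (V m) (V n) < e"
        by (meson order_le_less_trans)
    qed
    then obtain v where v: "V \<longlonglongrightarrow> v"
      using Cauchy_convergent_iff convergent_def by blast
    \<comment> \<open>Passing to the limit in the tested equation shows that the graph is closed: it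
      puts \<open>v\<close> into the domain and identifies \<open>A v\<close>.\<close>
    have "inner v (A u) = inner (y - v) u" if u: "u \<in> D" for u
    proof (rule LIMSEQ_unique)
      show "(\<lambda>n. inner (V n) (A u)) \<longlonglongrightarrow> inner v (A u)"
        by (intro tendsto_intros v)
      have "(\<lambda>n. inner (X n - V n) u) \<longlonglongrightarrow> inner (y - v) u"
        using X by (intro tendsto_intros v) auto
      moreover have "inner (X n - V n) u = inner (V n) (A u)" for n
        using A_symmetric[OF V(1) u] by (simp add: V)
      ultimately show "(\<lambda>n. inner (V n) (A u)) \<longlonglongrightarrow> inner (y - v) u"
        by simp
    qed
    then have "v \<in> D \<and> A v = y - v"
      using graph_iff by blast
    then show "y \<in> ?R"
      by (auto intro!: image_eqI[of _ _ v])
  qed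
  then obtain v where v: "v \<in> ?R" "\<And>w. w \<in> ?R \<Longrightarrow> inner w (y - v) = 0"
    using projection_exists[OF sub] by metis
  have "inner (y - v) (A u) = inner (- (y - v)) u" if "u \<in> D" for u
  proof -
    have "inner (A u) (y - v) + inner u (y - v) = 0"
      using v(2)[of "A u + u"] that by (simp only: inner_add_left image_eqI)
    then show ?thesis
      unfolding inner_minus_left inner_commute[of "y - v"] by linarith
  qed
  then have d: "y - v \<in> D" "A (y - v) = - (y - v)"
    using graph_iff[of "y - v" "- (y - v)"] by auto
  have "y - v = 0"
    using A_pos[OF d(1)] unfolding d(2) inner_minus_right dot_square_norm by simp
  then show ?thesis
    using v(1) by auto
qed

text \<open>The resolvent \<open>(T + 1)\<^sup>-\<^sup>1\<close>. The point given by
  \<open>compact_resolvent\<close> is an arbitrary complex number, whereas at \<open>-1\<close> the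
  resolvent is symmetric, positive and a contraction.\<close>

definition B :: "'a \<Rightarrow> 'a"
  where "B y = (SOME u. u \<in> D \<and> A u + u = y)"

lemma B_in: "B y \<in> D" and A_B: "A (B y) + B y = y"
  using someI_ex[of "\<lambda>u. u \<in> D \<and> A u + u = y"] A_plus_surj[of y] unfolding B_def by auto

lemma B_A:
  assumes u: "u \<in> D"
  shows "B (A u + u) = u"
proof -
  have d: "B (A u + u) - u \<in> D"
    using u B_in dom_real_subspace by (simp add: subspace_diff)
  have "A (B (A u + u) - u) + (B (A u + u) - u) = 0"
    using A_B[of "A u + u"] by (simp add: A_diff[OF B_in u] algebra_simps)
  then show ?thesis
    using norm_le_norm_A_plus[OF d] by simp
qed

lemma norm_B_le: "norm (B y) \<le> norm y"
  using norm_le_norm_A_plus[OF B_in, of y] by (simp add: A_B)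

lemma bounded_linear_B: "bounded_linear B"
proof (rule bounded_linear_intro[where K = 1])
  have "B (x + y) = B (A (B x + B y) + (B x + B y))" for x y
    using A_B[of x] A_B[of y] by (simp add: A_add[OF B_in B_in] algebra_simps)
  then show "B (x + y) = B x + B y" for x y
    using B_in dom_real_subspace by (simp add: B_A subspace_add)
  have "B (r *\<^sub>R x) = B (A (r *\<^sub>R B x) + r *\<^sub>R B x)" for x r
    by (metis A_B A_scaleR B_in scaleR_add_right)
  then show "B (r *\<^sub>R x) = r *\<^sub>R B x" for x r
    using B_in dom_real_subspace by (simp add: B_A subspace_scale)
qed (simp add: norm_B_le)

sublocale B: bounded_linear B
  by (rule bounded_linear_B)

lemma B_symmetric: "inner (B x) y = inner x (B y)"
proof -
  have "inner (B x) (A (B y) + B y) = inner (A (B x) + B x) (B y)"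
    by (simp add: inner_add_left inner_add_right A_symmetric[OF B_in B_in])
  then show ?thesis
    by (simp add: A_B)
qed

lemma B_pos: "0 \<le> inner w (B w)"
proof -
  have "inner w (B w) = inner (B w) (A (B w) + B w)"
    by (simp add: A_B inner_commute)
  also have "\<dots> \<ge> 0"
    using A_pos[OF B_in] by (simp add: inner_add_right)
  finally show ?thesis .
qed

text \<open>By the resolvent identity, \<open>B x\<close> is the compact resolvent at
  \<open>z\<close> applied to \<open>x - B x - z *\<^sub>C B x\<close>, and these arguments stay
  bounded along a bounded sequence.\<close>

lemma B_compact:
  assumes "bounded (range X)"
  obtains y and r :: "nat \<Rightarrow> nat" where "strict_mono r" "(\<lambda>n. B (X (r n))) \<longlonglongrightarrow> y"
proof -
  obtain z where bij: "bij_betw (\<lambda>u. A u - z *\<^sub>C u) D UNIV"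
    and cpt: "compact_operator (inv_into D (\<lambda>u. A u - z *\<^sub>C u))"
    using compact_res unfolding compact_resolvent_def by blast
  define Y where "Y n = X n - B (X n) - z *\<^sub>C B (X n)" for n
  obtain C where C: "\<And>n. norm (X n) \<le> C"
    using assms unfolding bounded_iff by auto
  have "norm (Y n) \<le> C + C + cmod z * C" for n
  proof -
    have "norm (Y n) \<le> norm (X n) + norm (B (X n)) + cmod z * norm (B (X n))"
      unfolding Y_def norm_scaleC[symmetric]
      using norm_triangle_ineq4 order_trans[OF norm_triangle_ineq4 add_right_mono] by blast
    also have "\<dots> \<le> C + C + cmod z * C"
      using C[of n] norm_B_le[of "X n"] by (intro add_mono mult_left_mono) auto
    finally show ?thesis .
  qed
  then have "bounded (range Y)"
    unfolding bounded_iff by blast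
  then have "compact (closure (inv_into D (\<lambda>u. A u - z *\<^sub>C u) ` range Y))"
    using cpt unfolding compact_operator_def by blast
  moreover have "B (X n) \<in> closure (inv_into D (\<lambda>u. A u - z *\<^sub>C u) ` range Y)" for n
  proof -
    have "inv_into D (\<lambda>u. A u - z *\<^sub>C u) (Y n) = B (X n)"
    proof (rule inv_into_f_eq)
      show "A (B (X n)) - z *\<^sub>C B (X n) = Y n"
        using A_B[of "X n"] by (simp add: Y_def algebra_simps eq_diff_eq)
    qed (use bij B_in in \<open>auto simp: bij_betw_def\<close>)
    then have "B (X n) \<in> inv_into D (\<lambda>u. A u - z *\<^sub>C u) ` range Y"
      by (intro image_eqI[of _ _ "Y n"]) auto
    then show ?thesis
      by (rule subsetD[OF closure_subset])
  qed
  ultimately obtain y and r :: "nat \<Rightarrow> nat"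
    where "strict_mono r" "((\<lambda>n. B (X n)) \<circ> r) \<longlonglongrightarrow> y"
    using compact_imp_seq_compact seq_compactE[of _ "\<lambda>n. B (X n)"] by blast
  then show ?thesis
    using that by (auto simp: o_def)
qed

text \<open>Since \<open>B\<close> inverts \<open>A + 1\<close>, an eigenvalue \<open>m\<close> of
  \<open>B\<close> becomes \<open>1 / m - 1\<close> for \<open>A\<close>.\<close>

lemma eigenspace_I: "B x = m *\<^sub>R x \<Longrightarrow> m \<noteq> 0 \<Longrightarrow> x \<in> eigenspace T (1 / m - 1)"
proof -
  assume x: "B x = m *\<^sub>R x" and m: "m \<noteq> 0"
  have "x = (1 / m) *\<^sub>R B x"
    using x m by simp
  then have "x \<in> D"
    using subspace_scale[OF dom_real_subspace B_in] by metis
  with A_B[of x] m have "m *\<^sub>R A x = m *\<^sub>R ((1 / m - 1) *\<^sub>R x)"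
    by (simp add: x A_scaleR algebra_simps eq_diff_eq)
  then have "A x = (1 / m - 1) *\<^sub>R x"
    using m by (simp only: scaleR_cancel_left) simp
  then show ?thesis
    using \<open>x \<in> D\<close> by (simp add: eigenspace_def)
qed

text \<open>
  A maximizing sequence for the norm of \<open>B\<close> on the orthogonal complement of all eigenspaces
  would converge to an eigenvector in that complement.
\<close>

lemma eigenspaces_total:
  assumes x0: "\<And>l v. v \<in> eigenspace T l \<Longrightarrow> inner v x0 = 0"
  shows "x0 = 0"
proof (rule ccontr)
  assume "x0 \<noteq> 0"
  define W where "W = {x. \<forall>l. \<forall>v\<in>eigenspace T l. inner v x = 0}"
  have WB: "B x \<in> W" if x: "x \<in> W" for x
  proof -
    have "inner v (B x) = 0" if v: "v \<in> eigenspace T l" for v l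
    proof -
      \<comment> \<open>Eigenvectors of \<open>A\<close> are eigenvectors of \<open>B\<close>, so
        symmetry of \<open>B\<close> keeps \<open>W\<close> invariant; for \<open>l = -1\<close> the
        vector \<open>v\<close> vanishes.\<close>
      have "A v + v = (l + 1) *\<^sub>R v" "v \<in> D"
        using v by (auto simp: eigenspace_def scaleR_add_left)
      then have Bv: "(l + 1) *\<^sub>R B v = v"
        using B_A[of v] by (simp add: B.scaleR)
      then have "(l + 1) * inner v (B x) = inner v x"
        by (metis B_symmetric inner_scaleR_left)
      then show ?thesis
        using x v Bv by (cases "l + 1 = 0") (auto simp: W_def)
    qed
    then show ?thesis
      by (auto simp: W_def)
  qed
  have W_scale: "r *\<^sub>R x \<in> W" if "x \<in> W" for r x
    using that by (auto simp: W_def)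
  define m where "m = (SUP x\<in>{x \<in> W. norm x = 1}. norm (B x))"
  have bdd: "bdd_above ((\<lambda>x. norm (B x)) ` {x \<in> W. norm x = 1})"
    by (rule bdd_aboveI2[of _ _ 1]) (auto intro: order_trans[OF norm_B_le])
  have x1: "(1 / norm x0) *\<^sub>R x0 \<in> {x \<in> W. norm x = 1}"
    using x0 \<open>x0 \<noteq> 0\<close> by (auto simp: W_def)
  have m_upper: "norm (B x) \<le> m * norm x" if "x \<in> W" for x
  proof (cases "x = 0")
    case False
    have "norm (B ((1 / norm x) *\<^sub>R x)) \<le> m"
      unfolding m_def using W_scale[OF that] False by (intro cSUP_upper[OF _ bdd]) auto
    then show ?thesis
      using False by (simp add: B.scaleR field_simps)
  qed (simp add: B.zero)
  \<comment> \<open>\<open>B\<close> is injective, which makes the supremum \<open>m\<close>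
    strictly positive.\<close>
  have "B x0 \<noteq> 0"
    using A_B[of x0] \<open>x0 \<noteq> 0\<close> A_scaleR[of 0 0] subspace_0[OF dom_real_subspace] by auto
  then have "0 < m * norm x0"
    using m_upper[of x0] x0 W_def by (smt (verit) mem_Collect_eq norm_le_zero_iff)
  then have "0 < m"
    using \<open>x0 \<noteq> 0\<close> by (simp add: zero_less_mult_iff)
  have "\<forall>n. \<exists>x. x \<in> W \<and> norm x = 1 \<and> m - 1 / real (Suc n) < norm (B x)"
  proof
    fix n
    have "{x \<in> W. norm x = 1} \<noteq> {}"
      using x1 by blast
    moreover have "m - 1 / real (Suc n) < m"
      by simp
    ultimately show "\<exists>x. x \<in> W \<and> norm x = 1 \<and> m - 1 / real (Suc n) < norm (B x)"
      using less_cSUP_iff[OF _ bdd] unfolding m_def by blast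
  qed
  then obtain X where X: "\<And>n. X n \<in> W" "\<And>n. norm (X n) = 1"
    "\<And>n. m - 1 / real (Suc n) < norm (B (X n))"
    by metis
  have lim_norm: "(\<lambda>n. norm (B (X n))) \<longlonglongrightarrow> m"
  proof (rule tendsto_sandwich)
    show "(\<lambda>n. m - 1 / real (Suc n)) \<longlonglongrightarrow> m"
      using tendsto_diff[OF tendsto_const LIMSEQ_inverse_real_of_nat, of m]
      by (simp add: inverse_eq_divide)
    show "\<forall>\<^sub>F n in sequentially. m - 1 / real (Suc n) \<le> norm (B (X n))"
      using X(3) less_imp_le by (intro always_eventually) blast
    show "\<forall>\<^sub>F n in sequentially. norm (B (X n)) \<le> m"
      using m_upper[OF X(1)] X(2) by (intro always_eventually) simp
  qed simp
  \<comment> \<open>Near-maximizers of \<open>norm (B x)\<close> are near-eigenvectors of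
    \<open>B\<close> squared: symmetry evaluates the mixed term of the expanded square, and
    \<open>m\<close> bounds \<open>B\<close> once more on \<open>W\<close>.\<close>
  have "(\<lambda>n. (norm (B (B (X n)) - m\<^sup>2 *\<^sub>R X n))\<^sup>2) \<longlonglongrightarrow> 0"
  proof (rule tendsto_sandwich[where f = "\<lambda>_. 0"])
    show "(\<lambda>n. m\<^sup>2 * (m\<^sup>2 - (norm (B (X n)))\<^sup>2)) \<longlonglongrightarrow> 0"
      using tendsto_mult[OF tendsto_const tendsto_diff[OF tendsto_const tendsto_power[OF lim_norm, of 2]],
          of "m\<^sup>2" "m\<^sup>2"] by simp
    have "(norm (B (B (X n)) - m\<^sup>2 *\<^sub>R X n))\<^sup>2 \<le> m\<^sup>2 * (m\<^sup>2 - (norm (B (X n)))\<^sup>2)" for n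
    proof -
      have "(norm (B (B (X n)) - m\<^sup>2 *\<^sub>R X n))\<^sup>2 =
          (norm (B (B (X n))))\<^sup>2 - 2 * m\<^sup>2 * inner (B (B (X n))) (X n) + (m\<^sup>2)\<^sup>2 * (norm (X n))\<^sup>2"
        unfolding power2_norm_eq_inner
        by (simp add: inner_diff_left inner_diff_right inner_commute power2_eq_square algebra_simps)
      also have "inner (B (B (X n))) (X n) = (norm (B (X n)))\<^sup>2"
        by (simp only: B_symmetric power2_norm_eq_inner)
      also have "(norm (B (B (X n))))\<^sup>2 \<le> (m * norm (B (X n)))\<^sup>2"
        using m_upper[OF WB[OF X(1)]] by (rule power_mono) simp
      finally show ?thesis
        by (simp add: X(2) power_mult_distrib algebra_simps power2_eq_square)
    qed
    then show "\<forall>\<^sub>F n in sequentially. (norm (B (B (X n)) - m\<^sup>2 *\<^sub>R X n))\<^sup>2 \<le> m\<^sup>2 * (m\<^sup>2 - (norm (B (X n)))\<^sup>2)"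
      by simp
  qed auto
  then have lim0: "(\<lambda>n. B (B (X n)) - m\<^sup>2 *\<^sub>R X n) \<longlonglongrightarrow> 0"
    using tendsto_real_sqrt unfolding tendsto_norm_zero_iff[symmetric, of "\<lambda>n. B (B (X n)) - m\<^sup>2 *\<^sub>R X n"]
    by fastforce
  have "bounded (range X)"
    using X(2) by (auto simp: bounded_iff intro!: exI[of _ 1])
  then obtain y r where r: "strict_mono r" and y: "(\<lambda>n. B (X (r n))) \<longlonglongrightarrow> y"
    by (rule B_compact)
  define x where "x = (1 / m\<^sup>2) *\<^sub>R B y"
  \<comment> \<open>Compactness gives convergence of \<open>B (X (r n))\<close> only; the
    near-eigenvector relation upgrades it to convergence of \<open>X (r n)\<close>.\<close>
  have "(\<lambda>n. B (B (X (r n))) - (B (B (X (r n))) - m\<^sup>2 *\<^sub>R X (r n))) \<longlonglongrightarrow> B y - 0"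
    by (rule tendsto_diff[OF B.tendsto[OF y]]) (use LIMSEQ_subseq_LIMSEQ[OF lim0 r] in \<open>simp add: o_def\<close>)
  then have "(\<lambda>n. (1 / m\<^sup>2) *\<^sub>R (m\<^sup>2 *\<^sub>R X (r n))) \<longlonglongrightarrow> (1 / m\<^sup>2) *\<^sub>R B y"
    by (intro tendsto_intros) simp
  then have lim_x: "(\<lambda>n. X (r n)) \<longlonglongrightarrow> x"
    using \<open>0 < m\<close> by (simp add: x_def)
  have "norm x = 1"
    using tendsto_norm[OF lim_x] X(2) by (simp add: LIMSEQ_const_iff)
  have "x \<in> W"
  proof -
    have "inner v x = 0" if "v \<in> eigenspace T l" for v l
    proof (rule LIMSEQ_unique)
      show "(\<lambda>n. inner v (X (r n))) \<longlonglongrightarrow> inner v x"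
        by (intro tendsto_intros lim_x)
      show "(\<lambda>n. inner v (X (r n))) \<longlonglongrightarrow> 0"
        using X(1) that by (simp add: W_def)
    qed
    then show ?thesis
      by (auto simp: W_def)
  qed
  have "y = B x"
    using LIMSEQ_unique[OF y B.tendsto[OF lim_x]] .
  then have BB: "B (B x) = m\<^sup>2 *\<^sub>R x"
    using \<open>0 < m\<close> by (simp add: x_def)
  \<comment> \<open>\<open>B (B x) = m\<^sup>2 *\<^sub>R x\<close> factors as
    \<open>(B + m) (B - m) x = 0\<close>, so a nonzero \<open>w\<close> would be an eigenvector for
    \<open>-m\<close>, against positivity of \<open>B\<close>.\<close>
  define w where "w = B x - m *\<^sub>R x"
  have "B w = - m *\<^sub>R w"
    by (simp add: w_def B.diff B.scaleR BB algebra_simps power2_eq_square)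
  then have "m * (norm w)\<^sup>2 \<le> 0"
    using B_pos[of w] by (simp add: power2_norm_eq_inner)
  then have "w = 0"
    using \<open>0 < m\<close> by (simp add: mult_le_0_iff)
  then have "x \<in> eigenspace T (1 / m - 1)"
    using eigenspace_I[of x m] \<open>0 < m\<close> by (simp add: w_def)
  then have "inner x x = 0"
    using \<open>x \<in> W\<close> by (auto simp: W_def)
  then show False
    using \<open>norm x = 1\<close> by simp
qed

sublocale orth_resolution "eigenspace T"
  by (rule orth_resolution.intro)
    (fact eigenspace_closed_subspace eigenspace_orthogonal eigenspaces_total)+

end

section \<open>Linear evolution equations\<close>

text \<open>
  Since the norm need not be differentiable at zeros of \<open>d\<close>, it is approximated by
  \<open>sqrt ((norm (d r))\<^sup>2 + \<eta>\<^sup>2)\<close>.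
\<close>

lemma norm_growth:
  fixes d d' :: "real \<Rightarrow> 'a::real_inner"
  assumes ab: "a \<le> b" and \<epsilon>: "0 \<le> \<epsilon>"
    and deriv: "\<And>r. r \<in> {a..b} \<Longrightarrow> (d has_vector_derivative d' r) (at r within {a..b})"
    and bound: "\<And>r. r \<in> {a..b} \<Longrightarrow> \<bar>inner (d r) (d' r)\<bar> \<le> \<epsilon> * norm (d r)"
  shows "\<bar>norm (d b) - norm (d a)\<bar> \<le> \<epsilon> * (b - a)"
proof (rule field_le_epsilon)
  fix e :: real assume "0 < e"
  define \<eta> where "\<eta> = e / 2"
  have "0 < \<eta>"
    using \<open>0 < e\<close> by (simp add: \<eta>_def)
  define f where "f r = sqrt (inner (d r) (d r) + \<eta>\<^sup>2)" for r
  have pos: "0 < inner (d r) (d r) + \<eta>\<^sup>2" for r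
    using \<open>0 < \<eta>\<close> by (simp add: add_nonneg_pos)
  have near: "norm (d r) \<le> f r" "f r \<le> norm (d r) + \<eta>" for r
  proof -
    show "norm (d r) \<le> f r"
      unfolding f_def by (rule real_le_rsqrt) (simp add: dot_square_norm)
    show "f r \<le> norm (d r) + \<eta>"
      unfolding f_def using \<open>0 < \<eta>\<close>
      by (intro real_le_lsqrt) (simp_all add: dot_square_norm power2_sum)
  qed
  have f_pos: "0 < f r" for r
    unfolding f_def using pos by simp
  have df: "(f has_field_derivative inner (d r) (d' r) / f r) (at r within {a..b})"
    if r: "r \<in> {a..b}" for r
  proof -
    have "((\<lambda>r. inner (d r) (d r) + \<eta>\<^sup>2) has_derivative
            (\<lambda>h. inner (d r) (h *\<^sub>R d' r) + inner (h *\<^sub>R d' r) (d r) + 0)) (at r within {a..b})"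
      using deriv[OF r] unfolding has_vector_derivative_def
      by (intro has_derivative_add has_derivative_inner has_derivative_const)
    then have d2: "((\<lambda>r. inner (d r) (d r) + \<eta>\<^sup>2) has_field_derivative 2 * inner (d r) (d' r)) (at r within {a..b})"
      unfolding has_field_derivative_def
      by (rule has_derivative_eq_rhs) (simp add: fun_eq_iff inner_commute)
    have "((\<lambda>r. sqrt (inner (d r) (d r) + \<eta>\<^sup>2)) has_field_derivative
        inverse (sqrt (inner (d r) (d r) + \<eta>\<^sup>2)) / 2 * (2 * inner (d r) (d' r))) (at r within {a..b})"
      by (rule DERIV_chain2[where f = sqrt, OF _ d2]) (rule DERIV_real_sqrt[OF pos])
    moreover have "inverse p / 2 * (2 * q) = q / p" for p q :: real
      by (cases "p = 0") (simp_all add: field_simps)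
    ultimately show ?thesis
      unfolding f_def[abs_def] by simp
  qed
  have "norm (f b - f a) \<le> \<epsilon> * norm (b - a)"
  proof (rule field_differentiable_bound[OF _ df])
    show "norm (inner (d r) (d' r) / f r) \<le> \<epsilon>" if r: "r \<in> {a..b}" for r
    proof -
      have "\<bar>inner (d r) (d' r)\<bar> \<le> \<epsilon> * f r"
        using bound[OF r] mult_left_mono[OF near(1) \<epsilon>, of r] by linarith
      then show ?thesis
        using f_pos[of r] by (simp add: divide_le_eq)
    qed
  qed (use ab in auto)
  then show "\<bar>norm (d b) - norm (d a)\<bar> \<le> \<epsilon> * (b - a) + e"
    using near[of a] near[of b] ab by (simp add: \<eta>_def)
qed

text \<open>By polarization this is skew-adjointness for the real inner product. For
  \<open>G = - \<i> A\<close> it says that \<open>cinner x (A x)\<close> is real.\<close>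

abbreviation skew :: "('a::real_inner \<Rightarrow>\<^sub>L 'a) \<Rightarrow> bool"
  where "skew G \<equiv> \<forall>x. inner x (blinfun_apply G x) = 0"

text \<open>The exponential \<open>exp (h G) v\<close> with the real time \<open>h\<close> kept
  apart, so that it can be differentiated in \<open>h\<close>; the factor \<open>- \<i>\<close>
  belongs to \<open>G\<close>.\<close>

abbreviation flow :: "real \<Rightarrow> ('a::real_normed_vector \<Rightarrow>\<^sub>L 'a) \<Rightarrow> 'a \<Rightarrow> 'a"
  where "flow h G \<equiv> op_exp (\<lambda>x. h *\<^sub>R blinfun_apply G x)"

section \<open>The exponential series of a bounded operator\<close>

lemma funpow_scaled:
  fixes G :: "'a::real_normed_vector \<Rightarrow>\<^sub>L 'a"
  shows "((\<lambda>x. h *\<^sub>R blinfun_apply G x) ^^ n) v = h ^ n *\<^sub>R (blinfun_apply G ^^ n) v"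
  by (induction n) (simp_all add: blinfun.scaleR_right)

lemma flow_eq:
  fixes G :: "'a::real_normed_vector \<Rightarrow>\<^sub>L 'a"
  shows "flow h G v = (\<Sum>n. (h ^ n / fact n) *\<^sub>R (blinfun_apply G ^^ n) v)"
  by (simp add: op_exp_def funpow_scaled divide_inverse mult.commute)

lemma norm_funpow_le:
  fixes G :: "'a::real_normed_vector \<Rightarrow>\<^sub>L 'a"
  shows "norm ((blinfun_apply G ^^ n) v) \<le> norm G ^ n * norm v"
proof (induction n)
  case (Suc n)
  have "norm ((blinfun_apply G ^^ Suc n) v) \<le> norm G * norm ((blinfun_apply G ^^ n) v)"
    by (simp add: norm_blinfun)
  also have "\<dots> \<le> norm G * (norm G ^ n * norm v)"
    by (intro mult_left_mono Suc) simp
  finally show ?case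
    by (simp add: mult.assoc)
qed simp

lemma norm_flow_term_le:
  fixes G :: "'a::real_normed_vector \<Rightarrow>\<^sub>L 'a"
  assumes "\<bar>h\<bar> \<le> c"
  shows "norm ((h ^ n / fact n) *\<^sub>R (blinfun_apply G ^^ n) v) \<le> (c * norm G) ^ n /\<^sub>R fact n * norm v"
proof -
  have "\<bar>h\<bar> ^ n * norm ((blinfun_apply G ^^ n) v) \<le> c ^ n * (norm G ^ n * norm v)"
    using assms by (intro mult_mono power_mono norm_funpow_le) auto
  then show ?thesis
    by (simp add: power_abs power_mult_distrib field_simps)
qed

lemma summable_flow_bound: "summable (\<lambda>n. (x::real) ^ n /\<^sub>R fact n * y)"
  by (intro summable_mult2 summable_exp_generic)

lemma summable_flow:
  fixes G :: "'a::banach \<Rightarrow>\<^sub>L 'a"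
  shows "summable (\<lambda>n. (h ^ n / fact n) *\<^sub>R (blinfun_apply G ^^ n) v)"
  by (rule summable_comparison_test'[OF summable_flow_bound norm_flow_term_le[OF order_refl]])

lemma flow_sums:
  fixes v :: "'a::banach"
  shows "(\<lambda>n. (h ^ n / fact n) *\<^sub>R (blinfun_apply G ^^ n) v) sums flow h G v"
  unfolding flow_eq by (rule summable_sums[OF summable_flow])

lemma op_exp_zero [simp]: "op_exp (\<lambda>_. 0) v = v"
proof -
  have "((\<lambda>_. 0) ^^ n) v = (if n = 0 then v else 0)" for n
    by (cases n) auto
  then show ?thesis
    unfolding op_exp_def by (subst suminf_finite[where N = "{0}"]) auto
qed

text \<open>As a \<open>blinfun\<close>, \<open>G\<close> is only real-linear; taking multiplication
  by a complex number for \<open>L\<close> later gives complex linearity of the flow.\<close>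

lemma flow_commute_bounded_linear:
  fixes v :: "'a::banach"
  assumes L: "bounded_linear L" and comm: "\<And>x. blinfun_apply G (L x) = L (blinfun_apply G x)"
  shows "flow h G (L v) = L (flow h G v)"
proof -
  have pow: "(blinfun_apply G ^^ n) (L v) = L ((blinfun_apply G ^^ n) v)" for n
    by (induction n) (simp_all add: comm)
  have "(\<lambda>n. L ((h ^ n / fact n) *\<^sub>R (blinfun_apply G ^^ n) v)) sums L (flow h G v)"
    by (rule bounded_linear.sums[OF L flow_sums])
  then have "(\<lambda>n. (h ^ n / fact n) *\<^sub>R (blinfun_apply G ^^ n) (L v)) sums L (flow h G v)"
    by (simp add: pow linear_scale[OF bounded_linear.linear[OF L]])
  then show ?thesis
    using flow_sums sums_unique2 by blast
qed

lemma flow_add: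
  fixes v w :: "'a::banach"
  shows "flow h G (v + w) = flow h G v + flow h G w"
proof -
  have "(blinfun_apply G ^^ n) (v + w) = (blinfun_apply G ^^ n) v + (blinfun_apply G ^^ n) w" for n
    by (induction n) (simp_all add: blinfun.add_right)
  then have "(\<lambda>n. (h ^ n / fact n) *\<^sub>R (blinfun_apply G ^^ n) (v + w)) sums (flow h G v + flow h G w)"
    using sums_add[OF flow_sums[of h G v] flow_sums[of h G w]] by (simp add: scaleR_add_right)
  then show ?thesis
    using flow_sums sums_unique2 by blast
qed

lemma flow_scaleR:
  fixes v :: "'a::banach"
  shows "flow h G (r *\<^sub>R v) = r *\<^sub>R flow h G v"
  by (rule flow_commute_bounded_linear[OF bounded_linear_scaleR_right]) (simp add: blinfun.scaleR_right)

lemma flow_diff: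
  fixes v w :: "'a::banach"
  shows "flow h G (v - w) = flow h G v - flow h G w"
  using flow_add[of h G v "(-1) *\<^sub>R w"] by (simp only: flow_scaleR) simp

lemma flow_in_closed_subspace:
  fixes v :: "'a::banach"
  assumes "subspace V" "closed V" "\<And>x. x \<in> V \<Longrightarrow> blinfun_apply G x \<in> V" "v \<in> V"
  shows "flow h G v \<in> V"
proof (rule closed_sequentially[OF \<open>closed V\<close>])
  have pow: "(blinfun_apply G ^^ n) v \<in> V" for n
    by (induction n) (use assms in auto)
  show "(\<Sum>i<n. (h ^ i / fact i) *\<^sub>R (blinfun_apply G ^^ i) v) \<in> V" for n
    by (intro subspace_sum subspace_scale assms pow)
  show "(\<lambda>n. \<Sum>i<n. (h ^ i / fact i) *\<^sub>R (blinfun_apply G ^^ i) v) \<longlonglongrightarrow> flow h G v"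
    using flow_sums unfolding sums_def .
qed

text \<open>Termwise differentiation. Each partial sum of derivatives is \<open>G\<close> applied to
  the preceding partial sum of values, so uniform convergence on bounded intervals passes to the
  derivatives.\<close>

lemma flow_derivative:
  fixes v :: "'a::banach"
  shows "((\<lambda>h. flow h G v) has_vector_derivative blinfun_apply G (flow h G v)) (at h)"
proof -
  define c where "c = \<bar>h\<bar> + 1"
  define S where "S = {-c<..<c}"
  define f where "f n x = (x ^ n / fact n) *\<^sub>R (blinfun_apply G ^^ n) v" for n and x :: real
  \<comment> \<open>The constant term is separated because \<open>n - 1\<close> is truncated at
    zero.\<close>
  define f' where "f' n x k = (k * (if n = 0 then 0 else x ^ (n - 1) / fact (n - 1))) *\<^sub>R (blinfun_apply G ^^ n) v"
    for n and x k :: real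
  have sum_f': "(\<Sum>i<Suc n. f' i x k) = k *\<^sub>R blinfun_apply G (\<Sum>i<n. f i x)" for n x k
    unfolding sum.lessThan_Suc_shift
    by (simp add: f'_def f_def blinfun.sum_right blinfun.scaleR_right scaleR_sum_right)
  have unif: "uniform_limit S (\<lambda>n x. \<Sum>i<n. f i x) (\<lambda>x. flow x G v) sequentially"
    unfolding flow_eq f_def
    by (rule Weierstrass_m_test[OF norm_flow_term_le[where c = c] summable_flow_bound]) (auto simp: S_def)
  have "\<exists>g. \<forall>x\<in>S. (\<lambda>n. f n x) sums g x \<and>
          (g has_derivative (\<lambda>k. k *\<^sub>R blinfun_apply G (flow x G v))) (at x within S)"
  proof (rule has_derivative_series)
    show "convex S"
      by (simp add: S_def)
    show "h \<in> S"
      by (auto simp: S_def c_def)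
    show "(\<lambda>n. f n h) sums flow h G v"
      unfolding f_def by (rule flow_sums)
    show "(f n has_derivative f' n x) (at x within S)" for n x
    proof (cases n)
      case 0
      then show ?thesis
        by (simp add: f_def[abs_def] f'_def[abs_def])
    next
      case (Suc m)
      have "((\<lambda>x. x ^ n / fact n) has_field_derivative x ^ (n - 1) / fact (n - 1)) (at x within S)"
        using DERIV_cdivide[OF DERIV_pow[of n x S], of "fact n"] by (simp add: Suc fact_Suc)
      then have "((\<lambda>x. (x ^ n / fact n) *\<^sub>R (blinfun_apply G ^^ n) v) has_derivative
          (\<lambda>k. (x ^ (n - 1) / fact (n - 1) * k) *\<^sub>R (blinfun_apply G ^^ n) v)) (at x within S)"
        unfolding has_field_derivative_def by (rule has_derivative_scaleR_left)
      then show ?thesis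
        using Suc by (simp add: f_def[abs_def] f'_def[abs_def] mult.commute)
    qed
    fix e :: real assume "0 < e"
    \<comment> \<open>The summand \<open>1\<close> guards against \<open>G = 0\<close>.\<close>
    have "0 < e / (norm G + 1)"
      using \<open>0 < e\<close> by (intro divide_pos_pos add_nonneg_pos) auto
    then have "\<forall>\<^sub>F n in sequentially. \<forall>x\<in>S. dist (\<Sum>i<n. f i x) (flow x G v) < e / (norm G + 1)"
      using unif uniform_limitD by blast
    then have "\<forall>\<^sub>F n in sequentially. \<forall>x\<in>S. \<forall>k.
        norm ((\<Sum>i<Suc n. f' i x k) - k *\<^sub>R blinfun_apply G (flow x G v)) \<le> e * norm k"
    proof (rule eventually_mono, intro ballI allI)
      fix n x and k :: real
      assume "\<forall>x\<in>S. dist (\<Sum>i<n. f i x) (flow x G v) < e / (norm G + 1)" "x \<in> S"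
      then have *: "norm ((\<Sum>i<n. f i x) - flow x G v) \<le> e / (norm G + 1)"
        by (auto simp: dist_norm intro: less_imp_le)
      have "norm G * norm ((\<Sum>i<n. f i x) - flow x G v) \<le> (norm G + 1) * (e / (norm G + 1))"
        using * by (intro mult_mono) auto
      also have "\<dots> = e"
        by (simp add: add_nonneg_eq_0_iff)
      finally have "norm (blinfun_apply G ((\<Sum>i<n. f i x) - flow x G v)) \<le> e"
        using norm_blinfun order_trans by blast
      then have "norm k * norm (blinfun_apply G ((\<Sum>i<n. f i x) - flow x G v)) \<le> norm k * e"
        by (intro mult_left_mono) auto
      then show "norm ((\<Sum>i<Suc n. f' i x k) - k *\<^sub>R blinfun_apply G (flow x G v)) \<le> e * norm k"
        unfolding sum_f' scaleR_diff_right[symmetric] blinfun.diff_right[symmetric] norm_scaleR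
        by (simp add: mult.commute)
    qed
    \<comment> \<open>The estimate was obtained for \<open>Suc n\<close> terms; an eventual property
      is insensitive to the shift.\<close>
    then show "\<forall>\<^sub>F n in sequentially. \<forall>x\<in>S. \<forall>k.
        norm ((\<Sum>i<n. f' i x k) - k *\<^sub>R blinfun_apply G (flow x G v)) \<le> e * norm k"
      unfolding eventually_sequentially_Suc[where P = "\<lambda>n. \<forall>x\<in>S. \<forall>k.
        norm ((\<Sum>i<n. f' i x k) - k *\<^sub>R blinfun_apply G (flow x G v)) \<le> e * norm k"] .
  qed
  then obtain g where g: "\<And>x. x \<in> S \<Longrightarrow> (\<lambda>n. f n x) sums g x"
    "\<And>x. x \<in> S \<Longrightarrow> (g has_derivative (\<lambda>k. k *\<^sub>R blinfun_apply G (flow x G v))) (at x within S)"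
    by blast
  have "h \<in> S" "open S"
    by (auto simp: S_def c_def)
  have "g x = flow x G v" if "x \<in> S" for x
    using g(1)[OF that] flow_sums[of x G v] unfolding f_def by (rule sums_unique2)
  then have "((\<lambda>x. flow x G v) has_derivative (\<lambda>k. k *\<^sub>R blinfun_apply G (flow h G v))) (at h within S)"
    using has_derivative_transform[OF \<open>h \<in> S\<close> _ g(2)[OF \<open>h \<in> S\<close>]] by simp
  then show ?thesis
    using at_within_open[OF \<open>h \<in> S\<close> \<open>open S\<close>] by (simp add: has_vector_derivative_def)
qed

lemma flow_derivative_shift:
  fixes v :: "'a::banach"
  shows "((\<lambda>r. flow (r - a) G v) has_vector_derivative blinfun_apply G (flow (r - a) G v)) (at r within S)"
proof -
  have "((\<lambda>r. r - a) has_vector_derivative 1) (at r within S)"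
    by (auto intro!: derivative_eq_intros)
  from vector_diff_chain_within[OF this has_vector_derivative_at_within[OF flow_derivative]]
  show ?thesis
    by (simp add: o_def)
qed

lemma norm_flow:
  fixes v :: "'a::{real_inner,banach}"
  assumes "skew G"
  shows "norm (flow h G v) = norm v"
proof -
  have "\<bar>norm (flow (b - 0) G v) - norm (flow (a - 0) G v)\<bar> \<le> 0 * (b - a)" if "a \<le> b" for a b
    by (rule norm_growth[OF that order_refl flow_derivative_shift]) (use assms in simp)
  from this[of 0 h] this[of h 0] show ?thesis
    by (cases "0 \<le> h") simp_all
qed

text \<open>Skewness removes \<open>G\<close> from the inner product of the difference with its
  derivative. What remains is the defect, so the bound has no exponential factor and does not
  involve \<open>norm G\<close>.\<close>

lemma solution_step:
  fixes y :: "real \<Rightarrow> 'a::{real_inner,banach}"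
  assumes ab: "a \<le> b" and "0 \<le> \<epsilon>" and G: "skew G"
    and deriv: "\<And>r. r \<in> {a..b} \<Longrightarrow> (y has_vector_derivative y' r) (at r within {a..b})"
    and bound: "\<And>r. r \<in> {a..b} \<Longrightarrow> norm (y' r - blinfun_apply G (y r)) \<le> \<epsilon>"
  shows "norm (y b - flow (b - a) G (y a)) \<le> \<epsilon> * (b - a)"
proof -
  let ?d = "\<lambda>r. y r - flow (r - a) G (y a)"
  have "\<bar>norm (?d b) - norm (?d a)\<bar> \<le> \<epsilon> * (b - a)"
  proof (rule norm_growth[OF ab \<open>0 \<le> \<epsilon>\<close>])
    fix r assume r: "r \<in> {a..b}"
    show "(?d has_vector_derivative y' r - blinfun_apply G (flow (r - a) G (y a))) (at r within {a..b})"
      by (intro has_vector_derivative_diff deriv[OF r] flow_derivative_shift)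
    have "inner (?d r) (y' r - blinfun_apply G (flow (r - a) G (y a))) =
        inner (?d r) (y' r - blinfun_apply G (y r)) + inner (?d r) (blinfun_apply G (?d r))"
      by (simp add: blinfun.diff_right inner_diff_right)
    also have "\<bar>\<dots>\<bar> \<le> norm (?d r) * norm (y' r - blinfun_apply G (y r))"
      using G Cauchy_Schwarz_ineq2 by simp
    also have "\<dots> \<le> norm (?d r) * \<epsilon>"
      by (intro mult_left_mono bound r) simp
    finally show "\<bar>inner (?d r) (y' r - blinfun_apply G (flow (r - a) G (y a)))\<bar> \<le> \<epsilon> * norm (?d r)"
      by (simp add: mult.commute)
  qed
  then show ?thesis
    by simp
qed

text \<open>On \<open>{0..h}\<close> the curve \<open>flow (r - h) G v\<close> solves the equation
  with zero defect; it starts at \<open>flow (- h) G v\<close> and ends at \<open>v\<close>.\<close>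

lemma flow_inverse:
  fixes v :: "'a::{real_inner,banach}"
  assumes G: "skew G" and "0 \<le> h"
  shows "flow h G (flow (- h) G v) = v"
  using solution_step[OF \<open>0 \<le> h\<close> order_refl G, of "\<lambda>r. flow (r - h) G v", OF flow_derivative_shift]
  by (simp del: scaleR_minus_left)

text \<open>Picard iteration in an exponentially weighted sup norm: the fixed point \<open>z\<close>
  is the solution divided by \<open>w\<close>. The weight makes the iteration a contraction on the
  whole interval at once.\<close>

lemma linear_ode_exists:
  fixes G :: "real \<Rightarrow> 'a::banach \<Rightarrow>\<^sub>L 'a"
  assumes ab: "a \<le> b" and G: "continuous_on {a..b} G"
  obtains y where "y a = v"
    "\<And>r. r \<in> {a..b} \<Longrightarrow> (y has_vector_derivative blinfun_apply (G r) (y r)) (at r within {a..b})"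
proof -
  obtain C where "\<forall>x\<in>G ` {a..b}. norm x \<le> C"
    using compact_imp_bounded[OF compact_continuous_image[OF G compact_Icc]] unfolding bounded_iff by blast
  then have C: "norm (G r) \<le> C" if "r \<in> {a..b}" for r
    using that by blast
  \<comment> \<open>Strictly above \<open>\<bar>C\<bar>\<close>, which makes
    \<open>\<bar>C\<bar> / L\<close> a contraction factor.\<close>
  define L where "L = \<bar>C\<bar> + 1"
  have "0 < L" "C \<le> L" "0 \<le> \<bar>C\<bar>"
    by (auto simp: L_def)
  define w where "w r = exp (L * (r - a))" for r
  define F where "F z t = (1 / w t) *\<^sub>R (v + integral {a..t} (\<lambda>r. w r *\<^sub>R blinfun_apply (G r) (z r)))"
    for z :: "real \<Rightarrow> 'a" and t
  have w_pos: "0 < w r" for r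
    by (simp add: w_def)
  have cont_w: "continuous_on S w" for S
    unfolding w_def by (intro continuous_intros)
  have cont_integrand: "continuous_on {a..b} (\<lambda>r. w r *\<^sub>R blinfun_apply (G r) (z r))"
    if "continuous_on {a..b} z" for z
    by (intro continuous_intros cont_w G that)
  have cont_F: "continuous_on {a..b} (F z)" if "continuous_on {a..b} z" for z
    unfolding F_def using w_pos
    by (intro continuous_intros cont_w indefinite_integral_continuous_1 integrable_continuous_real
        cont_integrand that) (metis less_irrefl)
  \<comment> \<open>Bounded continuous functions live on the whole line; \<open>clamp\<close>
    extends the iterate from \<open>{a..b}\<close> by its end values.\<close>
  have "\<forall>z::real \<Rightarrow>\<^sub>C 'a. \<exists>g::real \<Rightarrow>\<^sub>C 'a. \<forall>x. apply_bcontfun g x = F (apply_bcontfun z) (clamp a b x)"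
    using continuous_on_cbox_bcontfunE[of a b] cont_F continuous_on_apply_bcontfun
    unfolding cbox_interval by metis
  then obtain \<Phi> :: "(real \<Rightarrow>\<^sub>C 'a) \<Rightarrow> (real \<Rightarrow>\<^sub>C 'a)"
    where \<Phi>: "\<And>z x. apply_bcontfun (\<Phi> z) x = F (apply_bcontfun z) (clamp a b x)"
    by metis
  have clamp_in: "clamp a b x \<in> {a..b}" for x
    using clamp_in_interval[of a b x] ab by (simp add: cbox_interval)
  have lipschitz: "dist (F (apply_bcontfun x) t) (F (apply_bcontfun y) t) \<le> \<bar>C\<bar> / L * dist x y"
    if t: "t \<in> {a..b}" for x y :: "real \<Rightarrow>\<^sub>C 'a" and t
  proof -
    let ?f = "\<lambda>z r. w r *\<^sub>R blinfun_apply (G r) (apply_bcontfun z r)"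
    have int: "?f z integrable_on {a..t}" for z :: "real \<Rightarrow>\<^sub>C 'a"
      by (rule integrable_continuous_real, rule continuous_on_subset[OF cont_integrand])
        (use t in auto)
    \<comment> \<open>The antiderivative of the weight is the weight divided by \<open>L\<close>;
      the gain \<open>1 / L\<close> arises here.\<close>
    have "((\<lambda>r. w r * (\<bar>C\<bar> * dist x y)) has_integral
        (w t * (\<bar>C\<bar> * dist x y) / L - w a * (\<bar>C\<bar> * dist x y) / L)) {a..t}"
    proof (rule fundamental_theorem_of_calculus)
      show "((\<lambda>r. w r * (\<bar>C\<bar> * dist x y) / L) has_vector_derivative w r * (\<bar>C\<bar> * dist x y)) (at r within {a..t})" for r
        unfolding w_def has_real_derivative_iff_has_vector_derivative[symmetric] using \<open>0 < L\<close>
        by (auto intro!: derivative_eq_intros)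
    qed (use t in auto)
    moreover have "norm (?f x r - ?f y r) \<le> w r * (\<bar>C\<bar> * dist x y)" if r: "r \<in> {a..t}" for r
    proof -
      have "norm (?f x r - ?f y r) = w r * norm (blinfun_apply (G r) (apply_bcontfun x r - apply_bcontfun y r))"
        using w_pos[of r] by (simp add: blinfun.diff_right flip: scaleR_diff_right)
      also have "\<dots> \<le> w r * (norm (G r) * norm (apply_bcontfun x r - apply_bcontfun y r))"
        using w_pos[of r] by (intro mult_left_mono norm_blinfun) auto
      also have "\<dots> \<le> w r * (\<bar>C\<bar> * dist x y)"
        using w_pos[of r] C[of r] r t dist_bounded[of x r y]
        by (intro mult_left_mono mult_mono) (auto simp: dist_norm)
      finally show ?thesis .
    qed
    ultimately have "norm (integral {a..t} (\<lambda>r. ?f x r - ?f y r)) \<le>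
        w t * (\<bar>C\<bar> * dist x y) / L - w a * (\<bar>C\<bar> * dist x y) / L"
      using integral_norm_bound_integral[OF integrable_diff[OF int int]]
      by (metis (no_types, lifting) has_integral_integrable integral_unique)
    also have "\<dots> \<le> w t * (\<bar>C\<bar> * dist x y) / L"
      using w_pos[of a] \<open>0 < L\<close> by simp
    finally have "norm (integral {a..t} (?f x) - integral {a..t} (?f y)) \<le> w t * (\<bar>C\<bar> * dist x y) / L"
      by (simp add: integral_diff[OF int int])
    then show ?thesis
      using w_pos[of t]
      by (simp add: F_def dist_norm divide_le_eq mult.commute flip: scaleR_diff_right)
  qed
  have "\<exists>!z. \<Phi> z = z"
  proof (rule banach_fix_type)
    show "\<bar>C\<bar> / L < 1"
      using \<open>0 < L\<close> by (simp add: L_def)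
    show "\<forall>x y. dist (\<Phi> x) (\<Phi> y) \<le> \<bar>C\<bar> / L * dist x y"
      by (intro allI dist_bound) (unfold \<Phi>, rule lipschitz[OF clamp_in])
  qed (use \<open>0 < L\<close> in simp)
  then obtain z where "\<Phi> z = z"
    by blast
  then have z: "apply_bcontfun z t = F (apply_bcontfun z) t" if "t \<in> {a..b}" for t
    using \<Phi>[of z t] that clamp_cancel_cbox[of t a b] by (simp add: cbox_interval)
  define y where "y t = v + integral {a..t} (\<lambda>r. w r *\<^sub>R blinfun_apply (G r) (apply_bcontfun z r))" for t
  have y_z: "w t *\<^sub>R apply_bcontfun z t = y t" if "t \<in> {a..b}" for t
    using z[OF that] w_pos[of t] by (simp add: F_def y_def)
  show ?thesis
  proof
    show "y a = v"
      by (simp add: y_def)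
    fix r assume r: "r \<in> {a..b}"
    have "(y has_vector_derivative 0 + w r *\<^sub>R blinfun_apply (G r) (apply_bcontfun z r)) (at r within {a..b})"
      unfolding y_def
      by (intro has_vector_derivative_add has_vector_derivative_const integral_has_vector_derivative
          cont_integrand r continuous_on_apply_bcontfun)
    then show "(y has_vector_derivative blinfun_apply (G r) (y r)) (at r within {a..b})"
      by (simp flip: y_z[OF r] add: blinfun.scaleR_right)
  qed
qed

text \<open>Time reversal: \<open>r\<close> becomes \<open>- r\<close> and the generator changes
  sign.\<close>

lemma linear_ode_exists_terminal:
  fixes G :: "real \<Rightarrow> 'a::banach \<Rightarrow>\<^sub>L 'a"
  assumes ab: "a \<le> b" and G: "continuous_on {a..b} G"
  obtains y where "y b = v"
    "\<And>r. r \<in> {a..b} \<Longrightarrow> (y has_vector_derivative blinfun_apply (G r) (y r)) (at r within {a..b})"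
proof -
  have img: "uminus ` {- b..- a} = {a..b}" and img': "uminus ` {a..b} = {- b..- a}"
    by auto
  have "continuous_on {- b..- a} (\<lambda>r. - G (- r))"
    using continuous_on_compose[of "{- b..- a}" uminus G] G img
    by (intro continuous_on_minus) (simp add: o_def continuous_on_minus continuous_on_id)
  then obtain z where z: "z (- b) = v" "\<And>r. r \<in> {- b..- a} \<Longrightarrow>
      (z has_vector_derivative blinfun_apply (- G (- r)) (z r)) (at r within {- b..- a})"
    using linear_ode_exists[of "- b" "- a" "\<lambda>r. - G (- r)" v] ab by auto
  show ?thesis
  proof (rule that[of "\<lambda>r. z (- r)"])
    fix r assume r: "r \<in> {a..b}"
    have "((\<lambda>r. - r) has_vector_derivative - 1) (at r within {a..b})"
      by (auto intro!: derivative_eq_intros)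
    moreover have "(z has_vector_derivative blinfun_apply (- G r) (z (- r))) (at (- r) within uminus ` {a..b})"
      using z(2)[of "- r"] r by (simp add: img')
    ultimately have "((z \<circ> uminus) has_vector_derivative (- 1) *\<^sub>R blinfun_apply (- G r) (z (- r))) (at r within {a..b})"
      by (rule vector_diff_chain_within)
    then show "((\<lambda>r. z (- r)) has_vector_derivative blinfun_apply (G r) (z (- r))) (at r within {a..b})"
      by (simp add: o_def blinfun.minus_left)
  qed (simp add: z)
qed

section \<open>Time slicing\<close>

lemma partition_mono:
  assumes \<tau>: "is_partition a b M \<tau>" and "i \<le> j" "j \<le> M"
  shows "\<tau> i \<le> \<tau> j"
  using \<open>i \<le> j\<close> \<open>j \<le> M\<close>
proof (induction j rule: dec_induct)
  case (step n)
  then show ?case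
    using \<tau> unfolding is_partition_def by (metis Suc_le_lessD less_imp_le order_trans Suc_leD)
qed simp

lemma partition_in: "is_partition a b M \<tau> \<Longrightarrow> j \<le> M \<Longrightarrow> \<tau> j \<in> {a..b}"
  using partition_mono[of a b M \<tau> 0 j] partition_mono[of a b M \<tau> j M] by (simp add: is_partition_def)

lemma partition_subset:
  assumes "is_partition (min s t) (max s t) M \<tau>" "s \<in> {a..b}" "t \<in> {a..b}" "j \<le> M"
  shows "\<tau> j \<in> {a..b}"
  using partition_in[OF assms(1,4)] assms(2,3) by auto

lemma partition_step_le: "is_partition a b M \<tau> \<Longrightarrow> j < M \<Longrightarrow> \<tau> j \<le> \<tau> (Suc j)"
  by (simp add: is_partition_def less_imp_le)

lemma partition_trivial: "is_partition a a M \<tau> \<Longrightarrow> M = 0"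
  using partition_mono[of a a M \<tau> 1 M] by (cases M) (auto simp: is_partition_def)

lemma partition_step_less_mesh:
  assumes "mesh M \<tau> < \<delta>" "j < M"
  shows "\<tau> (Suc j) - \<tau> j < \<delta>"
proof -
  have "\<tau> (Suc j) - \<tau> j \<le> mesh M \<tau>"
    unfolding mesh_def using assms(2) by (intro Max_ge) auto
  with assms(1) show ?thesis
    by simp
qed

lemma uniform_mesh_limit_cong:
  assumes "uniform_mesh_limit I F L"
    and "\<And>t s M \<tau>. t \<in> I \<Longrightarrow> s \<in> I \<Longrightarrow> is_partition (min s t) (max s t) M \<tau> \<Longrightarrow> F' t s M \<tau> = F t s M \<tau>"
  shows "uniform_mesh_limit I F' L"
  unfolding uniform_mesh_limit_def
proof (intro allI impI)
  fix \<epsilon> :: real assume "0 < \<epsilon>"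
  then obtain \<delta> where "0 < \<delta>" and \<delta>: "\<forall>t\<in>I. \<forall>s\<in>I. \<forall>M \<tau>.
      is_partition (min s t) (max s t) M \<tau> \<and> mesh M \<tau> < \<delta> \<longrightarrow> dist (F t s M \<tau>) (L t s) < \<epsilon>"
    using assms(1) unfolding uniform_mesh_limit_def by meson
  show "\<exists>\<delta>>0. \<forall>t\<in>I. \<forall>s\<in>I. \<forall>M \<tau>.
      is_partition (min s t) (max s t) M \<tau> \<and> mesh M \<tau> < \<delta> \<longrightarrow> dist (F' t s M \<tau>) (L t s) < \<epsilon>"
    by (rule exI[of _ \<delta>]) (use \<open>0 < \<delta>\<close> \<delta> assms(2) in auto)
qed

text \<open>Every step is an isometry and carries the earlier error along without enlarging it. The
  local errors, each \<open>\<epsilon>\<close> times the step length, add up to the bound whatever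
  the number of steps.\<close>

lemma time_slicing_error:
  fixes y :: "real \<Rightarrow> 'a::{real_inner,banach}"
  assumes \<tau>: "is_partition a b M \<tau>" and "0 \<le> \<epsilon>"
    and skew: "\<And>j. j < M \<Longrightarrow> skew (G j)"
    and deriv: "\<And>r. r \<in> {a..b} \<Longrightarrow> (y has_vector_derivative y' r) (at r within {a..b})"
    and bound: "\<And>j r. j < M \<Longrightarrow> r \<in> {\<tau> j..\<tau> (Suc j)} \<Longrightarrow> norm (y' r - blinfun_apply (G j) (y r)) \<le> \<epsilon>"
    and E: "\<And>j. j < M \<Longrightarrow> E j = flow (\<tau> (Suc j) - \<tau> j) (G j)"
  shows "norm (y b - time_ordered E M (y a)) \<le> \<epsilon> * (b - a)"
proof -
  have "norm (y (\<tau> k) - time_ordered E k (y a)) \<le> \<epsilon> * (\<tau> k - a)" if "k \<le> M" for k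
    using that
  proof (induction k)
    case 0
    then show ?case
      using \<tau> by (simp add: is_partition_def)
  next
    case (Suc k)
    then have k: "k < M" by simp
    let ?h = "\<tau> (Suc k) - \<tau> k"
    have sub: "{\<tau> k..\<tau> (Suc k)} \<subseteq> {a..b}"
      using partition_in[OF \<tau>, of k] partition_in[OF \<tau>, of "Suc k"] k by auto
    have "norm (y (\<tau> (Suc k)) - flow ?h (G k) (y (\<tau> k))) \<le> \<epsilon> * ?h"
    proof (rule solution_step)
      show "\<tau> k \<le> \<tau> (Suc k)"
        using partition_mono[OF \<tau>, of k "Suc k"] k by simp
      show "(y has_vector_derivative y' r) (at r within {\<tau> k..\<tau> (Suc k)})"
        if "r \<in> {\<tau> k..\<tau> (Suc k)}" for r
        using has_vector_derivative_within_subset[OF deriv sub] that sub by blast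
    qed (use k skew bound \<open>0 \<le> \<epsilon>\<close> in auto)
    moreover have "norm (flow ?h (G k) (y (\<tau> k)) - time_ordered E (Suc k) (y a)) \<le> \<epsilon> * (\<tau> k - a)"
      using Suc k by (simp add: E norm_flow[OF skew] flip: flow_diff)
    ultimately have "norm (y (\<tau> (Suc k)) - time_ordered E (Suc k) (y a)) \<le> \<epsilon> * ?h + \<epsilon> * (\<tau> k - a)"
      using norm_diff_triangle_le by blast
    then show ?case
      by (simp add: algebra_simps)
  qed
  from this[of M] \<tau> show ?thesis
    by (simp add: is_partition_def)
qed

text \<open>Convergence at the finitely many centres of an \<open>e/3\<close>-net spreads to all of
  \<open>S\<close>, because no \<open>P N\<close> increases distances.\<close>

lemma uniform_limit_on_compact:
  fixes P :: "'i \<Rightarrow> 'a::metric_space \<Rightarrow> 'a"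
  assumes "compact S"
    and contr: "\<And>N x y. dist (P N x) (P N y) \<le> dist x y"
    and lim: "\<And>x. ((\<lambda>N. P N x) \<longlongrightarrow> x) F"
  shows "uniform_limit S P (\<lambda>x. x) F"
proof (rule uniform_limitI)
  fix e :: real assume "0 < e"
  then obtain k where k: "finite k" "S \<subseteq> (\<Union>x\<in>k. ball x (e/3))"
    using \<open>compact S\<close> compact_eq_totally_bounded[of S] by (metis divide_pos_pos zero_less_numeral)
  have "\<forall>\<^sub>F N in F. \<forall>x\<in>k. dist (P N x) x < e/3"
    using tendstoD[OF lim, of "e/3"] \<open>0 < e\<close> by (intro eventually_ball_finite[OF k(1)]) simp
  then show "\<forall>\<^sub>F N in F. \<forall>x\<in>S. dist (P N x) x < e"
  proof (rule eventually_mono, intro ballI)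
    fix N y assume *: "\<forall>x\<in>k. dist (P N x) x < e/3" and "y \<in> S"
    then obtain x where x: "x \<in> k" "dist x y < e/3"
      using k(2) by auto
    have "dist (P N y) y \<le> dist (P N y) (P N x) + dist (P N x) x + dist x y"
      using dist_triangle[of "P N y" y "P N x"] dist_triangle[of "P N x" y x] by linarith
    then show "dist (P N y) y < e"
      using contr[of N y x] * x by (simp add: dist_commute) (smt (verit) dist_commute)
  qed
qed

section \<open>State sums\<close>

lemma complex_linear_on_sum:
  assumes A: "complex_linear_on V A" and x: "\<And>i. i \<in> S \<Longrightarrow> x i \<in> V"
  shows "A (\<Sum>i\<in>S. c i *\<^sub>C x i) = (\<Sum>i\<in>S. c i *\<^sub>C A (x i))"
proof -
  have V: "complex_vector.subspace V"
    and add: "\<And>x y. x \<in> V \<Longrightarrow> y \<in> V \<Longrightarrow> A (x + y) = A x + A y"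
    and scale: "\<And>c x. x \<in> V \<Longrightarrow> A (c *\<^sub>C x) = c *\<^sub>C A x"
    using A by (auto simp: complex_linear_on_def)
  have zero: "A 0 = 0"
    using scale[OF complex_vector.subspace_0[OF V], of 0] by simp
  show ?thesis
    using x
  proof (induction S rule: infinite_finite_induct)
    case (insert i S)
    then have "(\<Sum>j\<in>S. c j *\<^sub>C x j) \<in> V" "c i *\<^sub>C x i \<in> V"
      by (auto intro!: complex_vector.subspace_sum[OF V] complex_vector.subspace_scale[OF V])
    with insert show ?case
      by (simp add: add scale)
  qed (simp_all add: zero)
qed

lemma orthonormal_expansion:
  assumes e: "is_orthonormal_basis d e V" and v: "v \<in> V"
  shows "(\<Sum>c=1..d. cinner (e c) v *\<^sub>C e c) = v"
proof -
  have "v \<in> complex_vector.span (e ` {1..d})"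
    using e v by (simp add: is_orthonormal_basis_def)
  then show ?thesis
  proof (induction rule: complex_vector.span_induct)
    case base
    have "(\<Sum>c=1..d. cinner (e c) (r *\<^sub>C x) *\<^sub>C e c) = r *\<^sub>C (\<Sum>c=1..d. cinner (e c) x *\<^sub>C e c)" for r x
      unfolding complex_vector.scale_sum_right by (simp add: cinner_scaleC_right)
    moreover have "(\<Sum>c=1..d. cinner (e c) (x + y) *\<^sub>C e c) =
        (\<Sum>c=1..d. cinner (e c) x *\<^sub>C e c) + (\<Sum>c=1..d. cinner (e c) y *\<^sub>C e c)" for x y
      by (simp add: cinner_add_right scaleC_add_left sum.distrib)
    ultimately show ?case
      by (simp add: complex_vector.subspace_def)
  next
    case (step x)
    then obtain b where b: "b \<in> {1..d}" "x = e b"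
      by auto
    have "(\<Sum>c=1..d. cinner (e c) x *\<^sub>C e c) = (\<Sum>c=1..d. if c = b then e c else 0)"
      using e b by (intro sum.cong) (auto simp: is_orthonormal_basis_def)
    then show ?case
      using b by simp
  qed
qed

lemma orthonormal_basis_in: "is_orthonormal_basis d e V \<Longrightarrow> c \<in> {1..d} \<Longrightarrow> e c \<in> V"
  unfolding is_orthonormal_basis_def using complex_vector.span_base by blast

text \<open>Matrix multiplication, by induction on the last step: paths are grouped by their index
  at \<open>M\<close>, and the sum over that index is the orthonormal expansion of the vector on
  which \<open>E M\<close> acts.\<close>

lemma path_sum_eq:
  assumes e: "is_orthonormal_basis d e V"
    and lin: "\<And>j. complex_linear_on V (E j)" and inv: "\<And>j v. v \<in> V \<Longrightarrow> E j v \<in> V"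
    and a: "a \<in> {1..d}" and b: "b \<in> {1..d}"
  shows "(\<Sum>p \<in> {p \<in> {0..M} \<rightarrow>\<^sub>E {1..d}. p 0 = b \<and> p M = a}. \<Prod>j<M. cinner (e (p (Suc j))) (E j (e (p j)))) =
    cinner (e a) (time_ordered E M (e b))"
  using a
proof (induction M arbitrary: a)
  case 0
  \<comment> \<open>A path without steps exists only for \<open>a = b\<close>; its empty product is
    the Kronecker delta.\<close>
  have "{p \<in> {0..0} \<rightarrow>\<^sub>E {1..d}. p 0 = b \<and> p 0 = a} = (if a = b then {\<lambda>j\<in>{0..0::nat}. b} else {})"
    using b by (auto simp: PiE_iff extensional_def fun_eq_iff)
  then show ?case
    using e 0 b by (auto simp: is_orthonormal_basis_def)
next
  case (Suc M)
  define w where "w p = (\<Prod>j<M. cinner (e (p (Suc j))) (E j (e (p j))))" for p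
  define Q where "Q = {p \<in> {0..M} \<rightarrow>\<^sub>E {1..d}. p 0 = b}"
  have T_in: "time_ordered E M (e b) \<in> V" for M
    by (induction M) (auto simp: inv orthonormal_basis_in[OF e b])
  have "(\<Sum>p \<in> {p \<in> {0..Suc M} \<rightarrow>\<^sub>E {1..d}. p 0 = b \<and> p (Suc M) = a}.
          \<Prod>j<Suc M. cinner (e (p (Suc j))) (E j (e (p j)))) =
        (\<Sum>q\<in>Q. w q * cinner (e a) (E M (e (q M))))"
  \<comment> \<open>The last index is fixed to \<open>a\<close>, so a path is determined by its
    restriction to \<open>{0..M}\<close>; extensional functions are \<open>undefined\<close> outside
    their domain.\<close>
  proof (rule sum.reindex_bij_witness[where i = "\<lambda>q. q(Suc M := a)" and j = "\<lambda>p. p(Suc M := undefined)"])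
    fix p assume p: "p \<in> {p \<in> {0..Suc M} \<rightarrow>\<^sub>E {1..d}. p 0 = b \<and> p (Suc M) = a}"
    then show "(p(Suc M := undefined))(Suc M := a) = p"
      by auto
    show "p(Suc M := undefined) \<in> Q"
      using p by (auto simp: Q_def PiE_iff extensional_def)
    have "w (p(Suc M := undefined)) = w p"
      unfolding w_def by (rule prod.cong) auto
    then show "w (p(Suc M := undefined)) * cinner (e a) (E M (e ((p(Suc M := undefined)) M))) =
        (\<Prod>j<Suc M. cinner (e (p (Suc j))) (E j (e (p j))))"
      using p by (simp add: w_def)
  next
    fix q assume q: "q \<in> Q"
    then show "(q(Suc M := a))(Suc M := undefined) = q"
      by (auto simp: Q_def PiE_iff extensional_def fun_eq_iff)
    show "q(Suc M := a) \<in> {p \<in> {0..Suc M} \<rightarrow>\<^sub>E {1..d}. p 0 = b \<and> p (Suc M) = a}"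
      using q Suc.prems by (auto simp: Q_def PiE_iff extensional_def)
  qed
  also have "\<dots> = (\<Sum>c=1..d. \<Sum>q \<in> {q \<in> Q. q M = c}. w q * cinner (e a) (E M (e (q M))))"
  proof (rule sum.group[symmetric])
    show "finite Q"
      unfolding Q_def by (rule finite_subset[OF _ finite_PiE[of "{0..M}" "\<lambda>_. {1..d}"]]) auto
    show "(\<lambda>q. q M) ` Q \<subseteq> {1..d}"
      by (auto simp: Q_def PiE_iff)
  qed simp
  also have "\<dots> = (\<Sum>c=1..d. cinner (e c) (time_ordered E M (e b)) * cinner (e a) (E M (e c)))"
  proof (rule sum.cong[OF refl])
    fix c assume c: "c \<in> {1..d}"
    have "{q \<in> Q. q M = c} = {p \<in> {0..M} \<rightarrow>\<^sub>E {1..d}. p 0 = b \<and> p M = c}"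
      by (auto simp: Q_def)
    then have "(\<Sum>q \<in> {q \<in> Q. q M = c}. w q) = cinner (e c) (time_ordered E M (e b))"
      using Suc.IH[OF c] by (simp add: w_def)
    then show "(\<Sum>q \<in> {q \<in> Q. q M = c}. w q * cinner (e a) (E M (e (q M)))) =
        cinner (e c) (time_ordered E M (e b)) * cinner (e a) (E M (e c))"
      by (simp flip: sum_distrib_right)
  qed
  also have "\<dots> = cinner (e a) (E M (\<Sum>c=1..d. cinner (e c) (time_ordered E M (e b)) *\<^sub>C e c))"
    by (subst complex_linear_on_sum[OF lin], rule orthonormal_basis_in[OF e])
      (simp_all add: cinner_sum_right cinner_scaleC_right)
  also have "\<dots> = cinner (e a) (time_ordered E (Suc M) (e b))"
    using orthonormal_expansion[OF e T_in] by simp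
  finally show ?case .
qed

text \<open>\<open>v\<close> stands for the projection of \<open>u\<close>: it has the same
  coefficients but lies in \<open>V\<close>, where the expansion applies.\<close>

lemma matrix_sum_eq:
  assumes e: "is_orthonormal_basis d e V"
    and lin: "complex_linear_on V A" and inv: "\<And>v. v \<in> V \<Longrightarrow> A v \<in> V"
    and v: "v \<in> V" "\<And>b. b \<in> {1..d} \<Longrightarrow> cinner (e b) u = cinner (e b) v"
  shows "(\<Sum>a=1..d. \<Sum>b=1..d. (cinner (e a) (A (e b)) * cinner (e b) u) *\<^sub>C e a) = A v"
proof -
  have "A v = A (\<Sum>b=1..d. cinner (e b) v *\<^sub>C e b)"
    using orthonormal_expansion[OF e v(1)] by simp
  also have "\<dots> = (\<Sum>b=1..d. cinner (e b) u *\<^sub>C A (e b))"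
    by (subst complex_linear_on_sum[OF lin], rule orthonormal_basis_in[OF e]) (simp_all add: v(2))
  finally have "cinner (e a) (A v) = (\<Sum>b=1..d. cinner (e a) (A (e b)) * cinner (e b) u)" for a
    by (simp add: cinner_sum_right cinner_scaleC_right mult.commute)
  then have "(\<Sum>a=1..d. \<Sum>b=1..d. (cinner (e a) (A (e b)) * cinner (e b) u) *\<^sub>C e a) =
      (\<Sum>a=1..d. cinner (e a) (A v) *\<^sub>C e a)"
    by (simp add: complex_vector.scale_sum_left)
  also have "\<dots> = A v"
    by (rule orthonormal_expansion[OF e inv[OF v(1)]])
  finally show ?thesis .
qed

lemma complex_linear_on_inv_into:
  assumes lin: "complex_linear_on V A" and bij: "bij_betw A V V"
  shows "complex_linear_on V (inv_into V A)"
proof -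
  have V: "complex_vector.subspace V"
    and add: "\<And>x y. x \<in> V \<Longrightarrow> y \<in> V \<Longrightarrow> A (x + y) = A x + A y"
    and scale: "\<And>c x. x \<in> V \<Longrightarrow> A (c *\<^sub>C x) = c *\<^sub>C A x"
    using lin by (auto simp: complex_linear_on_def)
  have inv: "inv_into V A x \<in> V" "A (inv_into V A x) = x" if "x \<in> V" for x
    using bij that by (auto simp: bij_betw_def inv_into_into f_inv_into_f)
  have inv_eq: "inv_into V A y = x" if "x \<in> V" "A x = y" for x y
    using bij that by (auto simp: bij_betw_def)
  show ?thesis
    unfolding complex_linear_on_def
  proof (intro conjI ballI allI)
    show "inv_into V A (x + y) = inv_into V A x + inv_into V A y" if "x \<in> V" "y \<in> V" for x y
      using that inv by (intro inv_eq) (simp_all add: complex_vector.subspace_add[OF V] add)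
    show "inv_into V A (c *\<^sub>C x) = c *\<^sub>C inv_into V A x" if "x \<in> V" for c x
      using that inv by (intro inv_eq) (simp_all add: complex_vector.subspace_scale[OF V] scale)
  qed (rule V)
qed

section \<open>Spectral truncations\<close>

context positive_compact_resolvent
begin

abbreviation "P \<equiv> spectral_proj T"
abbreviation "\<Lambda> \<mu> \<equiv> diag (\<lambda>l. (1 + l) powr \<mu>)"

section \<open>Spectral projections and Sobolev weights as diagonal operators\<close>

lemma spectral_proj_eq: "P N = diag (indicator {0..N})"
  by (simp add: spectral_proj_def fun_calc_def diag_def component_def fun_eq_iff)

lemma sobolev_eq: "sobolev T \<mu> = diag_dom (\<lambda>l. (1 + l) powr \<mu>)"
  by (simp add: sobolev_def fun_calc_def diag_dom_def component_def)

lemma sobolev_norm_eq: "sobolev_norm T \<mu> u = norm (\<Lambda> \<mu> u)"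
  by (simp add: sobolev_norm_def fun_calc_def diag_def component_def)

lemma indicator_bound: "\<bar>indicator S l\<bar> \<le> (1::real)"
  by (simp add: indicator_def)

lemma comp_negative: "l < 0 \<Longrightarrow> component l x = 0"
  using eigenspace_negative comp_in by blast

lemma comp_P: "component l (P N x) = indicator {0..N} l *\<^sub>R component l x"
  unfolding spectral_proj_eq by (rule comp_diag[OF diag_dom_bounded[OF indicator_bound[of "{0..N}"]]])

lemma P_P: "P N (P N x) = P N x"
  by (rule comp_eqI) (simp add: comp_P indicator_def)

lemma bounded_linear_P: "bounded_linear (P N)"
  unfolding spectral_proj_eq by (rule bounded_linear_diag[OF indicator_bound[of "{0..N}"]])

sublocale P: bounded_linear "P N" for N
  by (rule bounded_linear_P)

lemma norm_P_le: "norm (P N x) \<le> norm x"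
  using norm_diag_le[OF indicator_bound[of "{0..N}"]] by (simp add: spectral_proj_eq)

lemma P_scaleC: "P N (c *\<^sub>C x) = c *\<^sub>C P N x"
  unfolding spectral_proj_eq by (rule diag_scaleC[OF indicator_bound[of "{0..N}"]])

lemma P_symmetric: "inner (P N x) y = inner x (P N y)"
  unfolding spectral_proj_eq by (rule diag_symmetric[OF indicator_bound[of "{0..N}"]])

lemma norm_P_complement_le: "norm (x - P N x) \<le> norm x"
proof -
  have "inner x (P N x) = inner (P N x) (P N x)"
    by (simp add: P_symmetric P_P)
  then have "(norm (x - P N x))\<^sup>2 = (norm x)\<^sup>2 - (norm (P N x))\<^sup>2"
    unfolding power2_norm_eq_inner by (simp add: inner_diff_left inner_diff_right inner_commute)
  then have "(norm (x - P N x))\<^sup>2 \<le> (norm x)\<^sup>2"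
    by simp
  then show ?thesis
    by (rule power2_le_imp_le) simp
qed

lemma spectral_space_eq: "spectral_space T N = {x. P N x = x}"
proof -
  have "x \<in> range (P N)" if "P N x = x" for x
    using that rangeI[of "P N" x] by simp
  then show ?thesis
    unfolding spectral_space_def by (auto simp: P_P)
qed

lemma spectral_space_closed_subspace: "closed_complex_subspace (spectral_space T N)"
proof
  show "complex_vector.subspace (spectral_space T N)"
    unfolding spectral_space_eq complex_vector.subspace_def
    by (simp add: P.zero P.add P_scaleC)
  show "closed (spectral_space T N)"
    unfolding spectral_space_eq
    by (intro closed_Collect_eq continuous_on_id P.continuous_on)
qed

lemma cinner_P: "w \<in> spectral_space T N \<Longrightarrow> cinner w (P N x) = cinner w x"
proof -
  assume w: "w \<in> spectral_space T N"
  have "\<forall>w\<in>spectral_space T N. inner w (x - P N x) = 0"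
    unfolding spectral_space_eq by (auto simp: inner_diff_right simp flip: P_symmetric)
  then have "cinner w (x - P N x) = 0"
    using cinner_zero_iff_inner_zero[OF closed_complex_subspace.subspace[OF spectral_space_closed_subspace]] w
    by blast
  then show ?thesis
    by (simp add: cinner_diff_right)
qed

text \<open>A finite sum \<open>v\<close> of components is fixed by \<open>P N\<close> once
  \<open>N\<close> exceeds the eigenvalues involved, so \<open>x - P N x\<close> is the
  complementary projection of the small vector \<open>x - v\<close>.\<close>

lemma P_tendsto: "((\<lambda>N. P N x) \<longlongrightarrow> x) at_top"
proof (rule tendstoI)
  fix e :: real assume "0 < e"
  have "((\<lambda>l. component l x) has_sum x) UNIV"
    using diag_has_sum[of x "\<lambda>_. 1"] by (simp add: diag_one diag_dom_bounded[where C = 1])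
  then obtain F where F: "finite F" "dist (\<Sum>l\<in>F. component l x) x \<le> e / 2"
    using has_sum_finite_approximation[where \<epsilon> = "e / 2"] \<open>0 < e\<close> half_gt_zero by metis
  define v where "v = (\<Sum>l\<in>F. component l x)"
  \<comment> \<open>Inserting \<open>0\<close> gives \<open>Max\<close> a value for empty
    \<open>F\<close>.\<close>
  have "dist (P N x) x < e" if N: "Max (insert 0 F) \<le> N" for N
  proof -
    have "P N (component l x) = component l x" if "l \<in> F" for l
    proof (rule comp_eqI)
      fix k
      have "l \<le> N"
        using that N F(1) by simp
      \<comment> \<open>Indices below the lower end of \<open>{0..N}\<close> do no harm: components
        at negative \<open>l\<close> vanish by positivity.\<close>
      then show "component k (P N (component l x)) = component k (component l x)"
        using comp_negative[of l x] comp_other[of k l "component l x"] comp_in[of l x]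
        by (cases "k = l"; cases "l < 0") (auto simp: comp_P indicator_def component.zero)
    qed
    then have "P N v = v"
      by (simp add: v_def P.sum)
    then have "x - P N x = (x - v) - P N (x - v)"
      by (simp add: P.diff)
    then have "norm (x - P N x) \<le> norm (x - v)"
      using norm_P_complement_le[of "x - v" N] by (simp only:)
    then show ?thesis
      using F(2) \<open>0 < e\<close> by (simp add: v_def dist_norm norm_minus_commute)
  qed
  then show "\<forall>\<^sub>F N in at_top. dist (P N x) x < e"
    unfolding eventually_at_top_linorder by blast
qed

text \<open>The multiplier of the weight applied after \<open>P N\<close>. It is bounded, so this
  composition is a bounded operator.\<close>

definition cutoff :: "real \<Rightarrow> real \<Rightarrow> real \<Rightarrow> real"
  where "cutoff \<mu> N l = (if 0 \<le> l \<and> l \<le> N then (1 + l) powr \<mu> else 0)"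

text \<open>The multiplier of the inverse weight. Negative \<open>l\<close> carry no component, and
  the value \<open>0\<close> keeps the multiplier bounded there.\<close>

definition inv_weight :: "real \<Rightarrow> real \<Rightarrow> real"
  where "inv_weight \<mu> l = (if 0 \<le> l then (1 + l) powr (- \<mu>) else 0)"

lemma cutoff_bound: "0 \<le> \<mu> \<Longrightarrow> \<bar>cutoff \<mu> N l\<bar> \<le> (1 + \<bar>N\<bar>) powr \<mu>"
  by (auto simp: cutoff_def intro!: powr_mono2)

lemma inv_weight_bound: "0 \<le> \<mu> \<Longrightarrow> \<bar>inv_weight \<mu> l\<bar> \<le> 1"
  by (auto simp: inv_weight_def powr_minus inverse_le_1_iff intro!: ge_one_powr_ge_zero)

lemma P_sobolev: "0 \<le> \<mu> \<Longrightarrow> P N x \<in> sobolev T \<mu>"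
proof -
  assume \<mu>: "0 \<le> \<mu>"
  have "((1 + l) powr \<mu>)\<^sup>2 * (norm (component l (P N x)))\<^sup>2 = (cutoff \<mu> N l)\<^sup>2 * (norm (component l x))\<^sup>2" for l
    by (simp add: comp_P cutoff_def indicator_def)
  then show ?thesis
    using diag_dom_bounded[OF cutoff_bound[OF \<mu>], where x = x] by (simp add: sobolev_eq diag_dom_def)
qed

lemma weight_P: "0 \<le> \<mu> \<Longrightarrow> \<Lambda> \<mu> (P N x) = diag (cutoff \<mu> N) x"
  by (rule comp_eqI)
    (simp add: comp_diag diag_dom_bounded[OF cutoff_bound] P_sobolev[unfolded sobolev_eq] comp_P
      cutoff_def indicator_def)

text \<open>Functions of one operator commute. A truncation tail in the Sobolev norm is therefore
  the ordinary tail of the weighted vector.\<close>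

lemma weight_P_commute: "0 \<le> \<mu> \<Longrightarrow> v \<in> sobolev T \<mu> \<Longrightarrow> \<Lambda> \<mu> (P N v) = P N (\<Lambda> \<mu> v)"
  by (rule comp_eqI)
    (simp add: comp_diag P_sobolev[unfolded sobolev_eq] sobolev_eq comp_P)

lemma bounded_linear_weight_P: "0 \<le> \<mu> \<Longrightarrow> bounded_linear (\<lambda>x. \<Lambda> \<mu> (P N x))"
  unfolding weight_P by (rule bounded_linear_diag[OF cutoff_bound])

lemma weight_inv_weight_eq: "(1 + l) powr \<mu> *\<^sub>R inv_weight \<mu> l *\<^sub>R component l x = component l x"
proof (cases "0 \<le> l")
  case True
  then have "(1 + l) powr \<mu> * (1 + l) powr (- \<mu>) = 1"
    by (simp flip: powr_add)
  then show ?thesis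
    using True by (simp add: inv_weight_def)
qed (simp add: comp_negative)

lemma inv_weight_sobolev: "0 \<le> \<mu> \<Longrightarrow> diag (inv_weight \<mu>) x \<in> sobolev T \<mu>"
  and weight_inv_weight: "0 \<le> \<mu> \<Longrightarrow> \<Lambda> \<mu> (diag (inv_weight \<mu>) x) = x"
proof -
  assume \<mu>: "0 \<le> \<mu>"
  have component: "(1 + l) powr \<mu> *\<^sub>R component l (diag (inv_weight \<mu>) x) = component l x" for l
    using weight_inv_weight_eq by (simp add: comp_diag diag_dom_bounded[OF inv_weight_bound[OF \<mu>]])
  have "((1 + l) powr \<mu>)\<^sup>2 * (norm (component l (diag (inv_weight \<mu>) x)))\<^sup>2 = (norm (component l x))\<^sup>2" for l
    using arg_cong[OF component[of l], of "\<lambda>x. (norm x)\<^sup>2"] by (simp add: power_mult_distrib)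
  then show *: "diag (inv_weight \<mu>) x \<in> sobolev T \<mu>"
    using components_summable[of x] by (simp add: sobolev_eq diag_dom_def)
  show "\<Lambda> \<mu> (diag (inv_weight \<mu>) x) = x"
    by (rule comp_eqI) (use * component in \<open>simp add: comp_diag sobolev_eq\<close>)
qed

lemma inv_weight_weight:
  assumes "0 \<le> \<mu>" "v \<in> sobolev T \<mu>"
  shows "diag (inv_weight \<mu>) (\<Lambda> \<mu> v) = v"
proof (rule comp_eqI)
  show "component l (diag (inv_weight \<mu>) (\<Lambda> \<mu> v)) = component l v" for l
    using weight_inv_weight_eq[of l \<mu> v] assms(2)
    by (simp add: comp_diag diag_dom_bounded[OF inv_weight_bound[OF assms(1)]] sobolev_eq mult.commute)
qed

lemma norm_le_weight:
  assumes "0 \<le> \<mu>" "v \<in> sobolev T \<mu>"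
  shows "norm v \<le> norm (\<Lambda> \<mu> v)"
  using norm_diag_le[where f = "inv_weight \<mu>" and C = 1 and x = "\<Lambda> \<mu> v", OF inv_weight_bound[OF assms(1)]]
  by (simp add: inv_weight_weight[OF assms])

lemma weight_diff:
  assumes "v \<in> sobolev T \<mu>" "w \<in> sobolev T \<mu>" "v - w \<in> sobolev T \<mu>"
  shows "\<Lambda> \<mu> (v - w) = \<Lambda> \<mu> v - \<Lambda> \<mu> w"
  by (rule comp_eqI) (use assms in \<open>simp add: comp_diag sobolev_eq component.diff scaleR_diff_right\<close>)

lemma weight_scaleR:
  assumes "v \<in> sobolev T \<mu>" "r *\<^sub>R v \<in> sobolev T \<mu>"
  shows "\<Lambda> \<mu> (r *\<^sub>R v) = r *\<^sub>R \<Lambda> \<mu> v"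
  by (rule comp_eqI) (use assms in \<open>simp add: comp_diag sobolev_eq component.scaleR mult.commute\<close>)

text \<open>Boundedness of \<open>Q\<close> makes the supremum a genuine upper bound; scaling
  reduces a nonzero vector to the unit sphere of the Sobolev norm.\<close>

lemma sobolev_opnorm_bound:
  assumes \<mu>: "0 \<le> \<mu>" and Q: "sobolev_bounded T \<mu> Q" and v: "v \<in> sobolev T \<mu>"
  shows "norm (Q v) \<le> sobolev_opnorm T \<mu> Q * norm (\<Lambda> \<mu> v)"
proof (cases "v = 0")
  case False
  have sub: "subspace (sobolev T \<mu>)"
    using Q by (auto simp: sobolev_bounded_def complex_linear_on_def intro: complex_subspace_imp_subspace)
  obtain C where C: "\<And>u. u \<in> sobolev T \<mu> \<Longrightarrow> norm (Q u) \<le> C * norm (\<Lambda> \<mu> u)"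
    using Q by (auto simp: sobolev_bounded_def sobolev_norm_eq)
  have scale: "Q (r *\<^sub>R v) = r *\<^sub>R Q v" for r
    using Q v unfolding sobolev_bounded_def complex_linear_on_def by (metis scaleC_of_real)
  have bdd: "bdd_above ((\<lambda>u. norm (Q u)) ` {u \<in> sobolev T \<mu>. sobolev_norm T \<mu> u \<le> 1})"
  proof (rule bdd_aboveI2)
    fix u assume u: "u \<in> {u \<in> sobolev T \<mu>. sobolev_norm T \<mu> u \<le> 1}"
    then have "C * norm (\<Lambda> \<mu> u) \<le> \<bar>C\<bar> * 1"
      by (intro mult_mono) (auto simp: sobolev_norm_eq)
    then show "norm (Q u) \<le> \<bar>C\<bar>"
      using C[of u] u by simp
  qed
  have pos: "0 < norm (\<Lambda> \<mu> v)"
    using norm_le_weight[OF \<mu> v] False by (smt (verit) zero_less_norm_iff)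
  define w where "w = (1 / norm (\<Lambda> \<mu> v)) *\<^sub>R v"
  have w: "w \<in> sobolev T \<mu>"
    unfolding w_def using sub v by (rule subspace_scale)
  have "norm (\<Lambda> \<mu> w) = 1"
    using pos w v by (simp add: w_def weight_scaleR)
  then have "norm (Q w) \<le> sobolev_opnorm T \<mu> Q"
    unfolding sobolev_opnorm_def by (intro cSUP_upper[OF _ bdd]) (simp add: w sobolev_norm_eq)
  then show ?thesis
    using pos by (simp add: w_def scale divide_le_eq)
next
  case True
  then have "Q v = 0"
    using Q v unfolding sobolev_bounded_def complex_linear_on_def
    by (metis complex_vector.scale_zero_left)
  then show ?thesis
    using True weight_scaleR[of v \<mu> 0] v by simp
qed

end

section \<open>Truncated evolutions\<close>

text \<open>Skewness is left to an extension of this locale: on a one-point interval there is no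
  derivative to read it off from, yet the state-sum identity is wanted there too.\<close>

locale truncated_evolution = positive_compact_resolvent T for T :: "'a::complex_hilbert operator" +
  fixes \<mu> :: real and I :: "real set" and K :: "real \<Rightarrow> 'a \<Rightarrow> 'a"
  assumes \<mu>: "0 \<le> \<mu>"
    and K_bounded: "t \<in> I \<Longrightarrow> sobolev_bounded T \<mu> (K t)"
    and K_continuous: "t0 \<in> I \<Longrightarrow>
      ((\<lambda>t. sobolev_opnorm T \<mu> (\<lambda>v. K t v - K t0 v)) \<longlongrightarrow> 0) (at t0 within I)"
begin

abbreviation "R \<equiv> diag (inv_weight \<mu>)"

lemma K_add: "t \<in> I \<Longrightarrow> v \<in> sobolev T \<mu> \<Longrightarrow> w \<in> sobolev T \<mu> \<Longrightarrow> K t (v + w) = K t v + K t w"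
  and K_scaleC: "t \<in> I \<Longrightarrow> v \<in> sobolev T \<mu> \<Longrightarrow> K t (c *\<^sub>C v) = c *\<^sub>C K t v"
  using K_bounded by (auto simp: sobolev_bounded_def complex_linear_on_def)

lemma K_scaleR: "t \<in> I \<Longrightarrow> v \<in> sobolev T \<mu> \<Longrightarrow> K t (r *\<^sub>R v) = r *\<^sub>R K t v"
  using K_scaleC[of t v "complex_of_real r"] by (simp add: scaleC_of_real)

lemma sobolev_subspace: "t \<in> I \<Longrightarrow> complex_vector.subspace (sobolev T \<mu>)"
  using K_bounded by (auto simp: sobolev_bounded_def complex_linear_on_def)

lemma K_diff_bounded:
  assumes t: "t \<in> I" and t0: "t0 \<in> I"
  shows "sobolev_bounded T \<mu> (\<lambda>v. K t v - K t0 v)"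
proof -
  obtain C C' where "\<And>u. u \<in> sobolev T \<mu> \<Longrightarrow> norm (K t u) \<le> C * sobolev_norm T \<mu> u"
    "\<And>u. u \<in> sobolev T \<mu> \<Longrightarrow> norm (K t0 u) \<le> C' * sobolev_norm T \<mu> u"
    using K_bounded[OF t] K_bounded[OF t0] unfolding sobolev_bounded_def by blast
  then have "norm (K t u - K t0 u) \<le> (C + C') * sobolev_norm T \<mu> u" if "u \<in> sobolev T \<mu>" for u
    using that norm_triangle_ineq4[of "K t u" "K t0 u"] by (fastforce simp: distrib_right)
  then show ?thesis
    unfolding sobolev_bounded_def complex_linear_on_def
    using sobolev_subspace[OF t] assms
    by (auto simp: K_add K_scaleC complex_vector.scale_right_diff_distrib)
qed

text \<open>\<open>K t\<close> after the inverse weight, a bounded operator on the whole space. It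
  turns continuity with respect to \<open>sobolev_opnorm\<close> into continuity of a
  \<open>blinfun\<close>-valued map.\<close>

definition K_weighted :: "real \<Rightarrow> 'a \<Rightarrow>\<^sub>L 'a"
  where "K_weighted t = Blinfun (\<lambda>x. K t (R x))"

lemma K_weighted_apply: "t \<in> I \<Longrightarrow> blinfun_apply (K_weighted t) x = K t (R x)"
proof -
  assume t: "t \<in> I"
  have lin: "R (x + y) = R x + R y" "R (r *\<^sub>R x) = r *\<^sub>R R x" for x y r
    using bounded_linear_diag[OF inv_weight_bound[OF \<mu>]]
    by (auto simp: linear_simps)
  obtain C where C: "\<And>u. u \<in> sobolev T \<mu> \<Longrightarrow> norm (K t u) \<le> C * norm (\<Lambda> \<mu> u)"
    using K_bounded[OF t] by (auto simp: sobolev_bounded_def sobolev_norm_eq)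
  have "bounded_linear (\<lambda>x. K t (R x))"
  proof (rule bounded_linear_intro[where K = C])
    show "norm (K t (R x)) \<le> norm x * C" for x
      using C[OF inv_weight_sobolev[OF \<mu>], of x] by (simp add: weight_inv_weight[OF \<mu>] mult.commute)
  qed (simp_all add: lin K_add[OF t] K_scaleR[OF t] inv_weight_sobolev[OF \<mu>])
  then show ?thesis
    by (simp add: K_weighted_def bounded_linear_Blinfun_apply)
qed

lemma K_eq_K_weighted: "t \<in> I \<Longrightarrow> v \<in> sobolev T \<mu> \<Longrightarrow> K t v = blinfun_apply (K_weighted t) (\<Lambda> \<mu> v)"
  by (simp add: K_weighted_apply inv_weight_weight[OF \<mu>])

lemma norm_K_weighted_diff_le:
  assumes t: "t \<in> I" and t0: "t0 \<in> I"
  shows "norm (K_weighted t - K_weighted t0) \<le> sobolev_opnorm T \<mu> (\<lambda>v. K t v - K t0 v)"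
proof (rule norm_blinfun_bound)
  have bound: "norm (K t (R x) - K t0 (R x)) \<le> sobolev_opnorm T \<mu> (\<lambda>v. K t v - K t0 v) * norm x" for x
    using sobolev_opnorm_bound[OF \<mu> K_diff_bounded[OF assms] inv_weight_sobolev[OF \<mu>, of x]]
    by (simp add: weight_inv_weight[OF \<mu>])
  then show "norm (blinfun_apply (K_weighted t - K_weighted t0) x) \<le> sobolev_opnorm T \<mu> (\<lambda>v. K t v - K t0 v) * norm x" for x
    by (simp add: blinfun.diff_left K_weighted_apply assms)
  \<comment> \<open>The operator norm bound requires a nonnegative constant; the supremum dominates
    the norm at \<open>0\<close>, which lies in the unit ball.\<close>
  have "0 \<in> {u \<in> sobolev T \<mu>. sobolev_norm T \<mu> u \<le> 1}"
    using weight_scaleR[of "R 0" \<mu> 0] inv_weight_sobolev[OF \<mu>, of 0]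
      complex_vector.subspace_0[OF sobolev_subspace[OF t]]
    by (simp add: sobolev_norm_eq)
  moreover obtain C where "\<And>u. u \<in> sobolev T \<mu> \<Longrightarrow> norm (K t u - K t0 u) \<le> C * sobolev_norm T \<mu> u"
    using K_diff_bounded[OF assms] unfolding sobolev_bounded_def by blast
  then have "bdd_above ((\<lambda>u. norm (K t u - K t0 u)) ` {u \<in> sobolev T \<mu>. sobolev_norm T \<mu> u \<le> 1})"
    by (intro bdd_aboveI2[of _ _ "\<bar>C\<bar>"])
      (smt (verit) mem_Collect_eq mult_left_le mult_right_mono norm_ge_zero sobolev_norm_eq)
  ultimately have "norm (K t 0 - K t0 0) \<le> sobolev_opnorm T \<mu> (\<lambda>v. K t v - K t0 v)"
    unfolding sobolev_opnorm_def by (rule cSUP_upper)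
  then show "0 \<le> sobolev_opnorm T \<mu> (\<lambda>v. K t v - K t0 v)"
    using norm_ge_zero order_trans by blast
qed

lemma continuous_on_K_weighted: "continuous_on I K_weighted"
  unfolding continuous_on_def
proof
  fix t0 assume t0: "t0 \<in> I"
  have "((\<lambda>t. K_weighted t - K_weighted t0) \<longlongrightarrow> 0) (at t0 within I)"
  proof (rule Lim_null_comparison[OF _ K_continuous[OF t0]])
    show "\<forall>\<^sub>F t in at t0 within I. norm (K_weighted t - K_weighted t0) \<le> sobolev_opnorm T \<mu> (\<lambda>v. K t v - K t0 v)"
      using norm_K_weighted_diff_le t0 by (auto simp: eventually_at_filter)
  qed
  then show "(K_weighted \<longlongrightarrow> K_weighted t0) (at t0 within I)"
    by (rule LIM_zero_cancel)
qed

text \<open>The generator \<open>- \<i> P K P\<close>, written as a product of bounded operators so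
  that norm continuity in \<open>t\<close> is inherited from \<open>K_weighted\<close>.\<close>

definition gen :: "real \<Rightarrow> real \<Rightarrow> 'a \<Rightarrow>\<^sub>L 'a"
  where "gen N t = Blinfun (\<lambda>x. (- \<i>) *\<^sub>C P N x) o\<^sub>L K_weighted t o\<^sub>L Blinfun (\<lambda>x. \<Lambda> \<mu> (P N x))"

lemma gen_apply:
  assumes t: "t \<in> I"
  shows "blinfun_apply (gen N t) x = (- \<i>) *\<^sub>C P N (K t (P N x))"
proof -
  have "bounded_linear (\<lambda>x. (- \<i>) *\<^sub>C P N x)"
    by (rule bounded_linear_compose[OF bounded_linear_scaleC bounded_linear_P])
  then show ?thesis
    by (simp add: gen_def bounded_linear_Blinfun_apply bounded_linear_weight_P[OF \<mu>]
        K_eq_K_weighted[OF t P_sobolev[OF \<mu>]])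
qed

lemma continuous_on_gen: "continuous_on I (gen N)"
  unfolding gen_def by (intro continuous_intros continuous_on_K_weighted)

lemma gen_in: "t \<in> I \<Longrightarrow> blinfun_apply (gen N t) x \<in> spectral_space T N"
  by (simp only: gen_apply spectral_space_eq mem_Collect_eq P_scaleC P_P)

lemma gen_scaleC: "t \<in> I \<Longrightarrow> blinfun_apply (gen N t) (c *\<^sub>C x) = c *\<^sub>C blinfun_apply (gen N t) x"
  by (simp add: gen_apply P_scaleC K_scaleC P_sobolev[OF \<mu>] scaleC_scaleC mult.commute)

text \<open>Moves the imaginary unit into the generator and leaves the real step length as flow
  time.\<close>

lemma short_step_eq:
  assumes "\<tau> j \<in> I"
  shows "short_step T K N \<tau> j = flow (\<tau> (Suc j) - \<tau> j) (gen N (\<tau> j))"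
proof -
  have "(- \<i> * complex_of_real h) *\<^sub>C truncated T N (K (\<tau> j)) v = h *\<^sub>R blinfun_apply (gen N (\<tau> j)) v" for h v
    by (simp add: gen_apply[OF assms] truncated_def scaleC_scaleC mult.commute flip: scaleC_of_real)
  then show ?thesis
    unfolding short_step_def by (simp only:)
qed

lemma flow_gen_linear: "t \<in> I \<Longrightarrow> complex_linear_on UNIV (flow h (gen N t))"
  unfolding complex_linear_on_def
  by (auto simp: flow_add gen_scaleC intro!: flow_commute_bounded_linear[OF bounded_linear_scaleC])

lemma flow_gen_in: "t \<in> I \<Longrightarrow> v \<in> spectral_space T N \<Longrightarrow> flow h (gen N t) v \<in> spectral_space T N"
  using spectral_space_closed_subspace[of N] gen_in
  by (intro flow_in_closed_subspace complex_subspace_imp_subspace)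
    (auto simp: closed_complex_subspace_def)

abbreviation "slices N \<tau> M \<equiv> time_ordered (short_step T K N \<tau>) M"

lemma slices_linear:
  assumes "\<And>j. j < M \<Longrightarrow> \<tau> j \<in> I"
  shows "complex_linear_on UNIV (slices N \<tau> M)"
  using assms
proof (induction M)
  case 0
  show ?case
    by (simp add: complex_linear_on_def)
next
  case (Suc M)
  have "complex_linear_on UNIV (short_step T K N \<tau> M)"
    using Suc.prems by (simp add: short_step_eq flow_gen_linear)
  then show ?case
    using Suc.IH Suc.prems by (simp add: complex_linear_on_def)
qed

lemma slices_in:
  assumes "\<And>j. j < M \<Longrightarrow> \<tau> j \<in> I" and "v \<in> spectral_space T N"
  shows "slices N \<tau> M v \<in> spectral_space T N"
  using assms by (induction M) (simp_all add: short_step_eq flow_gen_in)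

lemma slices_diff:
  assumes "\<And>j. j < M \<Longrightarrow> \<tau> j \<in> I"
  shows "slices N \<tau> M (x - y) = slices N \<tau> M x - slices N \<tau> M y"
proof -
  have lin: "slices N \<tau> M (x + y) = slices N \<tau> M x + slices N \<tau> M y"
    "slices N \<tau> M (c *\<^sub>C x) = c *\<^sub>C slices N \<tau> M x" for x y c
    using slices_linear[OF assms] unfolding complex_linear_on_def by auto
  show ?thesis
    using lin(1)[of "x - y" y] by simp
qed

end

text \<open>The condition says that \<open>cinner v (K t v)\<close> is real, the quadratic-form
  version of symmetry on the Sobolev space.\<close>

locale skew_truncated_evolution = truncated_evolution +
  assumes K_skew: "t \<in> I \<Longrightarrow> v \<in> sobolev T \<mu> \<Longrightarrow> inner v (\<i> *\<^sub>C K t v) = 0"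
begin

lemma gen_skew: "t \<in> I \<Longrightarrow> skew (gen N t)"
proof
  fix x assume t: "t \<in> I"
  have "inner x (blinfun_apply (gen N t) x) = - inner (P N x) (\<i> *\<^sub>C K t (P N x))"
    by (simp add: gen_apply[OF t] P_symmetric P_scaleC)
  then show "inner x (blinfun_apply (gen N t) x) = 0"
    by (simp add: K_skew[OF t P_sobolev[OF \<mu>]])
qed

lemma norm_slices:
  assumes "\<And>j. j < M \<Longrightarrow> \<tau> j \<in> I"
  shows "norm (slices N \<tau> M v) = norm v"
  using assms by (induction M) (simp_all add: short_step_eq norm_flow gen_skew)

text \<open>Injectivity comes from isometry. For surjectivity the last step is undone by the flow
  with reversed time, which also preserves the spectral space.\<close>

lemma slices_bij:
  assumes \<tau>: "\<And>j. j < M \<Longrightarrow> \<tau> j \<in> I" and step: "\<And>j. j < M \<Longrightarrow> \<tau> j \<le> \<tau> (Suc j)"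
  shows "bij_betw (slices N \<tau> M) (spectral_space T N) (spectral_space T N)"
  unfolding bij_betw_def
proof
  show "inj_on (slices N \<tau> M) (spectral_space T N)"
  proof (rule inj_onI)
    fix x y assume "slices N \<tau> M x = slices N \<tau> M y"
    then show "x = y"
      using norm_slices[of M \<tau> N "x - y"] \<tau> by (simp add: slices_diff)
  qed
  have surj: "\<exists>x\<in>spectral_space T N. slices N \<tau> M x = v" if "v \<in> spectral_space T N" for v
    using \<tau> step that
  proof (induction M arbitrary: v)
    case 0
    then show ?case by simp
  next
    case (Suc M)
    let ?h = "\<tau> (Suc M) - \<tau> M"
    have t: "\<tau> M \<in> I" and "0 \<le> ?h"
      using Suc.prems by auto
    have "flow (- ?h) (gen N (\<tau> M)) v \<in> spectral_space T N"
      by (rule flow_gen_in[OF t Suc.prems(3)])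
    then obtain x where x: "x \<in> spectral_space T N" "slices N \<tau> M x = flow (- ?h) (gen N (\<tau> M)) v"
      using Suc.IH Suc.prems by (metis less_SucI)
    have "slices N \<tau> (Suc M) x = v"
      using flow_inverse[OF gen_skew[OF t] \<open>0 \<le> ?h\<close>] x(2)
      by (simp add: short_step_eq[where \<tau> = \<tau>, OF t] del: scaleR_minus_left)
    then show ?case
      using x(1) by blast
  qed
  show "slices N \<tau> M ` spectral_space T N = spectral_space T N"
  proof
    show "slices N \<tau> M ` spectral_space T N \<subseteq> spectral_space T N"
      by (rule image_subsetI) (rule slices_in[OF \<tau>])
    show "spectral_space T N \<subseteq> slices N \<tau> M ` spectral_space T N"
      by (rule subsetI) (metis surj image_eqI)
  qed
qed

text \<open>The exact solution keeps its norm, so freezing the generator at \<open>\<tau> j\<close>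
  causes a defect of at most \<open>\<epsilon> * norm v\<close>. The slices always run from
  \<open>min s t\<close> to \<open>max s t\<close>.\<close>

lemma approx_propagator_error:
  assumes I: "I = {a..b}" and s: "s \<in> I" and t: "t \<in> I"
    and \<tau>: "is_partition (min s t) (max s t) M \<tau>" and v: "v \<in> spectral_space T N" "y s = v"
    and deriv: "\<And>r. r \<in> {min s t..max s t} \<Longrightarrow>
      (y has_vector_derivative blinfun_apply (gen N r) (y r)) (at r within {min s t..max s t})"
    and \<epsilon>: "0 \<le> \<epsilon>"
    and gen: "\<And>j r. j < M \<Longrightarrow> r \<in> {\<tau> j..\<tau> (Suc j)} \<Longrightarrow> norm (gen N r - gen N (\<tau> j)) \<le> \<epsilon>"
  shows "norm (y t - approx_propagator T K N t s M \<tau> v) \<le> \<epsilon> * norm v * \<bar>t - s\<bar>"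
proof -
  have sub: "{min s t..max s t} \<subseteq> I"
    using s t I by auto
  have \<tau>_in: "\<tau> j \<in> I" if "j \<le> M" for j
    using partition_in[OF \<tau> that] sub by blast
  have same_norm: "\<bar>norm (y q) - norm (y p)\<bar> \<le> 0 * (q - p)" if "p \<le> q" "{p..q} \<subseteq> {min s t..max s t}" for p q
  proof (rule norm_growth[OF that(1) order_refl])
    show "(y has_vector_derivative blinfun_apply (gen N r) (y r)) (at r within {p..q})" if "r \<in> {p..q}" for r
      using has_vector_derivative_within_subset[OF deriv] that \<open>{p..q} \<subseteq> _\<close> by blast
    show "\<bar>inner (y r) (blinfun_apply (gen N r) (y r))\<bar> \<le> 0 * norm (y r)" if "r \<in> {p..q}" for r
    proof -
      have "r \<in> I"
        using that \<open>{p..q} \<subseteq> _\<close> sub by blast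
      then show ?thesis
        using gen_skew[of r N] by simp
    qed
  qed
  have norm_y: "norm (y r) = norm v" if r: "r \<in> {min s t..max s t}" for r
    using same_norm[of r s] same_norm[of s r] r v(2) by (cases "r \<le> s") auto
  have "norm (y (max s t) - slices N \<tau> M (y (min s t))) \<le> (\<epsilon> * norm v) * (max s t - min s t)"
  proof (rule time_slicing_error[OF \<tau> _ _ deriv, where G = "\<lambda>j. gen N (\<tau> j)"])
    show "skew (gen N (\<tau> j))" if "j < M" for j
      using gen_skew[OF \<tau>_in] that by simp
    show "short_step T K N \<tau> j = flow (\<tau> (Suc j) - \<tau> j) (gen N (\<tau> j))" if "j < M" for j
      using short_step_eq[where \<tau> = \<tau>, OF \<tau>_in] that by simp
    show "norm (blinfun_apply (gen N r) (y r) - blinfun_apply (gen N (\<tau> j)) (y r)) \<le> \<epsilon> * norm v"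
      if "j < M" "r \<in> {\<tau> j..\<tau> (Suc j)}" for j r
    proof -
      have "r \<in> {min s t..max s t}"
        using that partition_in[OF \<tau>, of j] partition_in[OF \<tau>, of "Suc j"] by auto
      then have "norm (blinfun_apply (gen N r - gen N (\<tau> j)) (y r)) \<le> norm (gen N r - gen N (\<tau> j)) * norm v"
        using norm_blinfun[of "gen N r - gen N (\<tau> j)" "y r"] by (simp add: norm_y)
      also have "\<dots> \<le> \<epsilon> * norm v"
        by (intro mult_right_mono gen that) simp
      finally show ?thesis
        by (simp add: blinfun.diff_left)
    qed
  qed (use \<epsilon> in auto)
  then have err: "norm (y (max s t) - slices N \<tau> M (y (min s t))) \<le> \<epsilon> * norm v * \<bar>t - s\<bar>"
    by (simp add: max_def min_def abs_if split: if_splits)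
  show ?thesis
  proof (cases "s \<le> t")
    case True
    then show ?thesis
      using err v(2) by (simp add: approx_propagator_def)
  next
    case False
    \<comment> \<open>The slices map \<open>q\<close> exactly to \<open>v\<close> and
      \<open>y t\<close> close to \<open>y s = v\<close>; being isometric, they bound
      \<open>y t - q\<close> by the forward error.\<close>
    define q where "q = inv_into (spectral_space T N) (slices N \<tau> M) v"
    have "bij_betw (slices N \<tau> M) (spectral_space T N) (spectral_space T N)"
      using \<tau>_in partition_step_le[OF \<tau>] by (intro slices_bij) auto
    then have "slices N \<tau> M q = v"
      unfolding q_def using v(1) by (simp add: bij_betw_def f_inv_into_f)
    moreover have "norm (slices N \<tau> M (y t) - slices N \<tau> M q) = norm (y t - q)"
      using slices_diff[of M \<tau> N "y t" q] norm_slices[of M \<tau> N "y t - q"] \<tau>_in by simp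
    ultimately have "norm (y t - q) \<le> \<epsilon> * norm v * \<bar>t - s\<bar>"
      using err False v(2) by (simp add: norm_minus_commute)
    then show ?thesis
      using False by (simp add: approx_propagator_def q_def)
  qed
qed

lemma truncated_ode_exists:
  assumes I: "I = {a..b}" and s: "s \<in> I" and t: "t \<in> I"
  shows "\<exists>y. y s = v \<and> (\<forall>r \<in> {min s t..max s t}.
      (y has_vector_derivative blinfun_apply (gen N r) (y r)) (at r within {min s t..max s t}))"
proof -
  have cont: "continuous_on {min s t..max s t} (gen N)"
    by (rule continuous_on_subset[OF continuous_on_gen]) (use I s t in auto)
  have le: "min s t \<le> max s t"
    by simp
  show ?thesis
  proof (cases "s \<le> t")
    case True
    obtain y where "y (min s t) = v" "\<And>r. r \<in> {min s t..max s t} \<Longrightarrow>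
        (y has_vector_derivative blinfun_apply (gen N r) (y r)) (at r within {min s t..max s t})"
      by (rule linear_ode_exists[OF le cont, of v]) blast
    with True show ?thesis
      by (intro exI[of _ y]) simp
  next
    case False
    obtain y where "y (max s t) = v" "\<And>r. r \<in> {min s t..max s t} \<Longrightarrow>
        (y has_vector_derivative blinfun_apply (gen N r) (y r)) (at r within {min s t..max s t})"
      by (rule linear_ode_exists_terminal[OF le cont, of v]) blast
    with False show ?thesis
      by (intro exI[of _ y]) simp
  qed
qed

text \<open>The end value of some solution on the interval between \<open>s\<close> and
  \<open>t\<close>, in either order; the estimates below apply to whichever solution is
  chosen.\<close>

definition truncated_propagator :: "real \<Rightarrow> real \<Rightarrow> real \<Rightarrow> 'a \<Rightarrow> 'a"
  where "truncated_propagator N t s v = (SOME z. \<exists>y. y s = v \<and> y t = z \<and>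
    (\<forall>r \<in> {min s t..max s t}.
      (y has_vector_derivative blinfun_apply (gen N r) (y r)) (at r within {min s t..max s t})))"

lemma truncated_propagator:
  assumes "I = {a..b}" "s \<in> I" "t \<in> I"
  obtains y where "y s = v" "y t = truncated_propagator N t s v"
    "\<And>r. r \<in> {min s t..max s t} \<Longrightarrow>
      (y has_vector_derivative blinfun_apply (gen N r) (y r)) (at r within {min s t..max s t})"
proof -
  have "\<exists>z y. y s = v \<and> y t = z \<and> (\<forall>r \<in> {min s t..max s t}.
      (y has_vector_derivative blinfun_apply (gen N r) (y r)) (at r within {min s t..max s t}))"
    using truncated_ode_exists[OF assms] by blast
  from someI_ex[OF this] obtain y where "y s = v" "y t = truncated_propagator N t s v"
    "\<forall>r \<in> {min s t..max s t}.
      (y has_vector_derivative blinfun_apply (gen N r) (y r)) (at r within {min s t..max s t})"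
    unfolding truncated_propagator_def[symmetric] by (elim exE conjE)
  then show ?thesis
    using that by simp
qed

lemma time_slicing_converges:
  assumes I: "I = {a..b}"
  shows "uniform_mesh_limit I (\<lambda>t s M \<tau>. approx_propagator T K N t s M \<tau> (P N u))
    (\<lambda>t s. truncated_propagator N t s (P N u))"
  unfolding uniform_mesh_limit_def
proof (intro allI impI)
  fix \<epsilon> :: real assume "0 < \<epsilon>"
  \<comment> \<open>The summands \<open>1\<close> make \<open>c\<close> positive and strictly larger
    than \<open>norm u * \<bar>b - a\<bar>\<close>.\<close>
  define c where "c = (norm u + 1) * (\<bar>b - a\<bar> + 1)"
  have "0 < c"
    unfolding c_def by (intro mult_pos_pos) (auto intro: add_nonneg_pos)
  then have "0 < \<epsilon> / c"
    using \<open>0 < \<epsilon>\<close> by simp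
  \<comment> \<open>For fixed \<open>N\<close>, freezing the generator over a step shorter than
    \<open>\<delta>\<close> costs less than \<open>\<epsilon> / c\<close>, wherever the step lies in
    \<open>I\<close>.\<close>
  have "uniformly_continuous_on I (gen N)"
    using continuous_on_gen I compact_uniformly_continuous by blast
  then obtain \<delta> where "0 < \<delta>"
    and \<delta>: "\<And>r r'. r \<in> I \<Longrightarrow> r' \<in> I \<Longrightarrow> dist r' r < \<delta> \<Longrightarrow> dist (gen N r') (gen N r) < \<epsilon> / c"
    using \<open>0 < \<epsilon> / c\<close> unfolding uniformly_continuous_on_def by metis
  show "\<exists>\<delta>>0. \<forall>t\<in>I. \<forall>s\<in>I. \<forall>M \<tau>. is_partition (min s t) (max s t) M \<tau> \<and> mesh M \<tau> < \<delta> \<longrightarrow>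
      dist (approx_propagator T K N t s M \<tau> (P N u)) (truncated_propagator N t s (P N u)) < \<epsilon>"
  proof (intro exI[of _ \<delta>] conjI ballI allI impI)
    fix t s M \<tau> assume t: "t \<in> I" and s: "s \<in> I"
      and *: "is_partition (min s t) (max s t) M \<tau> \<and> mesh M \<tau> < \<delta>"
    obtain y where y: "y s = P N u" "y t = truncated_propagator N t s (P N u)"
      "\<And>r. r \<in> {min s t..max s t} \<Longrightarrow>
        (y has_vector_derivative blinfun_apply (gen N r) (y r)) (at r within {min s t..max s t})"
      by (rule truncated_propagator[OF I s t, where v = "P N u" and N = N]) blast
    have "norm (y t - approx_propagator T K N t s M \<tau> (P N u)) \<le> \<epsilon> / c * norm (P N u) * \<bar>t - s\<bar>"
    proof (rule approx_propagator_error[OF I s t _ _ y(1) y(3)])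
      show "is_partition (min s t) (max s t) M \<tau>"
        using * by blast
      show "P N u \<in> spectral_space T N"
        by (simp add: spectral_space_eq P_P)
      show "norm (gen N r - gen N (\<tau> j)) \<le> \<epsilon> / c" if "j < M" "r \<in> {\<tau> j..\<tau> (Suc j)}" for j r
      proof -
        have "\<tau> j \<in> {min s t..max s t}" "\<tau> (Suc j) \<in> {min s t..max s t}"
          using that(1) * by (auto intro!: partition_in simp del: atLeastAtMost_iff)
        then have "\<tau> j \<in> I" "r \<in> I"
          using that(2) s t I by auto
        moreover have "\<tau> (Suc j) - \<tau> j < \<delta>"
          using partition_step_less_mesh that(1) * by blast
        then have "dist r (\<tau> j) < \<delta>"
          using that(2) by (simp add: dist_real_def)
        ultimately show ?thesis
          using \<delta>[of "\<tau> j" r] by (simp add: dist_norm)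
      qed
    qed (use \<open>0 < \<epsilon> / c\<close> in auto)
    also have "\<dots> \<le> \<epsilon> / c * norm u * \<bar>b - a\<bar>"
      using less_imp_le[OF \<open>0 < \<epsilon> / c\<close>] norm_P_le s t I
      by (intro mult_mono mult_nonneg_nonneg norm_ge_zero) auto
    also have "\<dots> < \<epsilon> / c * c"
    proof -
      have "norm u * \<bar>b - a\<bar> < c"
        unfolding c_def by (intro mult_strict_mono) (auto intro: add_nonneg_pos)
      then show ?thesis
        unfolding mult.assoc using \<open>0 < \<epsilon> / c\<close> by (rule mult_strict_left_mono)
    qed
    also have "\<dots> = \<epsilon>"
      using \<open>0 < c\<close> by simp
    finally show "dist (approx_propagator T K N t s M \<tau> (P N u)) (truncated_propagator N t s (P N u)) < \<epsilon>"
      by (simp add: y(2) dist_norm norm_minus_commute)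
  qed (rule \<open>0 < \<delta>\<close>)
qed

text \<open>\<open>P N (w r)\<close> solves the truncated equation up to \<open>g\<close>, where
  \<open>K\<close> meets only the tail of \<open>w\<close>. Bounding this term through
  \<open>K_weighted\<close> gives a constant independent of \<open>N\<close>.\<close>

lemma truncation_error:
  assumes I: "I = {a..b}" and s: "s \<in> I" and t: "t \<in> I"
    and C: "\<And>r. r \<in> I \<Longrightarrow> norm (K_weighted r) \<le> C"
    and w: "\<And>r. r \<in> I \<Longrightarrow> w r \<in> sobolev T \<mu>"
    and dw: "\<And>r. r \<in> I \<Longrightarrow> (w has_vector_derivative (- \<i>) *\<^sub>C K r (w r)) (at r within I)"
    and tail: "\<And>r. r \<in> I \<Longrightarrow> norm (\<Lambda> \<mu> (w r) - P N (\<Lambda> \<mu> (w r))) \<le> \<zeta>"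
  shows "norm (truncated_propagator N t s (P N (w s)) - P N (w t)) \<le> C * \<zeta> * \<bar>t - s\<bar>"
proof -
  have sub: "{min s t..max s t} \<subseteq> I"
    using s t I by auto
  have "0 \<le> C" "0 \<le> \<zeta>"
    using C[OF s] tail[OF s] norm_ge_zero order_trans by blast+
  obtain y where y: "y s = P N (w s)" "y t = truncated_propagator N t s (P N (w s))"
    "\<And>r. r \<in> {min s t..max s t} \<Longrightarrow>
      (y has_vector_derivative blinfun_apply (gen N r) (y r)) (at r within {min s t..max s t})"
    by (rule truncated_propagator[OF I s t, where v = "P N (w s)" and N = N]) blast
  let ?d = "\<lambda>r. y r - P N (w r)"
  define g where "g r = \<i> *\<^sub>C P N (K r (w r - P N (w r)))" for r
  have g_le: "norm (g r) \<le> C * \<zeta>" if r: "r \<in> I" for r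
  proof -
    have wP: "w r - P N (w r) \<in> sobolev T \<mu>"
      using complex_vector.subspace_diff[OF sobolev_subspace[OF r] w[OF r] P_sobolev[OF \<mu>]] .
    have "norm (g r) \<le> norm (K r (w r - P N (w r)))"
      unfolding g_def norm_scaleC using norm_P_le by simp
    also have "\<dots> = norm (blinfun_apply (K_weighted r) (\<Lambda> \<mu> (w r) - P N (\<Lambda> \<mu> (w r))))"
      by (simp add: K_eq_K_weighted[OF r wP] weight_diff[OF w[OF r] P_sobolev[OF \<mu>] wP]
          weight_P_commute[OF \<mu> w[OF r]])
    also have "\<dots> \<le> norm (K_weighted r) * norm (\<Lambda> \<mu> (w r) - P N (\<Lambda> \<mu> (w r)))"
      by (rule norm_blinfun)
    also have "\<dots> \<le> C * \<zeta>"
      using \<open>0 \<le> C\<close> by (intro mult_mono C tail r) auto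
    finally show ?thesis .
  qed
  have "\<bar>norm (?d (max s t)) - norm (?d (min s t))\<bar> \<le> C * \<zeta> * (max s t - min s t)"
  proof (rule norm_growth)
    fix r assume r: "r \<in> {min s t..max s t}"
    then have rI: "r \<in> I"
      using sub by blast
    have "K r (w r) = K r (P N (w r)) + K r (w r - P N (w r))"
      using K_add[OF rI P_sobolev[OF \<mu>], of "w r - P N (w r)" N "w r"]
        complex_vector.subspace_diff[OF sobolev_subspace[OF rI] w[OF rI] P_sobolev[OF \<mu>]] by simp
    then have eq: "blinfun_apply (gen N r) (y r) - P N ((- \<i>) *\<^sub>C K r (w r)) = blinfun_apply (gen N r) (?d r) + g r"
      by (simp add: blinfun.diff_right gen_apply[OF rI] P_P P_scaleC P.add P.diff g_def
          complex_vector.scale_right_distrib linear_neg[OF bounded_linear.linear[OF bounded_linear_P]])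
    show "(?d has_vector_derivative blinfun_apply (gen N r) (?d r) + g r) (at r within {min s t..max s t})"
      unfolding eq[symmetric]
      by (intro has_vector_derivative_diff y(3) r P.has_vector_derivative
          has_vector_derivative_within_subset[OF dw[OF rI] sub])
    have "inner (?d r) (blinfun_apply (gen N r) (?d r) + g r) = inner (?d r) (g r)"
      using gen_skew[OF rI] by (simp add: inner_add_right)
    also have "\<bar>\<dots>\<bar> \<le> norm (?d r) * norm (g r)"
      by (rule Cauchy_Schwarz_ineq2)
    also have "\<dots> \<le> norm (?d r) * (C * \<zeta>)"
      by (intro mult_left_mono g_le rI) simp
    finally show "\<bar>inner (?d r) (blinfun_apply (gen N r) (?d r) + g r)\<bar> \<le> C * \<zeta> * norm (?d r)"
      by (simp add: mult.commute)
  qed (use \<open>0 \<le> C\<close> \<open>0 \<le> \<zeta>\<close> in auto)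
  \<comment> \<open>The difference vanishes at \<open>s\<close>, one of the two endpoints; the
    two-sided bound of \<open>norm_growth\<close> covers both time directions.\<close>
  then have "norm (?d t) \<le> C * \<zeta> * \<bar>t - s\<bar>"
    using y(1) by (cases "s \<le> t") (simp_all add: max_def min_def)
  then show ?thesis
    by (simp add: y(2))
qed

end

context truncated_evolution
begin

text \<open>For \<open>s \<le> t\<close> the amplitudes are path sums, for \<open>t < s\<close>
  entries of the inverse, whose existence rests on skewness. The premise \<open>s \<noteq> t\<close>
  keeps the lemma applicable on a one-point interval.\<close>

lemma state_sum_eq:
  assumes N: "is_orthonormal_basis (complex_vector.dim (spectral_space T N)) e (spectral_space T N)"
    and I: "I = {a..b}" and t: "t \<in> I" and s: "s \<in> I" and \<tau>: "is_partition (min s t) (max s t) M \<tau>"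
    and skew: "s \<noteq> t \<Longrightarrow> skew_truncated_evolution T \<mu> I K"
  shows "state_sum T K e N t s M \<tau> u = approx_propagator T K N t s M \<tau> (P N u)"
proof -
  let ?d = "complex_vector.dim (spectral_space T N)" and ?V = "spectral_space T N"
  let ?A = "approx_propagator T K N t s M \<tau>"
  have V: "complex_vector.subspace ?V"
    by (rule closed_complex_subspace.subspace[OF spectral_space_closed_subspace])
  have \<tau>_in: "\<tau> j \<in> I" if "j \<le> M" for j
    using partition_subset[OF \<tau> _ _ that] s t I by blast
  \<comment> \<open>Padded by \<open>id\<close> from index \<open>M\<close> on, because
    \<open>path_sum_eq\<close> asks for linearity and invariance at every index, while the nodes are
    controlled only up to \<open>M\<close>.\<close>
  define E where "E j = (if j < M then short_step T K N \<tau> j else id)" for j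
  have E_lin: "complex_linear_on ?V (E j)" and E_in: "v \<in> ?V \<Longrightarrow> E j v \<in> ?V" for j v
    using \<tau>_in[of j] V flow_gen_linear[of "\<tau> j" "\<tau> (Suc j) - \<tau> j" N]
      flow_gen_in[of "\<tau> j" v N "\<tau> (Suc j) - \<tau> j"]
    by (auto simp: E_def short_step_eq complex_linear_on_def)
  have E_slices: "time_ordered E k = time_ordered (short_step T K N \<tau>) k" if "k \<le> M" for k
    using that by (induction k) (auto simp: E_def)
  have lin: "complex_linear_on ?V (slices N \<tau> M)"
    using slices_linear[of M \<tau> N] \<tau>_in V by (simp add: complex_linear_on_def)
  have A: "complex_linear_on ?V ?A \<and> (\<forall>v\<in>?V. ?A v \<in> ?V)"
  proof (cases "s \<le> t")
    case True
    then show ?thesis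
      using lin slices_in[of M \<tau>] \<tau>_in by (simp add: approx_propagator_def)
  next
    case False
    then interpret skew_truncated_evolution T \<mu> I K
      using skew by simp
    have bij: "bij_betw (slices N \<tau> M) ?V ?V"
      using \<tau>_in partition_step_le[OF \<tau>] by (intro slices_bij) auto
    then have "inv_into ?V (slices N \<tau> M) v \<in> ?V" if "v \<in> ?V" for v
      using that by (metis bij_betw_imp_surj_on inv_into_into)
    then show ?thesis
      using False complex_linear_on_inv_into[OF lin bij] by (simp add: approx_propagator_def)
  qed
  have amplitude: "amplitude T K e N t s M \<tau> a b = cinner (e a) (?A (e b))"
    if a: "a \<in> {1..?d}" and b: "b \<in> {1..?d}" for a b
  proof (cases "s \<le> t")
    case True
    have "(\<Sum>p \<in> {p \<in> {0..M} \<rightarrow>\<^sub>E {1..?d}. p 0 = b \<and> p M = a}.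
        \<Prod>j<M. cinner (e (p (Suc j))) (short_step T K N \<tau> j (e (p j)))) =
      (\<Sum>p \<in> {p \<in> {0..M} \<rightarrow>\<^sub>E {1..?d}. p 0 = b \<and> p M = a}.
        \<Prod>j<M. cinner (e (p (Suc j))) (E j (e (p j))))"
      by (intro sum.cong prod.cong) (simp_all add: E_def)
    also have "\<dots> = cinner (e a) (time_ordered E M (e b))"
      by (rule path_sum_eq[OF N E_lin E_in a b])
    finally show ?thesis
      using True by (simp add: amplitude_def approx_propagator_def E_slices)
  qed (simp add: amplitude_def)
  have "state_sum T K e N t s M \<tau> u =
      (\<Sum>a=1..?d. \<Sum>b=1..?d. (cinner (e a) (?A (e b)) * cinner (e b) u) *\<^sub>C e a)"
    unfolding state_sum_def by (intro sum.cong refl) (simp add: amplitude)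
  also have "\<dots> = ?A (P N u)"
  proof (rule matrix_sum_eq[OF N])
    show "P N u \<in> ?V"
      by (simp add: spectral_space_eq P_P)
    show "cinner (e b) u = cinner (e b) (P N u)" if "b \<in> {1..?d}" for b
      using cinner_P[OF orthonormal_basis_in[OF N that]] by simp
  qed (use A in auto)
  finally show ?thesis .
qed

end

section \<open>Convergence of the state sums\<close>

theorem corollary3p10:
  fixes H0 :: "'a::complex_hilbert operator"
    and H :: "real \<Rightarrow> 'a operator"
    and K :: "real \<Rightarrow> 'a \<Rightarrow> 'a"
    and U :: "real \<Rightarrow> real \<Rightarrow> 'a \<Rightarrow> 'a"
    and e :: "real \<Rightarrow> nat \<Rightarrow> 'a"
    and I :: "real set" and \<mu> :: real and u :: 'a
  assumes separable: "separable_space (euclidean :: 'a topology)"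
    and H0: "self_adjoint H0" "positive_operator H0" "compact_resolvent H0"
    and basis: "\<forall>N>0. is_orthonormal_basis (complex_vector.dim (spectral_space H0 N)) (e N)
                        (spectral_space H0 N)"
    and I: "\<exists>a b. a \<le> b \<and> I = {a..b}"
    and \<mu>: "0 \<le> \<mu>"
    and H: "\<forall>t\<in>I. symmetric_operator (H t)"
    and U: "unitary_propagator I U"
    and i: "\<forall>t\<in>I. sobolev_bounded H0 \<mu> (K t) \<and>
              (\<forall>v \<in> opdom (H t) \<inter> sobolev H0 \<mu>. K t v = opapp (H t) v)"
    and ii: "\<forall>t0\<in>I. ((\<lambda>t. sobolev_opnorm H0 \<mu> (\<lambda>v. K t v - K t0 v)) \<longlongrightarrow> 0) (at t0 within I)"
    and iii: "\<forall>t\<in>I. \<forall>s\<in>I. U t s ` sobolev H0 \<mu> \<subseteq> sobolev H0 \<mu>"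
      "\<forall>v \<in> sobolev H0 \<mu>. \<forall>t0\<in>I. \<forall>s0\<in>I.
         ((\<lambda>(t, s). sobolev_norm H0 \<mu> (U t s v - U t0 s0 v)) \<longlongrightarrow> 0) (at (t0, s0) within I \<times> I)"
    and iv: "\<forall>v \<in> sobolev H0 \<mu>. \<forall>s\<in>I. \<forall>t\<in>I.
         \<exists>D. ((\<lambda>t. U t s v) has_vector_derivative D) (at t within I) \<and> \<i> *\<^sub>C D = K t (U t s v)"
    and u: "u \<in> sobolev H0 \<mu>"
  shows "(\<exists>V :: real \<Rightarrow> real \<Rightarrow> real \<Rightarrow> 'a.
           (\<forall>N>0. uniform_mesh_limit I
              (\<lambda>t s M \<tau>. approx_propagator H0 K N t s M \<tau> (spectral_proj H0 N u)) (V N)) \<and>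
           (\<forall>N>0. uniform_mesh_limit I
              (\<lambda>t s M \<tau>. state_sum H0 K (e N) N t s M \<tau> u) (V N)) \<and>
           uniform_limit (I \<times> I) (\<lambda>N (t, s). V N t s) (\<lambda>(t, s). U t s u) at_top) \<and>
         (\<forall>N>0. \<forall>t\<in>I. \<forall>s\<in>I. \<forall>M \<tau>. is_partition (min s t) (max s t) M \<tau> \<longrightarrow>
           state_sum H0 K (e N) N t s M \<tau> u =
             approx_propagator H0 K N t s M \<tau> (spectral_proj H0 N u))"
proof -
  interpret truncated_evolution H0 \<mu> I K
    by standard (use H0 \<mu> i ii in auto)
  obtain a b where ab: "a \<le> b" and I_eq: "I = {a..b}"
    using I by blast
  have propagator_norm: "norm (U t s v) = norm v" if "t \<in> I" "s \<in> I" for t s v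
  proof -
    have "cinner (U t s v) (U t s v) = cinner v v"
      using U that by (auto simp: unitary_propagator_def unitary_operator_def)
    then have "(norm (U t s v))\<^sup>2 = (norm v)\<^sup>2"
      unfolding cinner_self of_real_eq_iff .
    then show ?thesis
      by simp
  qed
  have propagator_id: "U s s v = v" if "s \<in> I" for s v
    using U that by (auto simp: unitary_propagator_def)
  have dU: "((\<lambda>t. U t s v) has_vector_derivative (- \<i>) *\<^sub>C K t (U t s v)) (at t within I)"
    if v: "v \<in> sobolev H0 \<mu>" and "s \<in> I" "t \<in> I" for v s t
  proof -
    obtain D where D: "((\<lambda>t. U t s v) has_vector_derivative D) (at t within I)"
      "\<i> *\<^sub>C D = K t (U t s v)"
      using iv[rule_format, OF v \<open>s \<in> I\<close> \<open>t \<in> I\<close>] by blast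
    have "D = (- \<i>) *\<^sub>C K t (U t s v)"
      by (simp only: D(2)[symmetric] scaleC_scaleC) simp
    with D(1) show ?thesis
      by simp
  qed
  have U_sobolev: "U t s v \<in> sobolev H0 \<mu>" if "v \<in> sobolev H0 \<mu>" "t \<in> I" "s \<in> I" for v t s
    using iii(1) that by blast
  have skew: "skew_truncated_evolution H0 \<mu> I K" if "a < b"
  proof
    fix t v assume t: "t \<in> I" and v: "v \<in> sobolev H0 \<mu>"
    \<comment> \<open>A derivative within \<open>I\<close> is unique only at a limit point, which
      \<open>a < b\<close> provides.\<close>
    have bot: "at t within I \<noteq> bot"
      using t \<open>a < b\<close> I_eq by (simp add: trivial_limit_within islimpt_Icc)
    \<comment> \<open>Constant by unitarity; its derivative at \<open>r = t\<close> is twice the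
      inner product of \<open>v\<close> with \<open>- \<i>\<close> times
      \<open>K t v\<close>.\<close>
    let ?f = "\<lambda>r. inner (U r t v) (U r t v)"
    have "(?f has_vector_derivative
        inner (U t t v) ((- \<i>) *\<^sub>C K t (U t t v)) + inner ((- \<i>) *\<^sub>C K t (U t t v)) (U t t v)) (at t within I)"
      by (rule bounded_bilinear.has_vector_derivative[OF bounded_bilinear_inner dU[OF v t t] dU[OF v t t]])
    moreover have "(?f has_vector_derivative 0) (at t within I)"
    proof (rule has_vector_derivative_transform[OF t])
      show "?f r = (norm v)\<^sup>2" if "r \<in> I" for r
        using propagator_norm[OF that t, of v] by (simp add: dot_square_norm)
    qed (rule has_vector_derivative_const)
    ultimately have "inner v ((- \<i>) *\<^sub>C K t v) + inner ((- \<i>) *\<^sub>C K t v) v = 0"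
      using vector_derivative_unique_within[OF bot] propagator_id[OF t] by metis
    then show "inner v (\<i> *\<^sub>C K t v) = 0"
      by (simp add: inner_commute[of _ v])
  qed
  have skew': "skew_truncated_evolution H0 \<mu> I K" if "t \<in> I" "s \<in> I" "s \<noteq> t" for t s
    using skew that I_eq by force
  have sums: "state_sum H0 K (e N) N t s M \<tau> u = approx_propagator H0 K N t s M \<tau> (P N u)"
    if "0 < N" "t \<in> I" "s \<in> I" "is_partition (min s t) (max s t) M \<tau>" for N t s M \<tau>
    using basis that skew' by (intro state_sum_eq[OF _ I_eq]) auto
  have "\<exists>V. (\<forall>N>0. uniform_mesh_limit I (\<lambda>t s M \<tau>. approx_propagator H0 K N t s M \<tau> (P N u)) (V N)) \<and>
      uniform_limit (I \<times> I) (\<lambda>N (t, s). V N t s) (\<lambda>(t, s). U t s u) at_top"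
  proof (cases "a < b")
    case False
    then have singleton: "I = {a}"
      using I_eq ab by auto
    \<comment> \<open>The only partition has no steps, so the sliced product is the identity and the
      inner limit is \<open>P N u\<close>.\<close>
    have "uniform_mesh_limit I (\<lambda>t s M \<tau>. approx_propagator H0 K N t s M \<tau> (P N u)) (\<lambda>t s. P N u)" for N
      unfolding uniform_mesh_limit_def singleton
      by (auto simp: approx_propagator_def dest!: partition_trivial intro!: exI[of _ 1])
    moreover have "uniform_limit (I \<times> I) (\<lambda>N (t, s). P N u) (\<lambda>(t, s). U t s u) at_top"
      unfolding uniform_limit_iff singleton using P_tendsto[of u] propagator_id[of a u] singleton
      by (simp add: tendsto_iff)
    ultimately show ?thesis
      by (intro exI[of _ "\<lambda>N t s. P N u"]) blast
  next
    case True
    interpret skew_truncated_evolution H0 \<mu> I K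
      by (rule skew[OF True])
    \<comment> \<open>Continuity in the Sobolev norm, read as norm continuity of the weighted
      trajectory; this makes its range over \<open>I \<times> I\<close> compact.\<close>
    have cont: "continuous_on (I \<times> I) (\<lambda>(t, s). \<Lambda> \<mu> (U t s u))"
      unfolding continuous_on_def
    proof (intro ballI)
      fix x assume "x \<in> I \<times> I"
      then obtain t0 s0 where x: "x = (t0, s0)" "t0 \<in> I" "s0 \<in> I"
        by blast
      have lim: "((\<lambda>(t, s). sobolev_norm H0 \<mu> (U t s u - U t0 s0 u)) \<longlongrightarrow> 0) (at x within I \<times> I)"
        unfolding x(1) by (rule iii(2)[rule_format, OF u x(2,3)])
      have norm_eq: "sobolev_norm H0 \<mu> (U t s u - U t0 s0 u) = norm (\<Lambda> \<mu> (U t s u) - \<Lambda> \<mu> (U t0 s0 u))"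
        if "t \<in> I" "s \<in> I" for t s
        using U_sobolev[OF u] that x complex_vector.subspace_diff[OF sobolev_subspace[OF x(2)]]
        by (simp add: sobolev_norm_eq weight_diff)
      have "((\<lambda>(t, s). norm (\<Lambda> \<mu> (U t s u) - \<Lambda> \<mu> (U t0 s0 u))) \<longlongrightarrow> 0) (at x within I \<times> I)"
        by (rule Lim_transform_within[OF lim zero_less_one]) (auto simp: norm_eq)
      then show "((\<lambda>(t, s). \<Lambda> \<mu> (U t s u)) \<longlongrightarrow> (case x of (t, s) \<Rightarrow> \<Lambda> \<mu> (U t s u))) (at x within I \<times> I)"
        using x(1) by (subst Lim_null, subst tendsto_norm_zero_iff[symmetric]) (simp add: case_prod_unfold)
    qed
    have "compact I"
      by (simp add: I_eq)
    then have compact: "compact ((\<lambda>(t, s). \<Lambda> \<mu> (U t s u)) ` (I \<times> I))"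
      by (intro compact_continuous_image[OF cont] compact_Times)
    obtain C where "\<forall>x\<in>K_weighted ` I. norm x \<le> C"
      using compact_imp_bounded[OF compact_continuous_image[OF continuous_on_K_weighted \<open>compact I\<close>]]
      unfolding bounded_iff by blast
    then have C: "norm (K_weighted r) \<le> \<bar>C\<bar>" if "r \<in> I" for r
      using that by force
    have unif: "uniform_limit ((\<lambda>(t, s). \<Lambda> \<mu> (U t s u)) ` (I \<times> I)) P (\<lambda>x. x) at_top"
      by (rule uniform_limit_on_compact[OF compact _ P_tendsto])
        (simp add: dist_norm norm_P_le flip: P.diff)
    have "uniform_limit (I \<times> I) (\<lambda>N (t, s). truncated_propagator N t s (P N u)) (\<lambda>(t, s). U t s u) at_top"
    proof (rule uniform_limitI)
      fix \<epsilon> :: real assume "0 < \<epsilon>"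
      \<comment> \<open>\<open>\<bar>C\<bar> * (b - a)\<close> accounts for the propagation error,
        \<open>1\<close> for the truncation of \<open>U t s u\<close> itself.\<close>
      define c where "c = \<bar>C\<bar> * (b - a) + 1"
      have "0 < c"
        unfolding c_def using ab by (intro add_nonneg_pos) auto
      then have "0 < \<epsilon> / c"
        using \<open>0 < \<epsilon>\<close> by simp
      from uniform_limitD[OF unif this]
      show "\<forall>\<^sub>F N in at_top. \<forall>x\<in>I \<times> I. dist (case x of (t, s) \<Rightarrow> truncated_propagator N t s (P N u))
          (case x of (t, s) \<Rightarrow> U t s u) < \<epsilon>"
      proof (rule eventually_mono, intro ballI)
        fix N x assume near: "\<forall>x\<in>(\<lambda>(t, s). \<Lambda> \<mu> (U t s u)) ` (I \<times> I). dist (P N x) x < \<epsilon> / c"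
          and "x \<in> I \<times> I"
        then obtain t s where x: "x = (t, s)" and t: "t \<in> I" and s: "s \<in> I"
          by blast
        have tail: "norm (\<Lambda> \<mu> (U r s u) - P N (\<Lambda> \<mu> (U r s u))) < \<epsilon> / c" if "r \<in> I" for r
          using near that s by (auto simp: dist_norm norm_minus_commute)
        have "norm (truncated_propagator N t s (P N (U s s u)) - P N (U t s u)) \<le> \<bar>C\<bar> * (\<epsilon> / c) * \<bar>t - s\<bar>"
          using U_sobolev[OF u _ s] dU[OF u s] less_imp_le[OF tail]
          by (intro truncation_error[OF I_eq s t C]) auto
        also have "\<dots> \<le> \<bar>C\<bar> * (\<epsilon> / c) * (b - a)"
          using \<open>0 < \<epsilon> / c\<close> s t I_eq by (intro mult_left_mono mult_nonneg_nonneg) (auto intro: less_imp_le)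
        finally have "norm (truncated_propagator N t s (P N u) - P N (U t s u)) \<le> \<bar>C\<bar> * (\<epsilon> / c) * (b - a)"
          by (simp add: propagator_id[OF s])
        moreover have "norm (P N (U t s u) - U t s u) < \<epsilon> / c"
        proof -
          have Us: "U t s u \<in> sobolev H0 \<mu>"
            by (rule U_sobolev[OF u t s])
          have Ud: "U t s u - P N (U t s u) \<in> sobolev H0 \<mu>"
            using complex_vector.subspace_diff[OF sobolev_subspace[OF t] Us P_sobolev[OF \<mu>]] .
          \<comment> \<open>The weight dominates the norm, so the same weighted tail controls this
            second contribution.\<close>
          have "norm (U t s u - P N (U t s u)) \<le> norm (\<Lambda> \<mu> (U t s u - P N (U t s u)))"
            by (rule norm_le_weight[OF \<mu> Ud])
          also have "\<dots> = norm (\<Lambda> \<mu> (U t s u) - P N (\<Lambda> \<mu> (U t s u)))"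
            by (simp add: weight_diff[OF Us P_sobolev[OF \<mu>] Ud] weight_P_commute[OF \<mu> Us])
          also have "\<dots> < \<epsilon> / c"
            by (rule tail[OF t])
          finally show ?thesis
            by (simp add: norm_minus_commute)
        qed
        ultimately have "norm (truncated_propagator N t s (P N u) - U t s u) < \<bar>C\<bar> * (\<epsilon> / c) * (b - a) + \<epsilon> / c"
          using norm_triangle_lt[of "truncated_propagator N t s (P N u) - P N (U t s u)" "P N (U t s u) - U t s u"]
          by force
        also have "\<bar>C\<bar> * q * (b - a) + q = c * q" for q
          by (simp add: c_def algebra_simps)
        also have "c * (\<epsilon> / c) = \<epsilon>"
          using \<open>0 < c\<close> by simp
        finally show "dist (case x of (t, s) \<Rightarrow> truncated_propagator N t s (P N u)) (case x of (t, s) \<Rightarrow> U t s u) < \<epsilon>"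
          by (simp add: x dist_norm)
      qed
    qed
    then show ?thesis
      using time_slicing_converges[OF I_eq] by (intro exI[of _ "\<lambda>N t s. truncated_propagator N t s (P N u)"]) blast
  qed
  then obtain V where V:
    "\<And>N. 0 < N \<Longrightarrow> uniform_mesh_limit I (\<lambda>t s M \<tau>. approx_propagator H0 K N t s M \<tau> (P N u)) (V N)"
    "uniform_limit (I \<times> I) (\<lambda>N (t, s). V N t s) (\<lambda>(t, s). U t s u) at_top"
    by blast
  have "uniform_mesh_limit I (\<lambda>t s M \<tau>. state_sum H0 K (e N) N t s M \<tau> u) (V N)" if "0 < N" for N
    using V(1)[OF that] sums[OF that] by (rule uniform_mesh_limit_cong)
  with V sums show ?thesis
    by blast
qed

end
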